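(* Let $\mu$ be a singular cardinal and $\lambda$ a cardinal. If $\mathfrak{a}_\mu\leqslant\lambda<\mathfrak{b}_\mu$, then $\lambda\in\operatorname{MAD}(\mu)$. Moreover, if $\mathfrak{b}_\mu$ is the successor of a regular cardinal and $\mathfrak{a}_\mu\leqslant\mathfrak{b}_\mu$, then $\mathfrak{b}_\mu\in\operatorname{MAD}(\mu)$.
   Context: For an infinite cardinal $\mu$, a family of sets $\mathcal{A}$ is $\mu$-almost disjoint if $|A|=\mu=|\bigcup\mathcal{A}|$ for every $A\in\mathcal{A}$ and $|A\cap B|<\mu$ for all distinct $A,B\in\mathcal{A}$; it is $\mu$-mad if moreover there is no $C\subseteq\bigcup\mathcal{A}$ with $\mathcal{A}\cup\{C\}$ $\mu$-almost disjoint. Such a family with fewer than $\operatorname{cf}\mu$ members is trivial. $\operatorname{MAD}(\mu)$ is the set of cardinalities of nontrivial $\mu$-mad families and $\mathfrak{a}_\mu=\min\operatorname{MAD}(\mu)$. For a quasi-order $(P,\le)$ without maximum, $\mathfrak{b}(P,\le)$ is the least size of an unbounded subset. For singular $\mu$ of cofinality $\kappa$, $\mathfrak{b}_\mu$ is the supremum of $\mathfrak{b}(\prod_{i<\kappa}\mu_i,\leqslant^* )$ over all strictly increasing sequences $\langle\mu_i:i<\kappa\rangle$ of regular cardinals with supremum $\mu$, where $f\leqslant^* g$ iff $\{i<\kappa: f(i)>g(i)\}$ is bounded in $\kappa$. *)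

theory Defs
  imports Main "HOL-Library.FuncSet"
begin

unbundle cardinal_syntax

text \<open>
  Cardinals are relations \<open>r\<close> with \<open>Card_order r\<close>, compared up to \<open>=o\<close>. In particular they may
  live on different types, and a set of cardinals is a set of such relations in which each
  cardinal need only occur up to \<open>=o\<close>; hence the following membership relation.
\<close>

definition cmem :: "'b rel \<Rightarrow> 'a rel set \<Rightarrow> bool" (infix "\<in>c" 50) where
  "l \<in>c R \<longleftrightarrow> (\<exists>s\<in>R. l =o s)"

text \<open>
  \<open>cmin R\<close> is meaningful (and determined up to \<open>=o\<close>) for every nonempty \<open>R\<close> consisting of cardinals,
  by \<open>exists_minim_Card_order\<close>.
\<close>

definition cmin :: "'a rel set \<Rightarrow> 'a rel" where
  "cmin R = (SOME r. r \<in> R \<and> (\<forall>s\<in>R. r \<le>o s))"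

text \<open>
  The least upper bound on the same type always exists, and it is the least one among all types:
  all cardinals on \<open>'a\<close> are bounded by \<open>|UNIV :: 'a set|\<close>, and a cardinal below a cardinal on
  \<open>'a\<close> has a copy on \<open>'a\<close>.
\<close>

definition csup :: "'a rel set \<Rightarrow> 'a rel" where
  "csup R = cmin {s. Card_order s \<and> (\<forall>r\<in>R. r \<le>o s)}"

definition cf :: "'a rel \<Rightarrow> 'a rel" where
  "cf r = cmin {|K| | K. K \<subseteq> Field r \<and> cofinal K r}"

definition regular_card :: "'a rel \<Rightarrow> bool" where
  "regular_card r \<longleftrightarrow> Cinfinite r \<and> regularCard r"

definition singular_card :: "'a rel \<Rightarrow> bool" where
  "singular_card r \<longleftrightarrow> Cinfinite r \<and> \<not> regularCard r"

definition almost_disjoint :: "'a rel \<Rightarrow> 'c set set \<Rightarrow> bool" where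
  "almost_disjoint r \<A> \<longleftrightarrow>
     (\<forall>A\<in>\<A>. |A| =o r \<and> |\<Union>\<A>| =o r) \<and>
     (\<forall>A\<in>\<A>. \<forall>B\<in>\<A>. A \<noteq> B \<longrightarrow> |A \<inter> B| <o r)"

text \<open>
  The set \<open>C\<close> has to be new: for \<open>C \<in> \<A>\<close> the family \<open>\<A> \<union> {C}\<close> is just \<open>\<A>\<close>.
\<close>

definition mad :: "'a rel \<Rightarrow> 'c set set \<Rightarrow> bool" where
  "mad r \<A> \<longleftrightarrow> almost_disjoint r \<A> \<and>
     \<not> (\<exists>C. C \<subseteq> \<Union>\<A> \<and> C \<notin> \<A> \<and> almost_disjoint r (\<A> \<union> {C}))"

definition trivial_family :: "'a rel \<Rightarrow> 'c set set \<Rightarrow> bool" where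
  "trivial_family r \<A> \<longleftrightarrow> |\<A>| <o cf r"

text \<open>
  Only families of subsets of \<open>'a\<close> are collected. This loses no cardinality: a nonempty \<open>r\<close>-almost
  disjoint family has a union of size \<open>r\<close>, which can be replaced by \<open>Field r\<close> along a bijection.
\<close>

definition MAD :: "'a rel \<Rightarrow> 'a set rel set" where
  "MAD r = {|\<A>| | \<A> :: 'a set set. mad r \<A> \<and> \<not> trivial_family r \<A>}"

definition a_num :: "'a rel \<Rightarrow> 'a set rel" where
  "a_num r = cmin (MAD r)"

definition bounding_number :: "'p set \<Rightarrow> ('p \<Rightarrow> 'p \<Rightarrow> bool) \<Rightarrow> 'p rel" where
  "bounding_number P le = cmin {|B| | B. B \<subseteq> P \<and> \<not> (\<exists>p\<in>P. \<forall>x\<in>B. le x p)}"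

text \<open>
  Sequences of cardinals below \<open>r\<close> of length \<open>\<kappa>\<close> are functions \<open>m\<close> considered on \<open>Field k\<close>, where
  the cardinal \<open>k\<close> represents \<open>\<kappa>\<close>; the product is \<open>\<Pi>\<^sub>E i\<in>Field k. Field (m i)\<close>, the \<open>i\<close>-th
  coordinates being compared by the well-order \<open>m i\<close>.
\<close>

definition regular_seq :: "'i rel \<Rightarrow> 'a rel \<Rightarrow> ('i \<Rightarrow> 'a rel) \<Rightarrow> bool" where
  "regular_seq k r m \<longleftrightarrow>
     (\<forall>i\<in>Field k. regular_card (m i)) \<and>
     (\<forall>i j. (i, j) \<in> k \<and> i \<noteq> j \<longrightarrow> m i <o m j) \<and>
     csup (m ` Field k) =o r"

definition bounded_in :: "'i rel \<Rightarrow> 'i set \<Rightarrow> bool" where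
  "bounded_in k X \<longleftrightarrow> (\<exists>j\<in>Field k. \<forall>i\<in>X. (i, j) \<in> k)"

definition le_star :: "'i rel \<Rightarrow> ('i \<Rightarrow> 'a rel) \<Rightarrow> ('i \<Rightarrow> 'a) \<Rightarrow> ('i \<Rightarrow> 'a) \<Rightarrow> bool" where
  "le_star k m f g \<longleftrightarrow> bounded_in k {i \<in> Field k. (g i, f i) \<in> m i \<and> g i \<noteq> f i}"

text \<open>
  The type \<open>'a\<close> suffices for the terms of the sequences, since they are cardinals below \<open>r\<close>.
\<close>

definition b_num :: "'a rel \<Rightarrow> ('a \<Rightarrow> 'a) rel" where
  "b_num r = csup {bounding_number (\<Pi>\<^sub>E i\<in>Field (cf r). Field (m i)) (le_star (cf r) m) | m.
     regular_seq (cf r) r m}"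

end

theory Submission
  imports Defs
begin

text \<open>
  Let \<open>k = cf \<mu>\<close> and let \<open>m\<close> be a sequence of regular cardinals with supremum \<open>\<mu>\<close> whose bounding
  number exceeds \<open>l\<close> (or equals \<open>l = \<nu>\<^sup>+\<close> with \<open>\<nu>\<close> regular). Take a \<open>\<le>\<^sup>*\<close>-increasing chain of
  functions \<open>f\<^sub>d\<close>, \<open>d < l\<close>, in the product and let \<open>X\<^sub>d\<close> be the region below the graph of \<open>f\<^sub>d\<close>.
  If \<open>f\<^sub>d\<close> is a least upper bound of the earlier functions and \<open>d\<close> does not have cofinality \<open>k\<close>,
  then no set of size \<open>\<mu>\<close> inside \<open>X\<^sub>d\<close> is almost disjoint from all earlier regions: such a set
  would yield a smaller upper bound. At successors and at points of cofinality \<open>k\<close>, a given mad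
  family of size at most \<open>l\<close> is copied so that its first \<open>k\<close> members become the earlier regions,
  and the remaining ones catch all sets that are new in \<open>X\<^sub>d\<close>. The union of these pieces is a mad
  family of size \<open>l\<close>.

  Least upper bounds exist at cofinality \<open>k\<^sup>+\<close> if the chain is built to dominate, at each stage, the
  suprema of the initial parts of a cofinal set chosen in advance. There are few enough of these
  when \<open>l\<close> lies below the bounding number, and when \<open>l = \<nu>\<^sup>+\<close> because points of cofinality less
  than \<open>\<nu>\<close> are approachable. At larger cofinalities one descends through upper bounds as in
  Shelah's trichotomy theorem; the points of cofinality \<open>k\<^sup>+\<close> exclude the bad cases.
\<close>

subsection \<open>Well-orders and cardinals\<close>

text \<open>Every stage of the chain has to obey at most \<open>n\<close> requests, so
  \<open>n\<close> must stay below the bounding number. If \<open>l\<close> is below it,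
  \<open>n = l\<close> is allowed. If \<open>l\<close> equals it, only the predecessor
  \<open>\<nu>\<close> is left and at most \<open>\<nu>\<close> sets may be listed per stage; this
  is where regularity of \<open>\<nu>\<close> enters. Cofinality \<open>k\<close> is exceptional for
  one reason: an inclusion modulo bounded sets has a threshold in \<open>Field k\<close>. Along a
  limit of any other cofinality unboundedly many members share a threshold, while \<open>k\<close>
  many thresholds may be unbounded in \<open>k\<close>. So least upper bounds cannot be expected
  there and the given mad family is imported. It must have at least \<open>k\<close> members, which
  is what nontriviality says, and at most \<open>l\<close>, so that all pieces together do not
  exceed \<open>l\<close>. Mere least upper bounds suffice, not exact ones: a large set almost
  disjoint from all earlier regions would allow the bound to be lowered on unboundedly many
  coordinates. The final family has no fewer than \<open>l\<close> members because at every
  successor stage the region gains \<open>\<mu>\<close> points, which forces a new member.\<close>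

lemma Well_order_refl: "Well_order r \<Longrightarrow> a \<in> Field r \<Longrightarrow> (a, a) \<in> r"
  using wo_rel.REFL[of r] by (auto simp: wo_rel_def refl_on_def)

lemma Well_order_trans: "Well_order r \<Longrightarrow> (a, b) \<in> r \<Longrightarrow> (b, c) \<in> r \<Longrightarrow> (a, c) \<in> r"
  using wo_rel.TRANS[of r] by (auto simp: wo_rel_def trans_def)

lemma Well_order_antisym: "Well_order r \<Longrightarrow> (a, b) \<in> r \<Longrightarrow> (b, a) \<in> r \<Longrightarrow> a = b"
  using wo_rel.ANTISYM[of r] by (auto simp: wo_rel_def antisym_def)

lemma Well_order_linear:
  "Well_order r \<Longrightarrow> a \<in> Field r \<Longrightarrow> b \<in> Field r \<Longrightarrow> (a, b) \<in> r \<or> b \<in> underS r a"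
  using wo_rel.TOTALS[of r] Well_order_refl[of r b] by (auto simp: wo_rel_def underS_def)

lemma in_underS_iff: "b \<in> underS r a \<longleftrightarrow> (b, a) \<in> r \<and> b \<noteq> a"
  by (auto simp: underS_def)

lemma in_underS_Field: "b \<in> underS r a \<Longrightarrow> b \<in> Field r \<and> a \<in> Field r"
  by (auto simp: underS_def Field_def)

lemma underS_trans1: "Well_order r \<Longrightarrow> (a, b) \<in> r \<Longrightarrow> b \<in> underS r c \<Longrightarrow> a \<in> underS r c"
  using Well_order_trans Well_order_antisym unfolding in_underS_iff by metis

lemma underS_trans2: "Well_order r \<Longrightarrow> a \<in> underS r b \<Longrightarrow> (b, c) \<in> r \<Longrightarrow> a \<in> underS r c"
  using Well_order_trans Well_order_antisym unfolding in_underS_iff by metis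

lemma ofilter_mem: "ofilter r S \<Longrightarrow> b \<in> S \<Longrightarrow> (a, b) \<in> r \<Longrightarrow> a \<in> S"
  by (auto simp: ofilter_def under_def)

lemma ofilter_subset_Field: "ofilter r S \<Longrightarrow> S \<subseteq> Field r"
  by (auto simp: ofilter_def)

lemma ofilter_underS: "Well_order r \<Longrightarrow> ofilter r (underS r a)"
  using wo_rel.underS_ofilter[of r] by (simp add: wo_rel_def)

lemma ofilter_linear: "Well_order r \<Longrightarrow> ofilter r A \<Longrightarrow> ofilter r B \<Longrightarrow> A \<subseteq> B \<or> B \<subseteq> A"
  using wo_rel.ofilter_linord[of r A B] by (simp add: wo_rel_def)

lemma Well_order_min:
  assumes "Well_order r" "A \<subseteq> Field r" "A \<noteq> {}"
  obtains a where "a \<in> A" "\<And>b. b \<in> A \<Longrightarrow> (a, b) \<in> r"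
  using wo_rel.minim_in[of r A] wo_rel.minim_least[of r A] assms by (auto simp: wo_rel_def)

text \<open>Initial segments are well-ordered by inclusion. A segment omitting the minimum
  \<open>a\<close> of \<open>T0 - \<Inter>\<T>\<close> is least: any of its points outside the
  intersection would lie in \<open>T0\<close> at or above \<open>a\<close> and force
  \<open>a\<close> in.\<close>

lemma ofilter_least:
  assumes r: "Well_order r" and T: "\<T> \<noteq> {}" "\<And>T. T \<in> \<T> \<Longrightarrow> ofilter r T"
  shows "\<exists>T\<in>\<T>. \<forall>T'\<in>\<T>. T \<subseteq> T'"
proof (rule ccontr)
  assume neg: "\<not> ?thesis"
  obtain T0 where T0: "T0 \<in> \<T>" using T by blast
  let ?I = "\<Inter>\<T>"
  have "T0 - ?I \<noteq> {}" using neg T0 by blast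
  moreover have "T0 - ?I \<subseteq> Field r" using T(2)[OF T0] by (auto simp: ofilter_def)
  ultimately obtain a where a: "a \<in> T0 - ?I" "\<And>b. b \<in> T0 - ?I \<Longrightarrow> (a, b) \<in> r"
    using Well_order_min[OF r] by metis
  then obtain T1 where T1: "T1 \<in> \<T>" "a \<notin> T1" by blast
  obtain b where b: "b \<in> T1" "b \<notin> ?I" using neg T1 by blast
  have "T1 \<subseteq> T0" using ofilter_linear[OF r T(2)[OF T0] T(2)[OF T1(1)]] a T1 by blast
  with a b have "(a, b) \<in> r" by blast
  with T(2)[OF T1(1)] b(1) T1(2) show False by (auto dest: ofilter_mem)
qed

lemma Card_order_Well_order: "Card_order r \<Longrightarrow> Well_order r"
  by (rule card_order_on_well_order_on)

lemma Cinfinite_Well_order: "Cinfinite r \<Longrightarrow> Well_order r"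
  by (simp add: Card_order_Well_order)

text \<open>Infinite cardinals have no last element, so every point has an immediate successor. This
  turns \<open>under\<close> into \<open>underS\<close>, for which size and boundedness facts are
  available.\<close>

lemma Cinfinite_succ:
  assumes r: "Cinfinite r" and a: "a \<in> Field r"
  shows "\<exists>b\<in>Field r. underS r b = under r a"
proof -
  have w: "Well_order r" using r by (rule Cinfinite_Well_order)
  obtain c where c: "c \<in> Field r" "a \<noteq> c" "(a, c) \<in> r"
    using infinite_Card_order_limit[of r a] r a by (auto simp: cinfinite_def)
  then have "aboveS r a \<noteq> {}" "aboveS r a \<subseteq> Field r" by (auto simp: aboveS_def Field_def)
  then obtain b where b: "b \<in> aboveS r a" "\<And>c. c \<in> aboveS r a \<Longrightarrow> (b, c) \<in> r"
    using Well_order_min[OF w] by metis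
  have b': "(a, b) \<in> r" "a \<noteq> b" "b \<in> Field r" using b(1) by (auto simp: aboveS_def Field_def)
  have "underS r b = under r a"
  proof (intro equalityI subsetI)
    fix x assume x: "x \<in> underS r b"
    then have xF: "x \<in> Field r" by (simp add: in_underS_Field)
    show "x \<in> under r a"
    proof (rule ccontr)
      assume "x \<notin> under r a"
      then have "a \<in> underS r x" using Well_order_linear[OF w xF a] by (auto simp: under_def)
      then have "x \<in> aboveS r a" by (auto simp: aboveS_def underS_def)
      then have "(b, x) \<in> r" by (rule b(2))
      with x show False using Well_order_antisym[OF w] by (auto simp: in_underS_iff)
    qed
  next
    fix x assume "x \<in> under r a"
    then show "x \<in> underS r b"
      using b' Well_order_trans[OF w] Well_order_antisym[OF w] by (auto simp: under_def in_underS_iff)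
  qed
  with b' show ?thesis by blast
qed

lemma card_of_ordLess_or_ordLeq: "Well_order r \<Longrightarrow> |A| <o r \<or> r \<le>o |A|"
  by (rule ordLess_or_ordLeq[OF card_of_Well_order])

lemma regular_bounded:
  assumes r: "regular_card r" and A: "A \<subseteq> Field r" "|A| <o r"
  shows "\<exists>b\<in>Field r. A \<subseteq> underS r b"
proof -
  have c: "Cinfinite r" "regularCard r" using r by (auto simp: regular_card_def)
  have w: "Well_order r" using c by (simp add: Cinfinite_Well_order)
  have "\<not> cofinal A r"
    using c A not_ordLess_ordIso by (auto simp: regularCard_def)
  then obtain a where a: "a \<in> Field r" "\<And>b. b \<in> A \<Longrightarrow> a = b \<or> (a, b) \<notin> r"
    by (auto simp: cofinal_def)
  obtain b where b: "b \<in> Field r" "underS r b = under r a"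
    using Cinfinite_succ[OF c(1) a(1)] by blast
  have "A \<subseteq> under r a"
  proof
    fix x assume "x \<in> A"
    then show "x \<in> under r a"
      using a A Well_order_linear[OF w, of x a] Well_order_refl[OF w a(1)]
      by (auto simp: under_def underS_def)
  qed
  with b show ?thesis by auto
qed

lemma regular_cardSuc: "Cinfinite r \<Longrightarrow> regular_card (cardSuc r)"
  by (simp add: regular_card_def Cinfinite_cardSuc regularCard_cardSuc)

lemma cardSuc_bounded:
  assumes "Cinfinite r" "A \<subseteq> Field (cardSuc r)" "|A| \<le>o r"
  shows "\<exists>b\<in>Field (cardSuc r). A \<subseteq> underS (cardSuc r) b"
  using assms regular_bounded[OF regular_cardSuc] cardSuc_greater ordLeq_ordLess_trans by blast

lemma card_of_Field_ordLeq: "Card_order r \<Longrightarrow> |Field r| \<le>o r"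
  by (rule ordIso_imp_ordLeq[OF card_of_Field_ordIso])

lemma ordLeq_card_of_Field: "Card_order r \<Longrightarrow> r \<le>o |Field r|"
  by (rule ordIso_imp_ordLeq[OF ordIso_symmetric[OF card_of_Field_ordIso]])

lemma card_of_image_ordLeq: "|A| \<le>o r \<Longrightarrow> |f ` A| \<le>o r"
  using card_of_image ordLeq_transitive by blast

lemma card_of_image_ordLess: "|A| <o r \<Longrightarrow> |f ` A| <o r"
  using card_of_image ordLeq_ordLess_trans by blast

lemma card_of_inj_image: "inj_on f A \<Longrightarrow> |f ` A| =o |A|"
  by (rule ordIso_symmetric[OF card_of_ordIsoI[OF inj_on_imp_bij_betw]])

lemma card_of_subset_ordLeq: "A \<subseteq> B \<Longrightarrow> |B| \<le>o r \<Longrightarrow> |A| \<le>o r"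
  using card_of_mono1 ordLeq_transitive by blast

lemma card_of_subset_ordLess: "A \<subseteq> B \<Longrightarrow> |B| <o r \<Longrightarrow> |A| <o r"
  using card_of_mono1 ordLeq_ordLess_trans by blast

lemma card_of_insert_ordLeq:
  assumes "Cinfinite r" "|A| \<le>o r" shows "|insert a A| \<le>o r"
proof -
  have "|{a}| \<le>o r" using assms(1)
    by (intro Card_order_singl_ordLeq) (auto simp: cinfinite_def)
  then have "|{a} \<union> A| \<le>o r" using assms Un_Cinfinite_bound by blast
  then show ?thesis by simp
qed

subsection \<open>Products of regular cardinals modulo bounded sets\<close>

lemma ofilterI: "A \<subseteq> Field r \<Longrightarrow> (\<And>a b. b \<in> A \<Longrightarrow> (a, b) \<in> r \<Longrightarrow> a \<in> A) \<Longrightarrow> ofilter r A"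
  unfolding ofilter_def under_def by blast

lemma ofilter_UN:
  assumes "\<And>a. a \<in> I \<Longrightarrow> ofilter r (X a)" shows "ofilter r (\<Union>a\<in>I. X a)"
proof (rule ofilterI)
  show "(\<Union>a\<in>I. X a) \<subseteq> Field r" using ofilter_subset_Field[OF assms] by blast
  fix x y assume "y \<in> (\<Union>a\<in>I. X a)" "(x, y) \<in> r"
  then show "x \<in> (\<Union>a\<in>I. X a)" using ofilter_mem[OF assms] by blast
qed

lemma ofilter_INT:
  assumes "I \<noteq> {}" "\<And>a. a \<in> I \<Longrightarrow> ofilter r (X a)" shows "ofilter r (\<Inter>a\<in>I. X a)"
proof (rule ofilterI)
  show "(\<Inter>a\<in>I. X a) \<subseteq> Field r" using assms(1) ofilter_subset_Field[OF assms(2)] by blast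
  fix x y assume "y \<in> (\<Inter>a\<in>I. X a)" "(x, y) \<in> r"
  then show "x \<in> (\<Inter>a\<in>I. X a)" using ofilter_mem[OF assms(2)] by blast
qed

lemma ofilter_Int: "ofilter r A \<Longrightarrow> ofilter r B \<Longrightarrow> ofilter r (A \<inter> B)"
  using ofilter_INT[of "{A, B}" r id] by auto

lemma ofilter_Field: "ofilter r (Field r)"
  by (rule ofilterI) (auto simp: Field_def)

lemma ofilter_empty: "ofilter r {}"
  by (rule ofilterI) auto

text \<open>The filter dual to the ideal of bounded subsets of \<open>k\<close>. Written as a
  filter, thresholds are merged by \<open>eventually_elim\<close> instead of by explicit
  maxima.\<close>

definition tail :: "'i rel \<Rightarrow> 'i filter" where
  "tail k = (INF j\<in>Field k. principal (aboveS k j))"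

lemma eventually_tail:
  assumes k: "Cinfinite k"
  shows "eventually P (tail k) \<longleftrightarrow> (\<exists>j\<in>Field k. \<forall>i. j \<in> underS k i \<longrightarrow> P i)"
proof -
  have w: "Well_order k" using k by (rule Cinfinite_Well_order)
  have "eventually P (tail k) \<longleftrightarrow> (\<exists>j\<in>Field k. eventually P (principal (aboveS k j)))"
    unfolding tail_def
  proof (rule eventually_INF_base)
    show "Field k \<noteq> {}" using k by (auto simp: cinfinite_def)
    fix a b assume ab: "a \<in> Field k" "b \<in> Field k"
    have *: "(c, d) \<in> k \<Longrightarrow> aboveS k d \<subseteq> aboveS k c" for c d
      using underS_trans1[OF w, of c d] by (auto simp: aboveS_def in_underS_iff)
    have "(a, b) \<in> k \<or> (b, a) \<in> k"
      using Well_order_linear[OF w ab] by (auto simp: in_underS_iff)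
    then have "aboveS k b \<subseteq> aboveS k a \<or> aboveS k a \<subseteq> aboveS k b"
      using * by blast
    then show "\<exists>x\<in>Field k. principal (aboveS k x) \<le> inf (principal (aboveS k a)) (principal (aboveS k b))"
      using ab by auto
  qed
  moreover have "i \<in> aboveS k j \<longleftrightarrow> j \<in> underS k i" for i j
    by (auto simp: aboveS_def underS_def)
  ultimately show ?thesis by (simp add: eventually_principal Ball_def)
qed

definition unbounded_in :: "'a rel \<Rightarrow> 'a set \<Rightarrow> 'a set \<Rightarrow> bool" where
  "unbounded_in r S x \<longleftrightarrow> x \<subseteq> S \<and> (\<forall>a\<in>S. \<exists>b\<in>x. (a, b) \<in> r)"

text \<open>
  This holds for \<open>S\<close> of cofinality \<open>k\<close>, and also for \<open>S\<close> with a maximum, through a constant \<open>g\<close>.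
\<close>

definition reached :: "'i rel \<Rightarrow> 'b rel \<Rightarrow> 'b set \<Rightarrow> bool" where
  "reached k r S \<longleftrightarrow> (\<exists>g. (\<forall>i\<in>Field k. g i \<in> S) \<and>
     (\<forall>a\<in>S. \<exists>i\<in>Field k. \<forall>j. (i, j) \<in> k \<longrightarrow> (a, g j) \<in> r))"

text \<open>
  A function in the product is replaced by the initial segments its values determine, so that
  \<open>\<le>\<^sup>*\<close> becomes inclusion on a tail and pointwise suprema become unions; a full segment
  \<open>Field (m i)\<close> serves as the value \<open>m i\<close> itself, outside the product.
\<close>

definition initial :: "'i rel \<Rightarrow> ('i \<Rightarrow> 'a rel) \<Rightarrow> ('i \<Rightarrow> 'a set) \<Rightarrow> bool" where
  "initial k m X \<longleftrightarrow> (\<forall>i\<in>Field k. ofilter (m i) (X i))"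

definition small :: "'i rel \<Rightarrow> ('i \<Rightarrow> 'a rel) \<Rightarrow> ('i \<Rightarrow> 'a set) \<Rightarrow> bool" where
  "small k m X \<longleftrightarrow> initial k m X \<and> (\<forall>\<^sub>F i in tail k. X i \<noteq> Field (m i))"

definition below :: "'i rel \<Rightarrow> ('i \<Rightarrow> 'a set) \<Rightarrow> ('i \<Rightarrow> 'a set) \<Rightarrow> bool" where
  "below k X Y \<longleftrightarrow> (\<forall>\<^sub>F i in tail k. X i \<subseteq> Y i)"

text \<open>\<open>Z\<close> and its competitors \<open>h\<close> need only be
  \<open>initial\<close>, so a least upper bound may be full on unboundedly many coordinates and
  thus leave the product. \<open>step_exists\<close> cuts such a \<open>Z\<close> back into the
  product.\<close>

definition lub_on :: "'i rel \<Rightarrow> ('i \<Rightarrow> 'a rel) \<Rightarrow> ('b \<Rightarrow> 'i \<Rightarrow> 'a set) \<Rightarrow> 'b set \<Rightarrow> ('i \<Rightarrow> 'a set) \<Rightarrow> bool" where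
  "lub_on k m X S Z \<longleftrightarrow> initial k m Z \<and> (\<forall>a\<in>S. below k (X a) Z) \<and>
     (\<forall>h. initial k m h \<and> (\<forall>a\<in>S. below k (X a) h) \<longrightarrow> below k Z h)"

text \<open>\<open>k_bounded\<close> is the regularity of \<open>k\<close> in the form used
  throughout. \<open>m_cofinal\<close> speaks of sets over one type because an assumption is
  monomorphic; \<open>m_cofinal'\<close> extends it to all types.\<close>

locale singular_sequence =
  fixes \<mu> :: "'a rel" and k :: "'i rel" and m :: "'i \<Rightarrow> 'a rel"
  assumes mu: "Cinfinite \<mu>" and k: "Cinfinite k" and k_less: "k <o \<mu>"
    and k_bounded: "\<And>H. H \<subseteq> Field k \<Longrightarrow> |H| <o k \<Longrightarrow> \<exists>j\<in>Field k. H \<subseteq> under k j"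
    and m_regular: "\<And>i. i \<in> Field k \<Longrightarrow> regular_card (m i)"
    and m_less: "\<And>i. i \<in> Field k \<Longrightarrow> m i <o \<mu>"
    and m_mono: "\<And>i j. i \<in> underS k j \<Longrightarrow> m i <o m j"
    and m_cofinal: "\<And>A :: 'a set. |A| <o \<mu> \<Longrightarrow> \<exists>i\<in>Field k. |A| <o m i"
begin

lemmas wk = Cinfinite_Well_order[OF k]
lemmas ev_tail = eventually_tail[OF k]

lemma m_Cinfinite: "i \<in> Field k \<Longrightarrow> Cinfinite (m i)"
  using m_regular by (auto simp: regular_card_def)

lemma m_Well_order: "i \<in> Field k \<Longrightarrow> Well_order (m i)"
  using m_Cinfinite Cinfinite_Well_order by blast

lemma k_nonempty: "Field k \<noteq> {}"
  using k by (auto simp: cinfinite_def)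

lemma k_succ: "i \<in> Field k \<Longrightarrow> \<exists>j\<in>Field k. underS k j = under k i"
  using Cinfinite_succ[OF k] by blast

lemma k_greater: "i \<in> Field k \<Longrightarrow> \<exists>j. i \<in> underS k j"
  using k_succ[of i] Well_order_refl[OF wk, of i] by (auto simp: under_def)

lemma k_max: "i \<in> Field k \<Longrightarrow> j \<in> Field k \<Longrightarrow> \<exists>h\<in>Field k. (i, h) \<in> k \<and> (j, h) \<in> k"
  using Well_order_linear[OF wk, of i j] Well_order_refl[OF wk] by (auto simp: in_underS_iff)

lemma m_mono': "(i, j) \<in> k \<Longrightarrow> m i \<le>o m j"
proof (cases "i = j")
  case True
  moreover assume "(i, j) \<in> k"
  ultimately show ?thesis using m_Well_order ordLeq_reflexive by (auto simp: Field_def)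
next
  case False
  moreover assume "(i, j) \<in> k"
  ultimately show ?thesis using m_mono ordLess_imp_ordLeq by (auto simp: in_underS_iff)
qed

lemma card_of_m: "i \<in> Field k \<Longrightarrow> |Field (m i)| =o m i"
  using m_Cinfinite card_of_Field_ordIso by blast

lemma m_cofinal':
  assumes "|A| <o \<mu>" shows "\<exists>i\<in>Field k. |A| <o m i"
  using assms m_cofinal internalize_card_of_ordLess ordIso_ordLess_trans by metis

lemma k_less_m: "\<exists>i\<in>Field k. k <o m i"
proof -
  have "|Field k| <o \<mu>" using k k_less card_of_Field_ordIso ordIso_ordLess_trans by blast
  then show ?thesis
    using m_cofinal' k ordIso_ordLess_trans[OF ordIso_symmetric[OF card_of_Field_ordIso]] by blast
qed

lemma m_cofinal_k:
  assumes "|A| <o \<mu>" shows "\<exists>i\<in>Field k. |A| <o m i \<and> k <o m i"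
proof -
  obtain i j where "i \<in> Field k" "|A| <o m i" "j \<in> Field k" "k <o m j"
    using m_cofinal'[OF assms] k_less_m by blast
  with k_max[of i j] show ?thesis using m_mono' ordLess_ordLeq_trans by metis
qed

text \<open>Each size is below some \<open>m (g i)\<close>, regularity of \<open>k\<close> bounds
  the fewer than \<open>k\<close> indices \<open>g i\<close>, and one \<open>m h\<close> then
  dominates all sizes and the index set. So the sets smaller than \<open>\<mu>\<close> form a
  \<open>k\<close>-complete ideal.\<close>

lemma small_Union:
  assumes I: "|I| <o k" and A: "\<And>i. i \<in> I \<Longrightarrow> |A i| <o \<mu>"
  shows "|\<Union>i\<in>I. A i| <o \<mu>"
proof -
  from A m_cofinal_k have "\<forall>i\<in>I. \<exists>j\<in>Field k. |A i| <o m j \<and> k <o m j" by blast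
  then obtain g where g: "\<And>i. i \<in> I \<Longrightarrow> g i \<in> Field k \<and> |A i| <o m (g i)" by metis
  have "|g ` I| <o k" using I card_of_image_ordLess by blast
  moreover have "g ` I \<subseteq> Field k" using g by blast
  ultimately obtain j where j: "j \<in> Field k" "\<And>i. i \<in> I \<Longrightarrow> (g i, j) \<in> k"
    using k_bounded[of "g ` I"] by (auto simp: under_def)
  obtain j' where j': "j' \<in> Field k" "k <o m j'" using k_less_m by blast
  obtain h where h: "h \<in> Field k" "(j, h) \<in> k" "(j', h) \<in> k" using k_max j(1) j'(1) by blast
  have "\<forall>i\<in>I. |A i| \<le>o m h"
  proof
    fix i assume i: "i \<in> I"
    have "m (g i) \<le>o m h" using m_mono' Well_order_trans[OF wk j(2)[OF i] h(2)] by blast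
    with g[OF i] show "|A i| \<le>o m h" using ordLess_ordLeq_trans ordLess_imp_ordLeq by blast
  qed
  moreover have "|I| \<le>o m h"
    using I j'(2) m_mono'[OF h(3)] ordLess_transitive ordLess_ordLeq_trans ordLess_imp_ordLeq by metis
  ultimately have "|\<Union>i\<in>I. A i| \<le>o m h"
    using m_Cinfinite[OF h(1)] by (intro UNION_Cinfinite_bound)
  then show ?thesis using m_less[OF h(1)] ordLeq_ordLess_trans by blast
qed

text \<open>Fewer than \<open>k\<close> thresholds have a common bound, so the tail filter is
  \<open>k\<close>-complete.\<close>

lemma ev_small_Ball:
  assumes I: "|I| <o k" and P: "\<And>a. a \<in> I \<Longrightarrow> \<forall>\<^sub>F i in tail k. P a i"
  shows "\<forall>\<^sub>F i in tail k. \<forall>a\<in>I. P a i"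
proof -
  have "\<forall>a\<in>I. \<exists>j\<in>Field k. \<forall>i. j \<in> underS k i \<longrightarrow> P a i" using P by (simp add: ev_tail)
  then obtain g where g: "\<And>a. a \<in> I \<Longrightarrow> g a \<in> Field k"
      "\<And>a i. a \<in> I \<Longrightarrow> g a \<in> underS k i \<Longrightarrow> P a i" by metis
  have "|g ` I| <o k" using I card_of_image_ordLess by blast
  moreover have "g ` I \<subseteq> Field k" using g by blast
  ultimately obtain j where j: "j \<in> Field k" "\<And>i. i \<in> I \<Longrightarrow> (g i, j) \<in> k"
    using k_bounded[of "g ` I"] by (auto simp: under_def)
  show ?thesis unfolding ev_tail
  proof (intro bexI[OF _ j(1)] allI impI ballI)
    fix i a assume "j \<in> underS k i" "a \<in> I"
    then show "P a i" using g(2) underS_trans1[OF wk j(2)] by blast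
  qed
qed

lemma ev_Field: "\<forall>\<^sub>F i in tail k. i \<in> Field k"
proof -
  obtain j where "j \<in> Field k" using k_nonempty by blast
  then show ?thesis unfolding ev_tail using in_underS_Field by fast
qed

lemma ev_m_greater:
  assumes "|A| <o \<mu>" shows "\<forall>\<^sub>F i in tail k. |A| <o m i"
proof -
  obtain j where "j \<in> Field k" "|A| <o m j" using m_cofinal'[OF assms] by blast
  then show ?thesis unfolding ev_tail using m_mono ordLess_transitive[of "|A|"] by metis
qed

lemma below_refl: "below k X X"
  by (simp add: below_def)

lemma below_subset: "(\<And>i. i \<in> Field k \<Longrightarrow> X i \<subseteq> Y i) \<Longrightarrow> below k X Y"
  unfolding below_def by (rule eventually_mono[OF ev_Field])

lemma below_trans: "below k X Y \<Longrightarrow> below k Y Z \<Longrightarrow> below k X Z"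
  unfolding below_def by (erule (1) eventually_elim2) blast

lemma initial_Field: "initial k m (\<lambda>i. Field (m i))"
  by (simp add: initial_def ofilter_Field)

lemma initial_UN: "(\<And>a. a \<in> I \<Longrightarrow> initial k m (X a)) \<Longrightarrow> initial k m (\<lambda>i. \<Union>a\<in>I. X a i)"
  unfolding initial_def by (intro ballI ofilter_UN) auto

lemma initial_Int: "initial k m X \<Longrightarrow> initial k m Y \<Longrightarrow> initial k m (\<lambda>i. X i \<inter> Y i)"
  unfolding initial_def by (simp add: ofilter_Int)

lemma small_initial: "small k m X \<Longrightarrow> initial k m X"
  by (simp add: small_def)

lemma initial_proper_bounded:
  assumes "i \<in> Field k" "ofilter (m i) A" "A \<noteq> Field (m i)"
  shows "\<exists>a\<in>Field (m i). A = underS (m i) a"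
  using wo_rel.ofilter_underS_Field[of "m i" A] m_Well_order[OF assms(1)] assms
  by (auto simp: wo_rel_def)

lemma initial_proper_card:
  assumes "i \<in> Field k" "ofilter (m i) A" "A \<noteq> Field (m i)"
  shows "|A| <o m i"
proof -
  obtain a where "a \<in> Field (m i)" "A = underS (m i) a" using initial_proper_bounded[OF assms] by blast
  then show ?thesis using card_of_underS[of "m i" a] m_Cinfinite[OF assms(1)] by simp
qed

text \<open>Once \<open>m i\<close> exceeds \<open>k\<close>, its regularity bounds any
  \<open>k\<close> proper segments of \<open>m i\<close>: they are \<open>underS (m i) (f a)\<close>
  for at most \<open>k\<close> points \<open>f a\<close>, which lie below one
  \<open>c\<close>.\<close>

lemma small_UN:
  assumes p: "|p| \<le>o k" and X: "\<And>a. a \<in> p \<Longrightarrow> small k m (X a)"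
  shows "small k m (\<lambda>i. \<Union>a\<in>p. {x \<in> X a i. X a i \<noteq> Field (m i)})"
proof -
  let ?Y = "\<lambda>i. \<Union>a\<in>p. {x \<in> X a i. X a i \<noteq> Field (m i)}"
  have ini: "initial k m ?Y"
  proof (rule initial_UN)
    fix a assume "a \<in> p"
    then have "initial k m (X a)" using X small_def by blast
    then show "initial k m (\<lambda>i. {x \<in> X a i. X a i \<noteq> Field (m i)})"
      unfolding initial_def
    proof (intro ballI)
      fix i assume "i \<in> Field k" "\<forall>i\<in>Field k. ofilter (m i) (X a i)"
      then show "ofilter (m i) {x \<in> X a i. X a i \<noteq> Field (m i)}"
        by (cases "X a i = Field (m i)") (simp_all add: ofilter_empty)
    qed
  qed
  have "|Field k| <o \<mu>" using k k_less card_of_Field_ordIso ordIso_ordLess_trans by blast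
  then have "\<forall>\<^sub>F i in tail k. |Field k| <o m i" by (rule ev_m_greater)
  with ev_Field have "\<forall>\<^sub>F i in tail k. ?Y i \<noteq> Field (m i)"
  proof eventually_elim
    case (elim i)
    have "k <o m i"
      using k elim ordIso_ordLess_trans[OF ordIso_symmetric[OF card_of_Field_ordIso]] by blast
    then have pm: "|p| <o m i" using p ordLeq_ordLess_trans by blast
    define q where "q = {a \<in> p. X a i \<noteq> Field (m i)}"
    have "\<forall>a\<in>q. \<exists>b\<in>Field (m i). X a i = underS (m i) b"
    proof
      fix a assume a: "a \<in> q"
      then have "ofilter (m i) (X a i)" using X elim(1) by (simp add: small_def initial_def q_def)
      with a show "\<exists>b\<in>Field (m i). X a i = underS (m i) b"
        using initial_proper_bounded[OF elim(1)] by (simp add: q_def)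
    qed
    then obtain f where f: "\<And>a. a \<in> q \<Longrightarrow> f a \<in> Field (m i) \<and> X a i = underS (m i) (f a)"
      by metis
    have "|f ` q| <o m i"
      by (rule card_of_image_ordLess, rule card_of_subset_ordLess[OF _ pm]) (auto simp: q_def)
    moreover have "f ` q \<subseteq> Field (m i)" using f by (intro image_subsetI) simp
    ultimately obtain c where c: "c \<in> Field (m i)" "f ` q \<subseteq> underS (m i) c"
      using regular_bounded[OF m_regular[OF elim(1)]] by blast
    have "?Y i \<subseteq> underS (m i) c"
    proof
      fix x assume "x \<in> ?Y i"
      then obtain a where a: "a \<in> q" "x \<in> X a i" by (auto simp: q_def)
      have "x \<in> underS (m i) (f a)" "f a \<in> underS (m i) c"
        using f[OF a(1)] a(2) c(2) a(1) by auto
      then show "x \<in> underS (m i) c"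
        using underS_trans1[OF m_Well_order[OF elim(1)], of x "f a"] by (simp add: in_underS_iff)
    qed
    then have "c \<notin> ?Y i" using underS_notIn[of c "m i"] by blast
    then show ?case using c(1) by blast
  qed
  with ini show ?thesis by (simp add: small_def)
qed

end

section \<open>Least upper bounds away from cofinality \<open>k\<close>, and projections\<close>

context singular_sequence
begin

text \<open>If no threshold is shared by unboundedly many members, every \<open>i\<close> has a
  point \<open>g i\<close> beyond which all thresholds exceed \<open>i\<close>. As \<open>a\<close>
  has threshold \<open>c a\<close>, it lies below \<open>g j\<close> for all \<open>j\<close> from
  \<open>c a\<close> on, so \<open>g\<close> witnesses \<open>reached\<close>.\<close>

lemma pigeonhole:
  assumes r: "Well_order r" "ofilter r S" and S: "\<not> reached k r S"
    and c: "\<And>a. a \<in> S \<Longrightarrow> c a \<in> Field k"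
  shows "\<exists>i\<in>Field k. \<forall>a\<in>S. \<exists>b\<in>S. (a, b) \<in> r \<and> (c b, i) \<in> k"
proof (rule ccontr)
  assume "\<not> ?thesis"
  then have "\<forall>i\<in>Field k. \<exists>a\<in>S. \<forall>b\<in>S. (a, b) \<in> r \<longrightarrow> (c b, i) \<notin> k" by blast
  then obtain g where g: "\<And>i. i \<in> Field k \<Longrightarrow> g i \<in> S"
    "\<And>i b. i \<in> Field k \<Longrightarrow> b \<in> S \<Longrightarrow> (g i, b) \<in> r \<Longrightarrow> (c b, i) \<notin> k" by metis
  have "reached k r S" unfolding reached_def
  proof (intro exI[of _ g] conjI ballI)
    fix a assume a: "a \<in> S"
    show "\<exists>i\<in>Field k. \<forall>j. (i, j) \<in> k \<longrightarrow> (a, g j) \<in> r"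
    proof (intro bexI[OF _ c[OF a]] allI impI)
      fix j assume j: "(c a, j) \<in> k"
      then have jF: "j \<in> Field k" by (auto simp: Field_def)
      then have "(g j, a) \<notin> r" using g(2) a j by blast
      moreover have "a \<in> Field r" "g j \<in> Field r"
        using a g(1)[OF jF] ofilter_subset_Field[OF r(2)] by auto
      ultimately show "(a, g j) \<in> r" using Well_order_linear[OF r(1)] by (auto simp: in_underS_iff)
    qed
  qed (rule g(1))
  with S show False by blast
qed

text \<open>The family \<open>s\<close> increases at every coordinate, whereas the chain itself will
  increase only modulo bounded sets. For an upper bound \<open>h\<close> the pigeonhole gives one
  threshold \<open>j\<close> valid for unboundedly many \<open>s b\<close>; monotonicity passes the
  inclusion beyond \<open>j\<close> to all of \<open>s\<close>, hence to the union.\<close>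

lemma lub_interleaved:
  assumes r: "Well_order r" "ofilter r S" and S: "\<not> reached k r S"
    and ini: "\<And>b. b \<in> S \<Longrightarrow> initial k m (s b)"
    and mono: "\<And>b c i. b \<in> S \<Longrightarrow> c \<in> S \<Longrightarrow> (b, c) \<in> r \<Longrightarrow> s b i \<subseteq> s c i"
    and sX: "\<And>b. b \<in> S \<Longrightarrow> \<exists>c\<in>S. below k (s b) (X c)"
    and Xs: "\<And>b. b \<in> S \<Longrightarrow> \<exists>c\<in>S. below k (X b) (s c)"
  shows "lub_on k m X S (\<lambda>i. \<Union>b\<in>S. s b i)"
  unfolding lub_on_def
proof (intro conjI ballI allI impI)
  show "initial k m (\<lambda>i. \<Union>b\<in>S. s b i)" by (rule initial_UN[OF ini])
  fix a assume "a \<in> S"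
  then obtain c where c: "c \<in> S" "below k (X a) (s c)" using Xs by blast
  then show "below k (X a) (\<lambda>i. \<Union>b\<in>S. s b i)"
    by (intro below_trans[OF c(2)] below_subset) blast
next
  fix h assume "initial k m h \<and> (\<forall>a\<in>S. below k (X a) h)"
  then have "below k (s b) h" if "b \<in> S" for b using sX[OF that] below_trans by blast
  then have "\<forall>b\<in>S. \<exists>j\<in>Field k. \<forall>i. j \<in> underS k i \<longrightarrow> s b i \<subseteq> h i"
    by (simp add: below_def ev_tail)
  then obtain c where c: "\<And>b. b \<in> S \<Longrightarrow> c b \<in> Field k"
    "\<And>b i. b \<in> S \<Longrightarrow> c b \<in> underS k i \<Longrightarrow> s b i \<subseteq> h i" by metis
  obtain j where j: "j \<in> Field k" "\<And>a. a \<in> S \<Longrightarrow> \<exists>b\<in>S. (a, b) \<in> r \<and> (c b, j) \<in> k"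
    using pigeonhole[of r S c, OF r S c(1)] by metis
  show "below k (\<lambda>i. \<Union>b\<in>S. s b i) h"
    unfolding below_def ev_tail
  proof (intro bexI[OF _ j(1)] allI impI UN_least)
    fix i a assume i: "j \<in> underS k i" and a: "a \<in> S"
    obtain b where b: "b \<in> S" "(a, b) \<in> r" "(c b, j) \<in> k" using j(2) a by blast
    have "s b i \<subseteq> h i" using c(2)[OF b(1)] underS_trans1[OF wk b(3) i] by blast
    with mono[OF a b(1,2)] show "s a i \<subseteq> h i" by blast
  qed
qed

text \<open>The case of cofinality below \<open>k\<close>: fewer than \<open>k\<close> thresholds
  have a common bound, so the union over \<open>x\<close> stays below every upper bound.\<close>

lemma lub_short:
  assumes x: "unbounded_in r S x" "|x| <o k"
    and ini: "\<And>b. b \<in> S \<Longrightarrow> initial k m (X b)"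
    and mono: "\<And>b c. b \<in> S \<Longrightarrow> c \<in> S \<Longrightarrow> (b, c) \<in> r \<Longrightarrow> below k (X b) (X c)"
  shows "lub_on k m X S (\<lambda>i. \<Union>b\<in>x. X b i)"
  unfolding lub_on_def
proof (intro conjI ballI allI impI)
  have xS: "x \<subseteq> S" using x by (simp add: unbounded_in_def)
  show "initial k m (\<lambda>i. \<Union>b\<in>x. X b i)" using xS by (intro initial_UN ini) blast
  fix a assume a: "a \<in> S"
  then obtain c where c: "c \<in> x" "(a, c) \<in> r" using x by (auto simp: unbounded_in_def)
  then have "below k (X a) (X c)" using mono[OF a] xS by blast
  then show "below k (X a) (\<lambda>i. \<Union>b\<in>x. X b i)"
    using c(1) by (elim below_trans) (auto intro!: below_subset)
next
  fix h assume h: "initial k m h \<and> (\<forall>a\<in>S. below k (X a) h)"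
  have "\<forall>\<^sub>F i in tail k. \<forall>b\<in>x. X b i \<subseteq> h i"
    using h x by (intro ev_small_Ball) (auto simp: below_def unbounded_in_def)
  then show "below k (\<lambda>i. \<Union>b\<in>x. X b i) h"
    unfolding below_def by (rule eventually_mono) blast
qed

lemma not_unbounded_in:
  assumes r: "Well_order r" "ofilter r S" and x: "x \<subseteq> S" "\<not> unbounded_in r S x"
  shows "\<exists>b\<in>S. x \<subseteq> underS r b"
proof -
  obtain a where a: "a \<in> S" "\<And>b. b \<in> x \<Longrightarrow> (a, b) \<notin> r"
    using x by (auto simp: unbounded_in_def)
  have "x \<subseteq> underS r a"
    using Well_order_linear[OF r(1)] a x(1) ofilter_subset_Field[OF r(2)] by blast
  with a show ?thesis by blast
qed

text \<open>With cofinality below \<open>k\<close> and \<open>reached\<close> both excluded, the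
  cofinality of \<open>S\<close> exceeds \<open>k\<close>. An unbounded \<open>x\<close> of size
  \<open>k\<close>, enumerated along \<open>k\<close>, would have bounded initial parts, and their
  bounds \<open>g i\<close> would make \<open>S\<close> reached.\<close>

lemma not_reached_bounded:
  assumes r: "Well_order r" "ofilter r S" and S: "\<not> reached k r S"
    and no: "\<And>x. |x| <o k \<Longrightarrow> \<not> unbounded_in r S x"
    and x: "x \<subseteq> S" "|x| \<le>o k"
  shows "\<exists>b\<in>S. x \<subseteq> underS r b"
proof (rule not_unbounded_in[OF r x(1)], rule notI)
  assume unb: "unbounded_in r S x"
  have "\<not> |x| <o k" using no unb by blast
  then have "k \<le>o |x|" using card_of_ordLess_or_ordLeq[OF wk] by blast
  then have "|Field k| =o |x|"
    using x(2) k card_of_Field_ordIso ordIso_iff_ordLeq ordIso_transitive by blast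
  then obtain f where f: "bij_betw f (Field k) x" using card_of_ordIso by blast
  have "\<forall>i\<in>Field k. \<exists>d\<in>S. f ` under k i \<subseteq> underS r d"
  proof
    fix i assume i: "i \<in> Field k"
    obtain j where j: "j \<in> Field k" "underS k j = under k i" using k_succ[OF i] by blast
    have "|f ` under k i| <o k"
      using card_of_image_ordLess card_of_underS[of k j] k j by metis
    moreover have "f ` under k i \<subseteq> S"
      using f x(1) under_Field[of k i] by (auto simp: bij_betw_def)
    ultimately show "\<exists>d\<in>S. f ` under k i \<subseteq> underS r d"
      using not_unbounded_in[OF r] no by blast
  qed
  then obtain g where g: "\<And>i. i \<in> Field k \<Longrightarrow> g i \<in> S"
    "\<And>i. i \<in> Field k \<Longrightarrow> f ` under k i \<subseteq> underS r (g i)" by metis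
  have "reached k r S" unfolding reached_def
  proof (intro exI[of _ g] conjI ballI)
    fix a assume "a \<in> S"
    then obtain b where b: "b \<in> x" "(a, b) \<in> r" using unb by (auto simp: unbounded_in_def)
    then obtain i where i: "i \<in> Field k" "b = f i" using f by (auto simp: bij_betw_def)
    show "\<exists>i\<in>Field k. \<forall>j. (i, j) \<in> k \<longrightarrow> (a, g j) \<in> r"
    proof (intro bexI[OF _ i(1)] allI impI)
      fix j assume j: "(i, j) \<in> k"
      then have "j \<in> Field k" by (auto simp: Field_def)
      then have "b \<in> underS r (g j)" using g(2) j i by (auto simp: under_def)
      then show "(a, g j) \<in> r" using underS_trans1[OF r(1) b(2)] by (simp add: in_underS_iff)
    qed
  qed (rule g(1))
  with S show False by blast
qed

text \<open>Projection to a family of bounds, as in the trichotomy argument: each \<open>Y i\<close>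
  is enlarged to the least value \<open>T i\<close> above it. A \<open>frame\<close> contains the
  full function so that there is such a value, and has at most \<open>k\<close> members so that its
  values at all coordinates are listed by \<open>k\<close> pairs.\<close>

definition upper :: "('i \<Rightarrow> 'a set) set \<Rightarrow> ('i \<Rightarrow> 'a set) \<Rightarrow> 'i \<Rightarrow> 'a set" where
  "upper \<S> Y i = (\<Inter>T\<in>{T \<in> \<S>. Y i \<subseteq> T i}. T i)"

definition frame :: "('i \<Rightarrow> 'a set) set \<Rightarrow> bool" where
  "frame \<S> \<longleftrightarrow> (\<lambda>i. Field (m i)) \<in> \<S> \<and> (\<forall>T\<in>\<S>. initial k m T) \<and> |\<S>| \<le>o k"

lemma upper_ge: "Y i \<subseteq> upper \<S> Y i"
  unfolding upper_def by blast

lemma upper_mono: "Y i \<subseteq> Y' i \<Longrightarrow> upper \<S> Y i \<subseteq> upper \<S> Y' i"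
  unfolding upper_def by blast

lemma upper_le: "T \<in> \<S> \<Longrightarrow> Y i \<subseteq> T i \<Longrightarrow> upper \<S> Y i \<subseteq> T i"
  unfolding upper_def by blast

lemma upper_antimono: "\<S> \<subseteq> \<S>' \<Longrightarrow> upper \<S>' Y i \<subseteq> upper \<S> Y i"
  unfolding upper_def by blast

lemma below_upper: "below k Y Y' \<Longrightarrow> below k (upper \<S> Y) (upper \<S> Y')"
  unfolding below_def by (erule eventually_mono) (rule upper_mono)

lemma below_upper_self: "below k Y (upper \<S> Y)"
  by (intro below_subset upper_ge)

lemma upper_attained:
  assumes "frame \<S>" "initial k m Y" "i \<in> Field k"
  shows "\<exists>T\<in>\<S>. upper \<S> Y i = T i"
proof -
  let ?T = "{T \<in> \<S>. Y i \<subseteq> T i}"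
  have "(\<lambda>i. Field (m i)) \<in> ?T"
    using assms by (auto simp: frame_def initial_def ofilter_def)
  moreover have "\<And>T. T \<in> ?T \<Longrightarrow> ofilter (m i) (T i)"
    using assms by (auto simp: frame_def initial_def)
  ultimately have "\<exists>A\<in>(\<lambda>T. T i) ` ?T. \<forall>A'\<in>(\<lambda>T. T i) ` ?T. A \<subseteq> A'"
    by (intro ofilter_least[OF m_Well_order[OF assms(3)]]) blast+
  then obtain T where "T \<in> ?T" "\<And>T'. T' \<in> ?T \<Longrightarrow> T i \<subseteq> T' i" by blast
  then show ?thesis unfolding upper_def by (intro bexI[of _ T]) blast+
qed

lemma upper_initial:
  assumes "frame \<S>" "initial k m Y" shows "initial k m (upper \<S> Y)"
proof -
  have "ofilter (m i) (upper \<S> Y i)" if i: "i \<in> Field k" for i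
    using upper_attained[OF assms i] assms(1) i by (auto simp: frame_def initial_def)
  then show ?thesis by (simp add: initial_def)
qed

end

subsection \<open>Chains with least upper bounds\<close>

text \<open>
  Unions of at most \<open>k\<close> many \<open>small\<close> families need not be \<open>small\<close>: each coordinate may be full for
  some member. Emptying the full coordinates repairs this and changes a \<open>small\<close> family only on a
  bounded set of coordinates.
\<close>

definition cut :: "('i \<Rightarrow> 'a rel) \<Rightarrow> ('i \<Rightarrow> 'a set) \<Rightarrow> 'i \<Rightarrow> 'a set" where
  "cut m X i = {x \<in> X i. X i \<noteq> Field (m i)}"

text \<open>\<open>n\<close> counts the requests that one stage can satisfy, and
  \<open>small_bound\<close> says that it lies below the bounding number; \<open>Q d\<close> lists
  the sets whose suprema stage \<open>d\<close> must dominate. Two instances occur: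
  \<open>n = l\<close>, and \<open>l\<close> the successor of \<open>n\<close>. The premises of
  \<open>approachable\<close> say that \<open>S\<close> has cofinality exactly
  \<open>cardSuc k\<close>.\<close>

locale chain_setup = singular_sequence \<mu> k m
  for \<mu> :: "'a rel" and k :: "'i rel" and m :: "'i \<Rightarrow> 'a rel" +
  fixes l :: "'b rel" and n :: "'n rel" and Q :: "'b \<Rightarrow> 'b set set"
  assumes l: "Cinfinite l" and n: "Cinfinite n" and k_le_n: "k \<le>o n"
    and card_underS_l: "\<And>d. d \<in> Field l \<Longrightarrow> |underS l d| \<le>o n"
    and card_Q: "\<And>d. d \<in> Field l \<Longrightarrow> |Q d| \<le>o n"
    and small_bound: "\<And>\<Y>. |\<Y>| \<le>o n \<Longrightarrow> (\<And>Y. Y \<in> \<Y> \<Longrightarrow> small k m Y) \<Longrightarrow>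
      \<exists>Z. small k m Z \<and> (\<forall>Y\<in>\<Y>. below k Y Z)"
    and approachable: "\<And>S x. ofilter l S \<Longrightarrow>
      (\<And>y. y \<subseteq> S \<Longrightarrow> |y| \<le>o k \<Longrightarrow> \<exists>b\<in>S. y \<subseteq> underS l b) \<Longrightarrow>
      unbounded_in l S x \<Longrightarrow> |x| \<le>o cardSuc k \<Longrightarrow>
      \<exists>x. unbounded_in l S x \<and> (\<forall>a\<in>S. \<exists>b\<in>S. (a, b) \<in> l \<and> |x \<inter> underS l b| \<le>o k \<and>
        (\<forall>d\<in>Field l. b \<in> underS l d \<longrightarrow> x \<inter> underS l b \<in> Q d))"
begin

lemmas wl = Cinfinite_Well_order[OF l]

text \<open>Away from reached stages the value is forced modulo bounded sets, so all other demands
  are placed on the reached ones, which include the successors. Growth by every \<open>m j\<close>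
  will give the new region size \<open>\<mu>\<close>; domination of the unions over members of
  \<open>Q d\<close> prepares least upper bounds at later stages of cofinality
  \<open>cardSuc k\<close>.\<close>

definition step :: "('b \<Rightarrow> 'i \<Rightarrow> 'a set) \<Rightarrow> 'b \<Rightarrow> ('i \<Rightarrow> 'a set) \<Rightarrow> bool" where
  "step X d Z \<longleftrightarrow> small k m Z \<and>
     (if reached k l (underS l d) then
        (\<forall>b\<in>underS l d. \<forall>j\<in>Field k. \<forall>\<^sub>F i in tail k. X b i \<subseteq> Z i \<and> m j \<le>o |Z i - X b i| ) \<and>
        (\<forall>p\<in>Q d. p \<subseteq> underS l d \<and> |p| \<le>o k \<longrightarrow> below k (\<lambda>i. \<Union>a\<in>p. cut m (X a) i) Z)
      else lub_on k m X (underS l d) Z)"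

lemma step_small: "step X d Z \<Longrightarrow> small k m Z"
  by (simp add: step_def)

lemma step_below:
  assumes "step X d Z" "b \<in> underS l d" shows "below k (X b) Z"
proof (cases "reached k l (underS l d)")
  case True
  obtain j where "j \<in> Field k" using k_nonempty by blast
  then have "\<forall>\<^sub>F i in tail k. X b i \<subseteq> Z i \<and> m j \<le>o |Z i - X b i|"
    using True assms by (simp add: step_def)
  then show ?thesis unfolding below_def by (rule eventually_mono) blast
next
  case False
  then show ?thesis using assms by (simp add: step_def lub_on_def)
qed

lemma chain_below:
  assumes "\<And>d. d \<in> S \<Longrightarrow> step X d (X d)" "b \<in> S" "(a, b) \<in> l"
  shows "below k (X a) (X b)"
  using step_below[OF assms(1)[OF assms(2)]] assms(3) below_refl
  by (cases "a = b") (auto simp: in_underS_iff)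

lemma reached_succ:
  assumes "underS l d = under l b" "b \<in> Field l"
  shows "reached k l (underS l d)"
  unfolding reached_def
proof (intro exI[of _ "\<lambda>_. b"] conjI ballI)
  show "b \<in> underS l d" using assms Well_order_refl[OF wl] by (simp add: under_def)
  fix a assume "a \<in> underS l d"
  then show "\<exists>i\<in>Field k. \<forall>j. (i, j) \<in> k \<longrightarrow> (a, b) \<in> l"
    using assms(1) k_nonempty by (auto simp: under_def)
qed

lemma succ_in:
  assumes S: "ofilter l S" and b: "b \<in> S" "c \<in> S" "b \<in> underS l c"
  shows "\<exists>d\<in>S. underS l d = under l b"
proof -
  obtain d where d: "d \<in> Field l" "underS l d = under l b"
    using Cinfinite_succ[OF l] b(1) ofilter_subset_Field[OF S] by blast
  have "c \<notin> underS l d" using d(2) b(3) Well_order_antisym[OF wl] by (auto simp: under_def in_underS_iff)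
  then have "(d, c) \<in> l" using Well_order_linear[OF wl d(1), of c] b(2) ofilter_subset_Field[OF S] by blast
  then show ?thesis using ofilter_mem[OF S b(2)] d by blast
qed

text \<open>\<open>s b\<close> is the union over the part of the approachable set \<open>y\<close>
  below \<open>b\<close>, so it increases at every coordinate. It stays below the chain because some
  longer part is listed in \<open>Q\<close> and was dominated at a successor stage; the chain stays
  below it because \<open>y\<close> is unbounded.\<close>

lemma interleaved_exists:
  assumes S: "ofilter l S" and X: "\<And>d. d \<in> S \<Longrightarrow> step X d (X d)"
    and bd: "\<And>y. y \<subseteq> S \<Longrightarrow> |y| \<le>o k \<Longrightarrow> \<exists>b\<in>S. y \<subseteq> underS l b"
    and x: "unbounded_in l S x" "|x| \<le>o cardSuc k"
  obtains s where "\<And>b. b \<in> S \<Longrightarrow> initial k m (s b)"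
    "\<And>b c i. (b, c) \<in> l \<Longrightarrow> s b i \<subseteq> s c i"
    "\<And>b. b \<in> S \<Longrightarrow> \<exists>c\<in>S. below k (s b) (X c)"
    "\<And>b. b \<in> S \<Longrightarrow> \<exists>c\<in>S. below k (X b) (s c)"
proof -
  obtain y where y: "unbounded_in l S y"
    "\<And>a. a \<in> S \<Longrightarrow> \<exists>b\<in>S. (a, b) \<in> l \<and> |y \<inter> underS l b| \<le>o k \<and>
        (\<forall>d\<in>Field l. b \<in> underS l d \<longrightarrow> y \<inter> underS l b \<in> Q d)"
    using approachable[OF S bd x] by metis
  have yS: "y \<subseteq> S" using y(1) by (simp add: unbounded_in_def)
  have above: "\<exists>c\<in>S. b \<in> underS l c" if "b \<in> S" for b
  proof -
    have "|{b}| \<le>o k" using k by (intro Card_order_singl_ordLeq) (auto simp: cinfinite_def)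
    then show ?thesis using bd[of "{b}"] that by auto
  qed
  define s where "s b i = (\<Union>a\<in>y \<inter> underS l b. cut m (X a) i)" for b i
  show thesis
  proof
    fix b assume b: "b \<in> S"
    have "initial k m (cut m (X a))" if "a \<in> S" for a
      unfolding initial_def
    proof
      fix i assume "i \<in> Field k"
      then have "ofilter (m i) (X a i)"
        using step_small[OF X[OF that]] by (simp add: small_def initial_def)
      then show "ofilter (m i) (cut m (X a) i)"
        by (cases "X a i = Field (m i)") (simp_all add: cut_def ofilter_empty)
    qed
    then show "initial k m (s b)"
      unfolding s_def using yS by (intro initial_UN) auto
    obtain c where c: "c \<in> S" "(b, c) \<in> l" "|y \<inter> underS l c| \<le>o k"
      "\<forall>d\<in>Field l. c \<in> underS l d \<longrightarrow> y \<inter> underS l c \<in> Q d" using y(2)[OF b] by blast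
    obtain c' where c': "c' \<in> S" "c \<in> underS l c'" using above[OF c(1)] by blast
    \<comment> \<open>The successor \<open>d\<close> of \<open>c\<close> is a reached stage, so
      \<open>step\<close> there dominates the union over \<open>y \<inter> underS l c\<close>, a
      member of \<open>Q d\<close>.\<close>
    obtain d where d: "d \<in> S" "underS l d = under l c" using succ_in[OF S c(1) c'] by blast
    have dF: "d \<in> Field l" "c \<in> Field l" using d(1) c(1) ofilter_subset_Field[OF S] by auto
    have cd: "c \<in> underS l d" using d(2) Well_order_refl[OF wl dF(2)] by (simp add: under_def)
    have "y \<inter> underS l c \<in> Q d" using c(4) dF(1) cd by blast
    moreover have "y \<inter> underS l c \<subseteq> underS l d" using d(2) underS_subset_under by fast
    ultimately have "below k (s c) (X d)"
      using X[OF d(1)] reached_succ[OF d(2) dF(2)] c(3) by (simp add: step_def s_def[abs_def])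
    moreover have "s b i \<subseteq> s c i" for i
      unfolding s_def using underS_trans2[OF wl _ c(2)] by blast
    ultimately show "\<exists>c\<in>S. below k (s b) (X c)"
      using d(1) below_subset[of "s b" "s c"] below_trans by blast
    obtain a where a: "a \<in> y" "(b, a) \<in> l" using y(1) b by (auto simp: unbounded_in_def)
    obtain e where e: "e \<in> S" "a \<in> underS l e" using above a(1) yS by blast
    have "\<forall>\<^sub>F i in tail k. X a i \<noteq> Field (m i)"
      using step_small[OF X] a(1) yS by (auto simp: small_def)
    then have "below k (X a) (s e)" unfolding below_def
      by (rule eventually_mono) (use a e in \<open>auto simp: s_def cut_def\<close>)
    then show "\<exists>c\<in>S. below k (X b) (s c)"
      using chain_below[of S X a b] X a yS e(1) below_trans by blast
  next
    fix b c i assume "(b, c) \<in> l"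
    then show "s b i \<subseteq> s c i" unfolding s_def using underS_trans2[OF wl] by blast
  qed
qed

lemmas k_Suc = Cinfinite_cardSuc[OF k]
lemmas wk_Suc = Cinfinite_Well_order[OF Cinfinite_cardSuc[OF k]]

lemma card_underS_Suc: "v \<in> Field (cardSuc k) \<Longrightarrow> |underS (cardSuc k) v| \<le>o k"
  using card_of_underS[of "cardSuc k" v] k_Suc k cardSuc_ordLeq_ordLess[of k] card_of_Card_order
  by blast

text \<open>Suppose the projection keeps changing, \<open>\<phi> a\<close> being a later stage where
  it has grown past that at \<open>a\<close>. Points passing \<open>\<phi>\<close> of all earlier
  ones span a segment \<open>T\<close> of cofinality \<open>cardSuc k\<close>, where an interleaved
  \<open>s\<close> exists. At each coordinate the projection of \<open>s\<close> only grows and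
  takes at most \<open>k\<close> values, all attained before one \<open>b0\<close>; from there on it
  is constant, contradicting the next change.\<close>

lemma upper_stabilises:
  assumes S: "ofilter l S" and X: "\<And>d. d \<in> S \<Longrightarrow> step X d (X d)"
    and bd: "\<And>y. y \<subseteq> S \<Longrightarrow> |y| \<le>o cardSuc k \<Longrightarrow> \<exists>b\<in>S. y \<subseteq> underS l b"
    and F: "frame \<S>"
  shows "\<exists>a\<in>S. \<forall>b\<in>S. (a, b) \<in> l \<longrightarrow> below k (upper \<S> (X b)) (upper \<S> (X a))"
proof (rule ccontr)
  let ?k = "cardSuc k"
  assume "\<not> ?thesis"
  then obtain \<phi> where \<phi>: "\<And>a. a \<in> S \<Longrightarrow> \<phi> a \<in> S \<and> (a, \<phi> a) \<in> l \<and>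
      \<not> below k (upper \<S> (X (\<phi> a))) (upper \<S> (X a))" by metis
  define P where "P \<alpha> v r \<longleftrightarrow>
      (v \<in> Field ?k \<longrightarrow> r \<in> S \<and> (\<forall>w\<in>underS ?k v. \<phi> (\<alpha> w) \<in> underS l r))" for \<alpha> v r
  have "\<exists>\<alpha>. \<forall>v. P \<alpha> v (\<alpha> v)"
  proof (rule dependent_wf_choice[of "?k - Id"])
    show "wf (?k - Id)" using wk_Suc by (simp add: well_order_on_def)
    fix f g :: "'i set \<Rightarrow> 'b" and v r
    assume "\<And>z. (z, v) \<in> ?k - Id \<Longrightarrow> f z = g z"
    then show "P f v r = P g v r" by (simp add: P_def in_underS_iff)
  next
    fix v and f :: "'i set \<Rightarrow> 'b"
    assume f: "\<And>y. (y, v) \<in> ?k - Id \<Longrightarrow> P f y (f y)"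
    show "\<exists>r. P f v r"
    proof (cases "v \<in> Field ?k")
      case True
      let ?A = "(\<lambda>w. \<phi> (f w)) ` underS ?k v"
      have "?A \<subseteq> S"
      proof (intro image_subsetI)
        fix w assume "w \<in> underS ?k v"
        then have "f w \<in> S" using f[of w] in_underS_Field[of w ?k v] by (auto simp: P_def in_underS_iff)
        then show "\<phi> (f w) \<in> S" using \<phi> by blast
      qed
      moreover have "|?A| \<le>o ?k"
        using card_of_image_ordLeq[OF card_underS_Suc[OF True]] cardSuc_ordLeq k ordLeq_transitive by blast
      ultimately obtain b where "b \<in> S" "?A \<subseteq> underS l b" using bd by meson
      then show ?thesis unfolding P_def by blast
    qed (simp add: P_def)
  qed
  then obtain \<alpha> where "\<And>v. P \<alpha> v (\<alpha> v)" by blast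
  then have \<alpha>: "\<And>v. v \<in> Field ?k \<Longrightarrow> \<alpha> v \<in> S"
    "\<And>v w. w \<in> underS ?k v \<Longrightarrow> \<phi> (\<alpha> w) \<in> underS l (\<alpha> v)"
    unfolding P_def using in_underS_Field by fast+
  \<comment> \<open>The segment generated by \<open>\<alpha>\<close>; its cofinality is exactly
    \<open>cardSuc k\<close>, the case covered by \<open>interleaved_exists\<close>.\<close>
  define T where "T = {c \<in> S. \<exists>v\<in>Field ?k. (c, \<alpha> v) \<in> l}"
  have \<alpha>T: "\<alpha> v \<in> T" if "v \<in> Field ?k" for v
    using that \<alpha>(1) ofilter_subset_Field[OF S] Well_order_refl[OF wl] by (auto simp: T_def)
  have T: "ofilter l T"
  proof (rule ofilterI)
    show "T \<subseteq> Field l" using ofilter_subset_Field[OF S] by (auto simp: T_def)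
    fix a b assume "b \<in> T" "(a, b) \<in> l"
    then show "a \<in> T" using ofilter_mem[OF S] Well_order_trans[OF wl] unfolding T_def by blast
  qed
  have TX: "\<And>d. d \<in> T \<Longrightarrow> step X d (X d)" using X by (simp add: T_def)
  have Tbd: "\<exists>b\<in>T. y \<subseteq> underS l b" if y: "y \<subseteq> T" "|y| \<le>o k" for y
  proof -
    have "\<forall>c\<in>y. \<exists>v\<in>Field ?k. (c, \<alpha> v) \<in> l" using y by (auto simp: T_def)
    then obtain g where g: "\<And>c. c \<in> y \<Longrightarrow> g c \<in> Field ?k \<and> (c, \<alpha> (g c)) \<in> l" by metis
    have "g ` y \<subseteq> Field ?k" using g by blast
    then obtain v where v: "v \<in> Field ?k" "g ` y \<subseteq> underS ?k v"
      using cardSuc_bounded[OF k _ card_of_image_ordLeq[OF y(2)]] by blast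
    have "y \<subseteq> underS l (\<alpha> v)"
    proof
      fix c assume c: "c \<in> y"
      have "(c, \<phi> (\<alpha> (g c))) \<in> l" using g[OF c] \<phi>[OF \<alpha>(1)] Well_order_trans[OF wl] by blast
      then show "c \<in> underS l (\<alpha> v)" using \<alpha>(2)[of "g c" v] v(2) c underS_trans1[OF wl] by blast
    qed
    with \<alpha>T[OF v(1)] show ?thesis by blast
  qed
  have "unbounded_in l T (\<alpha> ` Field ?k)"
    using \<alpha>T by (auto simp: unbounded_in_def T_def)
  moreover have "|\<alpha> ` Field ?k| \<le>o ?k"
    using card_of_image_ordLeq card_of_Field_ordLeq k_Suc by blast
  ultimately obtain s where s: "\<And>b. b \<in> T \<Longrightarrow> initial k m (s b)"
    "\<And>b c i. (b, c) \<in> l \<Longrightarrow> s b i \<subseteq> s c i"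
    "\<And>b. b \<in> T \<Longrightarrow> \<exists>c\<in>T. below k (s b) (X c)"
    "\<And>b. b \<in> T \<Longrightarrow> \<exists>c\<in>T. below k (X b) (s c)"
    using interleaved_exists[OF T TX Tbd] by metis
  \<comment> \<open>A point of \<open>T\<close> at which coordinate \<open>i\<close> projects to
    \<open>U i\<close>, if there is one. The pairs \<open>(i, U)\<close> number at most
    \<open>k\<close>, so these points lie below one \<open>b0\<close>; arbitrary choices outside
    \<open>T\<close> are removed by the intersection in \<open>C\<close>.\<close>
  define c where "c i U = (SOME b. b \<in> T \<and> upper \<S> (s b) i = U i)" for i and U :: "'i \<Rightarrow> 'a set"
  define C where "C = T \<inter> (\<lambda>(i, U). c i U) ` (Field k \<times> \<S>)"
  have "|Field k \<times> \<S>| \<le>o k"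
    using k F card_of_Field_ordLeq by (intro card_of_Times_ordLeq_infinite_Field) (auto simp: cinfinite_def frame_def)
  then have "|C| \<le>o k" unfolding C_def using card_of_image_ordLeq card_of_subset_ordLeq Int_lower2 by metis
  then obtain b0 where b0: "b0 \<in> T" "C \<subseteq> underS l b0" using Tbd[of C] by (auto simp: C_def)
  have const: "upper \<S> (s b) i \<subseteq> upper \<S> (s b0) i" if b: "b \<in> T" and i: "i \<in> Field k" for b i
  proof -
    obtain U where U: "U \<in> \<S>" "upper \<S> (s b) i = U i"
      using upper_attained[OF F s(1)[OF b] i] by blast
    then have cU: "c i U \<in> T \<and> upper \<S> (s (c i U)) i = U i"
      unfolding c_def using b by (intro someI[of "\<lambda>b. b \<in> T \<and> upper \<S> (s b) i = U i"]) simp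
    then have "c i U \<in> C" using i U by (auto simp: C_def)
    then have "(c i U, b0) \<in> l" using b0(2) by (auto simp: in_underS_iff)
    then have "upper \<S> (s (c i U)) i \<subseteq> upper \<S> (s b0) i" by (intro upper_mono s(2))
    with cU U show ?thesis by simp
  qed
  obtain d where d: "d \<in> T" "below k (s b0) (X d)" using s(3)[OF b0(1)] by blast
  then obtain v where v: "v \<in> Field ?k" "(d, \<alpha> v) \<in> l" by (auto simp: T_def)
  obtain w where w: "w \<in> Field ?k" "v \<in> underS ?k w"
    using Cinfinite_succ[OF k_Suc v(1)] v(1) Well_order_refl[OF wk_Suc] by (auto simp: under_def)
  have "\<phi> (\<alpha> v) \<in> T" using \<alpha>(2)[OF w(2)] ofilter_mem[OF T \<alpha>T[OF w(1)]] by (auto simp: in_underS_iff)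
  then obtain e where e: "e \<in> T" "below k (X (\<phi> (\<alpha> v))) (s e)" using s(4) by blast
  have "below k (upper \<S> (X (\<phi> (\<alpha> v)))) (upper \<S> (s e))" using e(2) by (rule below_upper)
  moreover have "below k (upper \<S> (s e)) (upper \<S> (s b0))" using const[OF e(1)] by (rule below_subset)
  moreover have "below k (upper \<S> (s b0)) (upper \<S> (X (\<alpha> v)))"
    using below_trans[OF d(2) chain_below[OF TX \<alpha>T[OF v(1)] v(2)]] by (rule below_upper)
  ultimately have "below k (upper \<S> (X (\<phi> (\<alpha> v)))) (upper \<S> (X (\<alpha> v)))"
    using below_trans by blast
  with \<phi>[OF \<alpha>(1)[OF v(1)]] show False by blast
qed

end

context chain_setup
begin

text \<open>Cofinality below \<open>k\<close> and equal to \<open>cardSuc k\<close> are settled by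
  \<open>lub_short\<close> and \<open>lub_interleaved\<close>. Beyond, suppose there is no least
  upper bound and descend: the stabilised projection to the bounds found so far is an upper bound,
  so some upper bound \<open>h v\<close> fails to dominate it. The projections of a late
  \<open>X a\<close> sink coordinatewise in well-orders, hence stop sinking before stage
  \<open>cardSuc k\<close>; but adding \<open>h v\<close> to the frame pushes the projection below
  \<open>h v\<close>.\<close>

lemma lub_exists:
  assumes S: "ofilter l S" and X: "\<And>d. d \<in> S \<Longrightarrow> step X d (X d)" and nr: "\<not> reached k l S"
  shows "\<exists>Z. lub_on k m X S Z"
proof -
  have iniX: "initial k m (X a)" if "a \<in> S" for a using step_small[OF X[OF that]] by (rule small_initial)
  have monoX: "below k (X b) (X c)" if "b \<in> S" "c \<in> S" "(b, c) \<in> l" for b c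
    using chain_below[of S X c b] X that by blast
  show ?thesis
  proof (cases "\<exists>x. unbounded_in l S x \<and> |x| <o k")
    case True
    then obtain x where x: "unbounded_in l S x" "|x| <o k" by blast
    show ?thesis using lub_short[OF x, of X, OF iniX monoX] by blast
  next
    case no: False
    then have bd: "\<exists>b\<in>S. y \<subseteq> underS l b" if "y \<subseteq> S" "|y| \<le>o k" for y
      using not_reached_bounded[OF wl S nr _ that] by blast
    show ?thesis
    proof (cases "\<exists>x. unbounded_in l S x \<and> |x| \<le>o cardSuc k")
      case True
      then obtain x where x: "unbounded_in l S x" "|x| \<le>o cardSuc k" by blast
      obtain s where s: "\<And>b. b \<in> S \<Longrightarrow> initial k m (s b)"
        "\<And>b c i. (b, c) \<in> l \<Longrightarrow> s b i \<subseteq> s c i"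
        "\<And>b. b \<in> S \<Longrightarrow> \<exists>c\<in>S. below k (s b) (X c)"
        "\<And>b. b \<in> S \<Longrightarrow> \<exists>c\<in>S. below k (X b) (s c)"
        using interleaved_exists[OF S X bd x] by metis
      show ?thesis using lub_interleaved[OF wl S nr s(1) s(2) s(3) s(4)] by blast
    next
      case False
      then have bd2: "\<exists>b\<in>S. y \<subseteq> underS l b" if "y \<subseteq> S" "|y| \<le>o cardSuc k" for y
        using not_unbounded_in[OF wl S that(1)] that(2) by blast
      show ?thesis
      proof (rule ccontr)
        let ?k = "cardSuc k" and ?D = "\<lambda>i. Field (m i)"
        assume nolub: "\<nexists>Z. lub_on k m X S Z"
        define F where "F h v = insert ?D (h ` underS ?k v)" for h and v :: "'i set"
        define P where "P h v r \<longleftrightarrow> (v \<in> Field ?k \<longrightarrow> initial k m r \<and> (\<forall>a\<in>S. below k (X a) r) \<and>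
          (\<exists>a\<in>S. (\<forall>b\<in>S. (a, b) \<in> l \<longrightarrow> below k (upper (F h v) (X b)) (upper (F h v) (X a))) \<and>
             \<not> below k (upper (F h v) (X a)) r))" for h v r
        have frameF: "frame (F h v)" if "\<And>w. w \<in> underS ?k v \<Longrightarrow> P h w (h w)" "v \<in> Field ?k" for h v
        proof -
          have "initial k m (h w)" if "w \<in> underS ?k v" for w
            using \<open>\<And>w. w \<in> underS ?k v \<Longrightarrow> P h w (h w)\<close>[OF that] in_underS_Field[OF that]
            by (auto simp: P_def)
          moreover have "|F h v| \<le>o k" unfolding F_def
            by (intro card_of_insert_ordLeq k card_of_image_ordLeq card_underS_Suc that(2))
          ultimately show ?thesis using initial_Field by (auto simp: frame_def F_def)
        qed
        have "\<exists>h. \<forall>v. P h v (h v)"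
        proof (rule dependent_wf_choice[of "?k - Id"])
          show "wf (?k - Id)" using wk_Suc by (simp add: well_order_on_def)
          fix f g :: "'i set \<Rightarrow> 'i \<Rightarrow> 'a set" and v r
          assume "\<And>z. (z, v) \<in> ?k - Id \<Longrightarrow> f z = g z"
          then have "f ` underS ?k v = g ` underS ?k v" by (intro image_cong) (auto simp: in_underS_iff)
          then show "P f v r = P g v r" by (simp add: P_def F_def)
        next
          fix v and f :: "'i set \<Rightarrow> 'i \<Rightarrow> 'a set"
          assume f: "\<And>y. (y, v) \<in> ?k - Id \<Longrightarrow> P f y (f y)"
          show "\<exists>r. P f v r"
          proof (cases "v \<in> Field ?k")
            case True
            have fr: "frame (F f v)" using f True by (intro frameF) (auto simp: in_underS_iff)
            obtain a where a: "a \<in> S"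
              "\<And>b. b \<in> S \<Longrightarrow> (a, b) \<in> l \<Longrightarrow> below k (upper (F f v) (X b)) (upper (F f v) (X a))"
              using upper_stabilises[OF S X bd2 fr] by blast
            let ?H = "upper (F f v) (X a)"
            \<comment> \<open>For \<open>b\<close> after \<open>a\<close> this is stabilisation:
              \<open>X b\<close> lies below its own projection, which lies below that of
              \<open>X a\<close>.\<close>
            have "below k (X b) ?H" if b: "b \<in> S" for b
            proof -
              have "(a, b) \<in> l \<or> (b, a) \<in> l"
                using Well_order_linear[OF wl] a(1) b ofilter_subset_Field[OF S] by (auto simp: in_underS_iff)
              then show ?thesis
                using a b monoX below_upper_self below_trans by blast
            qed
            moreover have "initial k m ?H" using upper_initial[OF fr iniX[OF a(1)]] .
            moreover have "\<not> lub_on k m X S ?H" using nolub by blast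
            ultimately obtain r where "initial k m r" "\<forall>a\<in>S. below k (X a) r" "\<not> below k ?H r"
              unfolding lub_on_def by blast
            with a show ?thesis unfolding P_def by blast
          qed (simp add: P_def)
        qed
        then obtain h where h: "\<And>v. P h v (h v)" by blast
        then have "\<forall>v\<in>Field ?k. \<exists>a\<in>S.
            (\<forall>b\<in>S. (a, b) \<in> l \<longrightarrow> below k (upper (F h v) (X b)) (upper (F h v) (X a))) \<and>
             \<not> below k (upper (F h v) (X a)) (h v)"
          unfolding P_def by blast
        then obtain A where A: "\<And>v. v \<in> Field ?k \<Longrightarrow> A v \<in> S"
          "\<And>v. v \<in> Field ?k \<Longrightarrow> \<not> below k (upper (F h v) (X (A v))) (h v)" by metis
        have "A ` Field ?k \<subseteq> S" using A(1) by blast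
        moreover have "|A ` Field ?k| \<le>o ?k"
          using card_of_image_ordLeq card_of_Field_ordLeq k_Suc by blast
        ultimately obtain a where a: "a \<in> S" "A ` Field ?k \<subseteq> underS l a" using bd2 by meson
        \<comment> \<open>The single \<open>a\<close> lies beyond all stabilisation points
          \<open>A v\<close>, so the failure of domination holds for \<open>X a\<close> at every
          \<open>v\<close> simultaneously.\<close>
        have nb: "\<not> below k (upper (F h v) (X a)) (h v)" if v: "v \<in> Field ?k" for v
        proof -
          have "(A v, a) \<in> l" using a(2) v by (auto simp: in_underS_iff)
          then have "below k (X (A v)) (X a)" using monoX A(1)[OF v] a(1) by blast
          then show ?thesis using A(2)[OF v] below_upper below_trans by blast
        qed
        have fr: "frame (F h v)" if "v \<in> Field ?k" for v using h that by (rule frameF)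
        have "\<exists>v\<in>Field ?k. \<forall>w\<in>Field ?k. upper (F h v) (X a) i \<subseteq> upper (F h w) (X a) i"
          if i: "i \<in> Field k" for i
        proof -
          let ?T = "(\<lambda>v. upper (F h v) (X a) i) ` Field ?k"
          have "Field ?k \<noteq> {}" using k_Suc by (auto simp: cinfinite_def)
          moreover have "ofilter (m i) (upper (F h v) (X a) i)" if "v \<in> Field ?k" for v
            using upper_initial[OF fr[OF that] iniX[OF a(1)]] i by (simp add: initial_def)
          ultimately have "\<exists>T\<in>?T. \<forall>T'\<in>?T. T \<subseteq> T'"
            by (intro ofilter_least[OF m_Well_order[OF i]]) auto
          then show ?thesis by blast
        qed
        \<comment> \<open>\<open>V i\<close> is a stage where coordinate \<open>i\<close> has sunk
          to its minimum. The at most \<open>k\<close> stages \<open>V i\<close> lie below one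
          \<open>v\<close>, after which no coordinate moves.\<close>
        then obtain V where V: "\<And>i. i \<in> Field k \<Longrightarrow> V i \<in> Field ?k"
          "\<And>i w. i \<in> Field k \<Longrightarrow> w \<in> Field ?k \<Longrightarrow> upper (F h (V i)) (X a) i \<subseteq> upper (F h w) (X a) i"
          by metis
        have "V ` Field k \<subseteq> Field ?k" using V(1) by blast
        moreover have "|V ` Field k| \<le>o k"
          using card_of_image_ordLeq card_of_Field_ordLeq k by blast
        ultimately obtain v where v: "v \<in> Field ?k" "V ` Field k \<subseteq> underS ?k v"
          using cardSuc_bounded[OF k] by blast
        obtain w where w: "w \<in> Field ?k" "underS ?k w = under ?k v"
          using Cinfinite_succ[OF k_Suc v(1)] by blast
        have vw: "v \<in> underS ?k w" using w(2) v(1) Well_order_refl[OF wk_Suc] by (simp add: under_def)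
        have "below k (upper (F h v) (X a)) (upper (F h w) (X a))"
        proof (rule below_subset)
          fix i assume i: "i \<in> Field k"
          have "V i \<in> underS ?k v" using v(2) i by blast
          then have "F h (V i) \<subseteq> F h v"
            unfolding F_def using underS_trans2[OF wk_Suc, of _ "V i" v] by (auto simp: in_underS_iff)
          then have "upper (F h v) (X a) i \<subseteq> upper (F h (V i)) (X a) i" by (rule upper_antimono)
          with V(2)[OF i w(1)] show "upper (F h v) (X a) i \<subseteq> upper (F h w) (X a) i" by blast
        qed
        moreover have "below k (upper (F h w) (X a)) (h v)"
        proof -
          have "h v \<in> F h w" using vw by (simp add: F_def)
          moreover have "below k (X a) (h v)" using h[of v] v(1) a(1) by (simp add: P_def)
          ultimately show ?thesis unfolding below_def by (auto elim!: eventually_mono dest: upper_le)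
        qed
        ultimately show False using nb[OF v(1)] below_trans by blast
      qed
    qed
  qed
qed

text \<open>At coordinates above \<open>j\<close> the complement of a proper segment of
  \<open>m i\<close> still has size \<open>m i\<close>, which exceeds \<open>m j\<close>. A subset
  \<open>E\<close> of it of size \<open>m j\<close> is bounded by regularity, and the segment below
  its bound is proper.\<close>

lemma grow:
  assumes Y: "small k m Y" and j: "j \<in> Field k"
  shows "\<exists>Z. small k m Z \<and> (\<forall>\<^sub>F i in tail k. Y i \<subseteq> Z i \<and> m j \<le>o |Z i - Y i| )"
proof -
  have step1: "\<exists>W. ofilter (m i) W \<and> W \<noteq> Field (m i) \<and> Y i \<subseteq> W \<and> m j \<le>o |W - Y i|"
    if i: "j \<in> underS k i" and ne: "Y i \<noteq> Field (m i)" for i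
  proof -
    have iF: "i \<in> Field k" using in_underS_Field[OF i] by blast
    have c: "Cinfinite (m i)" "Card_order (m i)" "Well_order (m i)" using m_Cinfinite m_Well_order iF by auto
    have ofY: "ofilter (m i) (Y i)" using Y iF by (simp add: small_def initial_def)
    have Yi: "|Y i| <o m i" using initial_proper_card[OF iF ofY ne] .
    have "\<not> |Field (m i) - Y i| <o m i"
    proof
      assume "|Field (m i) - Y i| <o m i"
      then have "|(Field (m i) - Y i) \<union> Y i| <o m i" using Un_Cinfinite_bound_strict[OF _ Yi c(1)] by blast
      then have "|Field (m i)| <o m i"
        by (rule card_of_subset_ordLess[rotated]) blast
      then show False using card_of_m[OF iF] not_ordLess_ordIso by blast
    qed
    then have "m i \<le>o |Field (m i) - Y i|" using card_of_ordLess_or_ordLeq[OF c(3)] by blast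
    then have "m j \<le>o |Field (m i) - Y i|" using m_mono[OF i] ordLess_ordLeq_trans ordLess_imp_ordLeq by blast
    then have "|Field (m j)| \<le>o |Field (m i) - Y i|" using card_of_m[OF j] ordIso_ordLeq_trans by blast
    then obtain E where E: "E \<subseteq> Field (m i) - Y i" "|Field (m j)| =o |E|"
      using internalize_card_of_ordLeq2 by metis
    have Ej: "|E| =o m j" using E(2) card_of_m[OF j] ordIso_symmetric ordIso_transitive by blast
    then have "|E| <o m i" using m_mono[OF i] ordIso_ordLess_trans by blast
    then obtain b where b: "b \<in> Field (m i)" "E \<subseteq> underS (m i) b"
      using regular_bounded[OF m_regular[OF iF], of E] E(1) by blast
    let ?W = "underS (m i) b \<union> Y i"
    have ob: "ofilter (m i) (underS (m i) b)" by (rule ofilter_underS[OF c(3)])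
    then have "ofilter (m i) ?W" "?W = Y i \<or> ?W = underS (m i) b"
      using ofilter_linear[OF c(3) ob ofY] ofY by (auto simp: Un_absorb1 Un_absorb2)
    moreover have "?W \<noteq> Field (m i)"
      using calculation(2) ne b(1) underS_notIn by metis
    moreover have "m j \<le>o |?W - Y i|"
    proof -
      have "|E| \<le>o |?W - Y i|" using E(1) b(2) by (intro card_of_mono1) blast
      then show ?thesis using ordIso_ordLeq_trans[OF ordIso_symmetric[OF Ej]] by blast
    qed
    ultimately show ?thesis by blast
  qed
  define G where "G i W \<longleftrightarrow> ofilter (m i) W \<and> W \<noteq> Field (m i) \<and> Y i \<subseteq> W \<and> m j \<le>o |W - Y i|" for i W
  \<comment> \<open>Where no enlargement exists, which happens only on a bounded set of coordinates,
    the empty segment keeps \<open>Z\<close> initial.\<close>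
  define Z where "Z i = (if \<exists>W. G i W then SOME W. G i W else {})" for i
  have Z: "G i (Z i)" if "\<exists>W. G i W" for i using someI_ex[OF that] that by (simp add: Z_def)
  have ev: "\<forall>\<^sub>F i in tail k. G i (Z i)"
  proof -
    have "\<forall>\<^sub>F i in tail k. j \<in> underS k i" unfolding ev_tail using j by blast
    moreover have "\<forall>\<^sub>F i in tail k. Y i \<noteq> Field (m i)" using Y by (simp add: small_def)
    ultimately show ?thesis
    proof eventually_elim
      case (elim i)
      then show ?case using step1 by (intro Z) (simp add: G_def)
    qed
  qed
  have "initial k m Z" unfolding initial_def
  proof
    fix i
    show "ofilter (m i) (Z i)"
      using Z[of i] by (cases "\<exists>W. G i W") (auto simp: G_def Z_def ofilter_empty)
  qed
  moreover have "\<forall>\<^sub>F i in tail k. Z i \<noteq> Field (m i)"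
    using ev by (rule eventually_mono) (simp add: G_def)
  moreover have "\<forall>\<^sub>F i in tail k. Y i \<subseteq> Z i \<and> m j \<le>o |Z i - Y i|"
    using ev by (rule eventually_mono) (simp add: G_def)
  ultimately show ?thesis by (auto simp: small_def)
qed

text \<open>Locality in the earlier stages, as the well-founded recursion of
  \<open>chain_exists\<close> requires.\<close>

lemma step_cong:
  assumes eq: "\<And>b. b \<in> underS l d \<Longrightarrow> X b = X' b" and st: "step X d Z"
  shows "step X' d Z"
proof -
  have "lub_on k m X (underS l d) Z = lub_on k m X' (underS l d) Z"
    using eq by (simp add: lub_on_def)
  moreover have "(\<lambda>i. \<Union>a\<in>p. cut m (X a) i) = (\<lambda>i. \<Union>a\<in>p. cut m (X' a) i)" if "p \<subseteq> underS l d" for p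
    using that eq by (intro ext SUP_cong) auto
  ultimately show ?thesis using st eq by (simp add: step_def split: if_splits)
qed

text \<open>At a reached stage the requests are \<open>T b j\<close>, one per earlier
  \<open>b\<close> and coordinate \<open>j\<close>, and the unions over members of
  \<open>Q d\<close>. There are at most \<open>n\<close> of them, so a common bound exists in the
  product.\<close>

lemma step_exists:
  assumes d: "d \<in> Field l" and X: "\<And>b. b \<in> underS l d \<Longrightarrow> step X b (X b)"
  shows "\<exists>Z. step X d Z"
proof (cases "reached k l (underS l d)")
  case True
  have sX: "small k m (X b)" if "b \<in> underS l d" for b using step_small[OF X[OF that]] .
  define T where "T b j = (SOME Z. small k m Z \<and> (\<forall>\<^sub>F i in tail k. X b i \<subseteq> Z i \<and> m j \<le>o |Z i - X b i| ))" for b j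
  have T: "small k m (T b j) \<and> (\<forall>\<^sub>F i in tail k. X b i \<subseteq> T b j i \<and> m j \<le>o |T b j i - X b i| )"
    if "b \<in> underS l d" "j \<in> Field k" for b j
    unfolding T_def by (rule someI_ex[OF grow[OF sX[OF that(1)] that(2)]])
  let ?p = "{p \<in> Q d. p \<subseteq> underS l d \<and> |p| \<le>o k}"
  let ?u = "\<lambda>p i. \<Union>a\<in>p. cut m (X a) i"
  let ?Y = "(\<lambda>(b, j). T b j) ` (underS l d \<times> Field k) \<union> ?u ` ?p"
  have "|underS l d \<times> Field k| \<le>o n"
    using n card_underS_l[OF d] ordLeq_transitive[OF card_of_Field_ordLeq k_le_n] k
    by (intro card_of_Times_ordLeq_infinite_Field) (auto simp: cinfinite_def)
  moreover have "|?p| \<le>o n" by (rule card_of_subset_ordLeq[OF _ card_Q[OF d]]) auto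
  ultimately have "|?Y| \<le>o n" using n by (intro Un_Cinfinite_bound card_of_image_ordLeq)
  moreover have "small k m Y" if "Y \<in> ?Y" for Y
  proof -
    have "small k m (?u p)" if "p \<in> ?p" for p
      using small_UN[of p X] that sX by (auto simp: cut_def)
    moreover have "small k m (T b j)" if "b \<in> underS l d" "j \<in> Field k" for b j
      using T[OF that] by (rule conjunct1)
    ultimately show ?thesis using that by (elim UnE imageE) (simp_all add: case_prod_beta mem_Times_iff)
  qed
  ultimately have "\<exists>Z. small k m Z \<and> (\<forall>Y\<in>?Y. below k Y Z)" by (rule small_bound)
  then obtain Z where Z: "small k m Z" "\<forall>Y\<in>?Y. below k Y Z" by (elim exE conjE)
  have "\<forall>\<^sub>F i in tail k. X b i \<subseteq> Z i \<and> m j \<le>o |Z i - X b i|" if "b \<in> underS l d" "j \<in> Field k" for b j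
  proof -
    have "below k (T b j) Z" using that by (intro bspec[OF Z(2)]) auto
    then show ?thesis
      using conjunct2[OF T[OF that]] unfolding below_def
    proof eventually_elim
      case (elim i)
      then have "|T b j i - X b i| \<le>o |Z i - X b i|" by (intro card_of_mono1) blast
      with elim show ?case using ordLeq_transitive by blast
    qed
  qed
  moreover have "below k (?u p) Z" if "p \<in> ?p" for p using that by (intro bspec[OF Z(2)]) blast
  ultimately have "step X d Z" using Z(1) True by (simp add: step_def)
  then show ?thesis by blast
next
  case False
  have sX: "small k m (X b)" if "b \<in> underS l d" for b using step_small[OF X[OF that]] .
  obtain Z0 where Z0: "lub_on k m X (underS l d) Z0"
    using lub_exists[OF ofilter_underS[OF wl] X False] by blast
  have "|X ` underS l d| \<le>o n" by (rule card_of_image_ordLeq[OF card_underS_l[OF d]])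
  then obtain Z1 where Z1: "small k m Z1" "\<And>b. b \<in> underS l d \<Longrightarrow> below k (X b) Z1"
    using small_bound[of "X ` underS l d"] sX by blast
  \<comment> \<open>\<open>Z1\<close> is an upper bound inside the product. Intersecting with it
    brings the least upper bound into the product and, since the result stays below
    \<open>Z0\<close>, keeps it least.\<close>
  let ?Z = "\<lambda>i. Z0 i \<inter> Z1 i"
  have iniZ: "initial k m ?Z" using Z0 Z1 by (intro initial_Int) (auto simp: lub_on_def small_def)
  have "\<forall>\<^sub>F i in tail k. Z1 i \<noteq> Field (m i)" using Z1(1) by (simp add: small_def)
  with ev_Field have "\<forall>\<^sub>F i in tail k. ?Z i \<noteq> Field (m i)"
  proof eventually_elim
    case (elim i)
    then have "Z1 i \<subseteq> Field (m i)" using Z1(1) by (auto simp: small_def initial_def ofilter_def)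
    with elim show ?case by blast
  qed
  then have "small k m ?Z" using iniZ by (simp add: small_def)
  moreover have "lub_on k m X (underS l d) ?Z" unfolding lub_on_def
  proof (intro conjI allI impI ballI iniZ)
    fix a assume "a \<in> underS l d"
    then have "below k (X a) Z0" "below k (X a) Z1" using Z0 Z1 by (auto simp: lub_on_def)
    then show "below k (X a) ?Z" unfolding below_def by eventually_elim blast
  next
    fix h assume "initial k m h \<and> (\<forall>a\<in>underS l d. below k (X a) h)"
    then have "below k Z0 h" using Z0 by (simp add: lub_on_def)
    then show "below k ?Z h" unfolding below_def by eventually_elim blast
  qed
  ultimately have "step X d ?Z" using False by (simp add: step_def)
  then show ?thesis by blast
qed

lemma chain_exists: "\<exists>X. \<forall>d\<in>Field l. step X d (X d)"
proof -
  have "\<exists>X. \<forall>d. d \<in> Field l \<longrightarrow> step X d (X d)"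
  proof (rule dependent_wf_choice[of "l - Id"])
    show "wf (l - Id)" using wl by (simp add: well_order_on_def)
    fix f g :: "'b \<Rightarrow> 'i \<Rightarrow> 'a set" and d r
    assume "\<And>z. (z, d) \<in> l - Id \<Longrightarrow> f z = g z"
    then have "f b = g b" if "b \<in> underS l d" for b using that by (auto simp: in_underS_iff)
    then show "(d \<in> Field l \<longrightarrow> step f d r) = (d \<in> Field l \<longrightarrow> step g d r)"
      using step_cong[of d f g] step_cong[of d g f] by auto
  next
    fix d and f :: "'b \<Rightarrow> 'i \<Rightarrow> 'a set"
    assume f: "\<And>y. (y, d) \<in> l - Id \<Longrightarrow> y \<in> Field l \<longrightarrow> step f y (f y)"
    have "step f b (f b)" if "b \<in> underS l d" for b
      using f[of b] that in_underS_Field[OF that] by (auto simp: in_underS_iff)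
    then show "\<exists>r. d \<in> Field l \<longrightarrow> step f d r" using step_exists[of d f] by blast
  qed
  then show ?thesis by blast
qed

end

subsection \<open>Mad families along a chain\<close>

lemma card_of_ordLess_or_ordIso: "|A| \<le>o r \<Longrightarrow> |A| <o r \<or> |A| =o r"
  using ordLeq_iff_ordLess_or_ordIso by blast

lemma card_of_ordIso_not_ordLess: "|A| =o r \<Longrightarrow> \<not> |A| <o r"
  using not_ordLess_ordIso by blast

lemma card_of_Un_ordLess: "Cinfinite r \<Longrightarrow> |A| <o r \<Longrightarrow> |B| <o r \<Longrightarrow> |A \<union> B| <o r"
  using Un_Cinfinite_bound_strict by blast

lemma mad_ad: "mad r \<A> \<Longrightarrow> A \<in> \<A> \<Longrightarrow> B \<in> \<A> \<Longrightarrow> A \<noteq> B \<Longrightarrow> |A \<inter> B| <o r"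
  by (simp add: mad_def almost_disjoint_def)

lemma mad_card: "mad r \<A> \<Longrightarrow> A \<in> \<A> \<Longrightarrow> |A| =o r"
  by (simp add: mad_def almost_disjoint_def)

lemma mad_card_Union: "mad r \<A> \<Longrightarrow> \<A> \<noteq> {} \<Longrightarrow> |\<Union>\<A>| =o r"
  by (auto simp: mad_def almost_disjoint_def)

text \<open>The definition of maximality speaks only of sets outside the family; a member
  \<open>C\<close> meets itself in full size.\<close>

lemma mad_meets:
  assumes mad: "mad r \<A>" and C: "C \<subseteq> \<Union>\<A>" "|C| =o r" and ne: "\<A> \<noteq> {}"
  shows "\<exists>A\<in>\<A>. |A \<inter> C| =o r"
proof (rule ccontr)
  assume neg: "\<not> ?thesis"
  have "C \<notin> \<A>" using neg C(2) by auto
  have "|A \<inter> C| <o r" if "A \<in> \<A>" for A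
  proof -
    have "|A \<inter> C| \<le>o r"
      by (rule card_of_subset_ordLeq[OF _ ordIso_imp_ordLeq[OF C(2)]]) blast
    then show ?thesis using neg that card_of_ordLess_or_ordIso by blast
  qed
  then have "almost_disjoint r (\<A> \<union> {C})"
    using mad C ne mad_card_Union[OF mad ne]
    by (auto simp: mad_def almost_disjoint_def Int_commute Un_absorb1)
  with \<open>C \<notin> \<A>\<close> C(1) mad show False by (auto simp: mad_def)
qed

lemma madI:
  assumes card: "\<And>A. A \<in> \<A> \<Longrightarrow> |A| =o r" and U: "|\<Union>\<A>| =o r"
    and ad: "\<And>A B. A \<in> \<A> \<Longrightarrow> B \<in> \<A> \<Longrightarrow> A \<noteq> B \<Longrightarrow> |A \<inter> B| <o r"
    and meets: "\<And>C. C \<subseteq> \<Union>\<A> \<Longrightarrow> |C| =o r \<Longrightarrow> \<exists>A\<in>\<A>. \<not> |A \<inter> C| <o r"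
  shows "mad r \<A>"
  unfolding mad_def
proof
  show "almost_disjoint r \<A>" using card U ad by (simp add: almost_disjoint_def)
  show "\<not> (\<exists>C. C \<subseteq> \<Union>\<A> \<and> C \<notin> \<A> \<and> almost_disjoint r (\<A> \<union> {C}))"
  proof
    assume "\<exists>C. C \<subseteq> \<Union>\<A> \<and> C \<notin> \<A> \<and> almost_disjoint r (\<A> \<union> {C})"
    then obtain C where C: "C \<subseteq> \<Union>\<A>" "C \<notin> \<A>" "almost_disjoint r (\<A> \<union> {C})" by blast
    then have "|C| =o r" "\<And>A. A \<in> \<A> \<Longrightarrow> |A \<inter> C| <o r"
      unfolding almost_disjoint_def by auto
    with meets[OF C(1)] show False by blast
  qed
qed

section \<open>Regions below functions: sizes and least upper bounds\<close>

context singular_sequence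
begin

abbreviation graph :: "('i \<Rightarrow> 'a set) \<Rightarrow> ('i \<times> 'a) set" where
  "graph X \<equiv> Sigma (Field k) X"

lemma card_graph_ordLeq:
  assumes h: "h \<in> Field k" "k \<le>o m h" and X: "\<And>i. i \<in> Field k \<Longrightarrow> |X i| \<le>o m h"
  shows "|graph X| <o \<mu>"
proof -
  have "|graph X| \<le>o m h"
    using m_Cinfinite[OF h(1)] ordLeq_transitive[OF card_of_Field_ordLeq h(2)] k X
    by (intro card_of_Sigma_ordLeq_infinite_Field) (auto simp: cinfinite_def)
  then show ?thesis using m_less[OF h(1)] ordLeq_ordLess_trans by blast
qed

lemma k_max3:
  assumes "i \<in> Field k" "j \<in> Field k"
  shows "\<exists>h\<in>Field k. k \<le>o m h \<and> (i, h) \<in> k \<and> (j, h) \<in> k"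
proof -
  obtain h where h: "h \<in> Field k" "(i, h) \<in> k" "(j, h) \<in> k" using k_max assms by blast
  obtain h' where h': "h' \<in> Field k" "k <o m h'" using k_less_m by blast
  obtain g where g: "g \<in> Field k" "(h, g) \<in> k" "(h', g) \<in> k" using k_max h(1) h'(1) by blast
  have "k \<le>o m g" using h'(2) m_mono'[OF g(3)] ordLess_ordLeq_trans ordLess_imp_ordLeq by blast
  then show ?thesis using g h Well_order_trans[OF wk] by blast
qed

text \<open>Exceptions occur only at coordinates up to one \<open>j\<close>: at most
  \<open>k\<close> of them, each of size at most \<open>m h\<close>. So \<open>\<le>\<^sup>*\<close>
  between functions becomes inclusion of regions up to fewer than \<open>\<mu>\<close>
  points.\<close>

lemma below_diff_small:
  assumes X: "initial k m X" and XY: "below k X Y"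
  shows "|graph X - graph Y| <o \<mu>"
proof -
  obtain j where j: "j \<in> Field k" "\<And>i. j \<in> underS k i \<Longrightarrow> X i \<subseteq> Y i"
    using XY by (auto simp: below_def ev_tail)
  obtain h where h: "h \<in> Field k" "k \<le>o m h" "(j, h) \<in> k" using k_max3[OF j(1) j(1)] by blast
  let ?R = "\<lambda>i. if (i, j) \<in> k then Field (m i) else {}"
  have "graph X - graph Y \<subseteq> graph ?R"
  proof
    fix p assume "p \<in> graph X - graph Y"
    then obtain i x where p: "p = (i, x)" "i \<in> Field k" "x \<in> X i" "x \<notin> Y i" by blast
    then have "(i, j) \<in> k" using j(2)[of i] Well_order_linear[OF wk p(2) j(1)] by auto
    moreover have "x \<in> Field (m i)" using X p by (auto simp: initial_def ofilter_def)
    ultimately show "p \<in> graph ?R" using p by auto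
  qed
  moreover have "|graph ?R| <o \<mu>"
  proof (rule card_graph_ordLeq[OF h(1,2)])
    fix i assume i: "i \<in> Field k"
    show "|?R i| \<le>o m h"
    proof (cases "(i, j) \<in> k")
      case True
      then have "m i \<le>o m h" using m_mono' Well_order_trans[OF wk _ h(3)] by blast
      then show ?thesis using True card_of_m[OF i] ordIso_ordLeq_trans by auto
    next
      case False
      then show ?thesis using m_Cinfinite[OF h(1)] by (simp add: Card_order_empty)
    qed
  qed
  ultimately show ?thesis by (rule card_of_subset_ordLess)
qed

lemma card_graph_le: "initial k m X \<Longrightarrow> |graph X| \<le>o \<mu>"
proof (rule card_of_Sigma_ordLeq_infinite_Field)
  assume X: "initial k m X"
  show "\<forall>i\<in>Field k. |X i| \<le>o \<mu>"
  proof
    fix i assume i: "i \<in> Field k"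
    then have "|X i| \<le>o |Field (m i)|" using X by (intro card_of_mono1) (auto simp: initial_def ofilter_def)
    also have "|Field (m i)| =o m i" by (rule card_of_m[OF i])
    also have "m i <o \<mu>" by (rule m_less[OF i])
    finally show "|X i| \<le>o \<mu>" by (rule ordLess_imp_ordLeq)
  qed
  show "|Field k| \<le>o \<mu>"
    using k k_less card_of_Field_ordIso ordIso_ordLess_trans ordLess_imp_ordLeq by blast
qed (use mu in \<open>auto simp: cinfinite_def\<close>)

text \<open>The order type of \<open>E\<close> exceeds \<open>m j\<close>, so some point of
  \<open>E\<close> has predecessors in \<open>E\<close> of order type \<open>m j\<close>.\<close>

lemma wide_segment:
  assumes i: "i \<in> Field k" and j: "j \<in> Field k" and E: "E \<subseteq> Field (m i)" "m j <o |E|"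
  shows "\<exists>c\<in>E. m j \<le>o |underS (m i) c \<inter> E|"
proof -
  let ?r = "Restr (m i) E"
  have r: "well_order_on E ?r" using well_order_on_Restr[OF m_Well_order[OF i] E(1)] .
  then have w: "Well_order ?r" and F: "Field ?r = E" using well_order_on_Well_order by auto
  have "m j <o ?r" using E(2) card_of_least[OF r] ordLess_ordLeq_trans by blast
  then obtain c where c: "c \<in> E" "m j =o Restr ?r (underS ?r c)"
    using ordLess_iff_ordIso_Restr[OF w m_Well_order[OF j]] F by blast
  have "m j =o |Field (m j)|" using card_of_m[OF j] ordIso_symmetric by blast
  also have "|Field (m j)| =o |Field (Restr ?r (underS ?r c))|" by (rule card_of_cong[OF c(2)])
  also have "|Field (Restr ?r (underS ?r c))| \<le>o |underS (m i) c \<inter> E|"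
    by (rule card_of_mono1) (auto simp: Field_def underS_def)
  finally show ?thesis using c(1) by blast
qed

text \<open>A counterexample \<open>C\<close> would allow \<open>Z\<close> to be lowered. By the
  pigeonhole unboundedly many \<open>X b\<close> meet \<open>C\<close> in fewer than
  \<open>m j\<close> points. Where a column of \<open>C\<close> is wider than \<open>m j2\<close>,
  cut \<open>Z\<close> at a point \<open>w i\<close> with at least \<open>m j2\<close> column points
  below it: such \<open>X b\<close> cannot reach past it. The lowered function is still an upper
  bound, so leastness of \<open>Z\<close> confines the wide columns to a bounded set of coordinates
  and makes \<open>C\<close> smaller than \<open>\<mu>\<close>.\<close>

lemma lub_no_large:
  assumes r: "Well_order r" "ofilter r S" and S: "\<not> reached k r S" and lub: "lub_on k m X S Z"
    and ini: "\<And>b. b \<in> S \<Longrightarrow> initial k m (X b)"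
    and mono: "\<And>b c. b \<in> S \<Longrightarrow> c \<in> S \<Longrightarrow> (b, c) \<in> r \<Longrightarrow> below k (X b) (X c)"
    and C: "C \<subseteq> graph Z" "|C| =o \<mu>"
  shows "\<exists>a\<in>S. \<not> |C \<inter> graph (X a)| <o \<mu>"
proof (rule ccontr)
  assume "\<not> ?thesis"
  then have "\<forall>a\<in>S. \<exists>i\<in>Field k. |C \<inter> graph (X a)| <o m i" using m_cofinal' by blast
  then obtain c where c: "\<And>a. a \<in> S \<Longrightarrow> c a \<in> Field k" "\<And>a. a \<in> S \<Longrightarrow> |C \<inter> graph (X a)| <o m (c a)"
    by metis
  obtain j where j: "j \<in> Field k" "\<And>a. a \<in> S \<Longrightarrow> \<exists>b\<in>S. (a, b) \<in> r \<and> (c b, j) \<in> k"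
    using pigeonhole[OF r S, of c] c(1) by meson
  obtain j2 where j2: "j \<in> underS k j2" using k_greater[OF j(1)] by blast
  have j2F: "j2 \<in> Field k" using in_underS_Field[OF j2] by blast
  define E where "E i = {x. (i, x) \<in> C}" for i
  have EZ: "E i \<subseteq> Z i" "i \<in> Field k" if "E i \<noteq> {}" for i using C(1) that by (auto simp: E_def)
  have Zi: "Z i \<subseteq> Field (m i)" "ofilter (m i) (Z i)" if "i \<in> Field k" for i
    using lub that by (auto simp: lub_on_def initial_def ofilter_def)
  have EF: "E i \<subseteq> Field (m i)" if "i \<in> Field k" for i using EZ[of i] Zi[OF that] by blast
  define J where "J = {i \<in> Field k. m j2 <o |E i| }"
  have "\<forall>i\<in>J. \<exists>x\<in>E i. m j2 \<le>o |underS (m i) x \<inter> E i|"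
    using wide_segment[OF _ j2F EF] by (simp add: J_def)
  then obtain w where w: "\<And>i. i \<in> J \<Longrightarrow> w i \<in> E i"
    "\<And>i. i \<in> J \<Longrightarrow> m j2 \<le>o |underS (m i) (w i) \<inter> E i|" by metis
  \<comment> \<open>For \<open>i\<close> in \<open>J\<close> the point \<open>w i\<close> belongs to
    \<open>Z i\<close> but not to \<open>h i\<close>, which is what later bounds
    \<open>J\<close>.\<close>
  define h where "h i = (if i \<in> J then underS (m i) (w i) else Z i)" for i
  have "initial k m h"
    using Zi(2) ofilter_underS[OF m_Well_order] by (simp add: initial_def h_def)
  moreover have "below k (X a) h" if a: "a \<in> S" for a
  proof -
    obtain b where b: "b \<in> S" "(a, b) \<in> r" "(c b, j) \<in> k" using j(2)[OF a] by blast
    have Cb: "|C \<inter> graph (X b)| <o m j" using c(2)[OF b(1)] m_mono'[OF b(3)] ordLess_ordLeq_trans by blast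
    have J: "X b i \<subseteq> underS (m i) (w i)" if i: "i \<in> J" for i
    proof (rule ccontr)
      assume neg: "\<not> ?thesis"
      have iF: "i \<in> Field k" using i by (simp add: J_def)
      have "ofilter (m i) (X b i)" using ini[OF b(1)] iF by (simp add: initial_def)
      then have sub: "underS (m i) (w i) \<subseteq> X b i"
        using neg ofilter_linear[OF m_Well_order[OF iF] _ ofilter_underS[OF m_Well_order[OF iF]]] by blast
      have "|underS (m i) (w i) \<inter> E i| \<le>o |C \<inter> graph (X b)|"
        by (rule card_of_ordLeqI[of "Pair i"]) (use sub iF in \<open>auto simp: E_def inj_on_def\<close>)
      then have "m j2 <o m j" using w(2)[OF i] Cb ordLeq_transitive ordLeq_ordLess_trans by blast
      then show False using m_mono[OF j2] ordLess_transitive ordLess_irreflexive by blast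
    qed
    have "below k (X b) Z" using lub b(1) by (simp add: lub_on_def)
    then have "below k (X b) h" unfolding below_def
      by (rule eventually_mono) (use J in \<open>auto simp: h_def\<close>)
    then show ?thesis using mono[OF a b(1,2)] below_trans by blast
  qed
  ultimately have "below k Z h" using lub by (simp add: lub_on_def)
  then obtain j3 where j3: "j3 \<in> Field k" "\<And>i. j3 \<in> underS k i \<Longrightarrow> Z i \<subseteq> h i"
    by (auto simp: below_def ev_tail)
  have J3: "(i, j3) \<in> k" if i: "i \<in> J" for i
  proof (rule ccontr)
    assume "(i, j3) \<notin> k"
    then have "Z i \<subseteq> h i" using j3 Well_order_linear[OF wk, of i j3] i by (auto simp: J_def)
    moreover have "w i \<in> Z i" using w(1)[OF i] EZ(1)[of i] by blast
    ultimately show False using i underS_notIn[of "w i" "m i"] by (auto simp: h_def)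
  qed
  obtain g where g: "g \<in> Field k" "k \<le>o m g" "(j2, g) \<in> k" "(j3, g) \<in> k"
    using k_max3[OF j2F j3(1)] by blast
  have "|E i| \<le>o m g" if i: "i \<in> Field k" for i
  proof (cases "i \<in> J")
    case True
    have "|E i| \<le>o |Field (m i)|" by (rule card_of_mono1[OF EF[OF i]])
    also have "|Field (m i)| =o m i" by (rule card_of_m[OF i])
    also have "m i \<le>o m g" using m_mono' Well_order_trans[OF wk J3[OF True] g(4)] by blast
    finally show ?thesis .
  next
    case False
    then have "|E i| \<le>o m j2"
      using i card_of_Well_order not_ordLess_iff_ordLeq m_Well_order[OF j2F] by (auto simp: J_def)
    then show ?thesis using m_mono'[OF g(3)] ordLeq_transitive by blast
  qed
  then have "|graph E| <o \<mu>" by (rule card_graph_ordLeq[OF g(1,2)])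
  moreover have "C \<subseteq> graph E" using C(1) by (auto simp: E_def)
  ultimately have "|C| <o \<mu>" using card_of_subset_ordLess by blast
  with C(2) show False using card_of_ordIso_not_ordLess by blast
qed

end

text \<open>The piece of the final family contributed by one region \<open>Z\<close>, with
  \<open>\<X>\<close> the earlier regions. Maximality is demanded only against sets almost disjoint
  from all of \<open>\<X>\<close>, since other sets are caught earlier. A block may be
  empty.\<close>

definition block :: "'r rel \<Rightarrow> 'd set \<Rightarrow> 'd set set \<Rightarrow> 'd set set \<Rightarrow> bool" where
  "block r Z \<X> \<B> \<longleftrightarrow> \<B> \<subseteq> Pow Z \<and> (\<forall>B\<in>\<B>. |B| =o r) \<and>
     (\<forall>B\<in>\<B>. \<forall>B'\<in>\<B>. B \<noteq> B' \<longrightarrow> |B \<inter> B'| <o r) \<and> (\<forall>B\<in>\<B>. \<forall>X\<in>\<X>. |B \<inter> X| <o r) \<and>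
     (\<forall>C. C \<subseteq> Z \<and> |C| =o r \<and> (\<forall>X\<in>\<X>. |C \<inter> X| <o r) \<longrightarrow> (\<exists>B\<in>\<B>. \<not> |B \<inter> C| <o r))"

section \<open>Transporting the given mad family\<close>

context singular_sequence
begin

lemma card_underS_k: "j \<in> Field k \<Longrightarrow> |underS k j| <o k"
  using card_of_underS[of k j] k by blast

lemma card_under_k: "j \<in> Field k \<Longrightarrow> |under k j| <o k"
  using k_succ[of j] card_underS_k by metis

text \<open>Disjoint parts \<open>Y j\<close> of the regions are embedded into disjoint parts
  \<open>A' j\<close> of \<open>k\<close> chosen members of the mad family; \<open>\<phi>\<close> is
  the combined injection. Preimages of the remaining members inherit almost disjointness and
  maximality, and \<open>R\<close>, the part of \<open>Z\<close> outside all regions, is one more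
  candidate.\<close>

lemma block_exists:
  assumes mad: "mad \<mu> \<A>" and kA: "k \<le>o |\<A>|" and Z: "|Z| \<le>o \<mu>"
  shows "\<exists>\<B>. |\<B>| \<le>o |\<A>| \<and> block \<mu> Z (X ` Field k) \<B>"
proof -
  have "|Field k| \<le>o |\<A>|" using kA k card_of_Field_ordIso ordIso_ordLeq_trans by blast
  then obtain A where A: "inj_on A (Field k)" "A ` Field k \<subseteq> \<A>" using card_of_ordLeq by metis
  have ne: "\<A> \<noteq> {}" using A(2) k_nonempty by blast
  \<comment> \<open>Removing fewer than \<open>k\<close> earlier members, each meeting
    \<open>A j\<close> in fewer than \<open>\<mu>\<close> points, leaves \<open>A' j\<close> of size
    \<open>\<mu>\<close>, large enough to receive \<open>Y j\<close>.\<close>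
  define A' where "A' j = A j - (\<Union>i\<in>underS k j. A i)" for j
  define Y where "Y j = (Z \<inter> X j) - (\<Union>i\<in>underS k j. X i)" for j
  have AA: "|A j \<inter> a| <o \<mu>" if "j \<in> Field k" "a \<in> \<A>" "a \<noteq> A j" for j a
    using mad_ad[OF mad _ that(2)] A(2) that by blast
  have cA': "|A' j| =o \<mu>" if j: "j \<in> Field k" for j
  proof -
    have "|A j| =o \<mu>" using mad_card[OF mad] A(2) j by blast
    then have "|A' j| \<le>o \<mu>" unfolding A'_def
      using card_of_subset_ordLeq[OF Diff_subset] ordIso_imp_ordLeq by blast
    moreover have "\<not> |A' j| <o \<mu>"
    proof
      assume s: "|A' j| <o \<mu>"
      have "|\<Union>i\<in>underS k j. A j \<inter> A i| <o \<mu>"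
      proof (rule small_Union[OF card_underS_k[OF j]])
        fix i assume i: "i \<in> underS k j"
        then have "i \<in> Field k" "A i \<noteq> A j" using in_underS_Field[OF i] A(1) j
          by (auto simp: in_underS_iff inj_on_def)
        then show "|A j \<inter> A i| <o \<mu>" using AA[OF j] A(2) by blast
      qed
      then have "|A' j \<union> (\<Union>i\<in>underS k j. A j \<inter> A i)| <o \<mu>" using s mu card_of_Un_ordLess by blast
      then have "|A j| <o \<mu>" by (rule card_of_subset_ordLess[rotated]) (auto simp: A'_def)
      with \<open>|A j| =o \<mu>\<close> show False using card_of_ordIso_not_ordLess by blast
    qed
    ultimately show ?thesis using card_of_ordLess_or_ordIso by blast
  qed
  have "\<exists>f. inj_on f (Y j) \<and> f ` Y j \<subseteq> A' j" if j: "j \<in> Field k" for j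
  proof -
    have "|Y j| \<le>o \<mu>" by (rule card_of_subset_ordLeq[OF _ Z]) (auto simp: Y_def)
    then have "|Y j| \<le>o |A' j|" using cA'[OF j] ordIso_symmetric ordLeq_ordIso_trans by blast
    then show ?thesis using card_of_ordLeq by blast
  qed
  then obtain f where f: "\<And>j. j \<in> Field k \<Longrightarrow> inj_on (f j) (Y j)" "\<And>j. j \<in> Field k \<Longrightarrow> f j ` Y j \<subseteq> A' j"
    by metis
  define U where "U = (\<Union>j\<in>Field k. Y j)"
  have idx: "\<exists>j\<in>Field k. z \<in> Y j \<and> (j, i) \<in> k" if "z \<in> Z" "z \<in> X i" "i \<in> Field k" for z i
  proof -
    have "{j \<in> Field k. z \<in> X j} \<subseteq> Field k" "{j \<in> Field k. z \<in> X j} \<noteq> {}" using that by auto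
    then obtain j where j: "j \<in> {j \<in> Field k. z \<in> X j}" "\<And>i. i \<in> {j \<in> Field k. z \<in> X j} \<Longrightarrow> (j, i) \<in> k"
      by (rule Well_order_min[OF wk]) blast
    have "z \<notin> X i" if i: "i \<in> underS k j" for i
      using j(2)[of i] in_underS_Field[OF i] i Well_order_antisym[OF wk, of i j]
      by (auto simp: in_underS_iff)
    then have "z \<in> Y j" using j(1) that(1) by (auto simp: Y_def)
    moreover have "(j, i) \<in> k" using j(2) that by blast
    ultimately show ?thesis using j(1) by blast
  qed
  define J where "J z = (SOME j. j \<in> Field k \<and> z \<in> Y j)" for z
  have Jspec: "J z \<in> Field k \<and> z \<in> Y (J z)" if "z \<in> U" for z
    unfolding J_def by (rule someI_ex) (use that in \<open>auto simp: U_def\<close>)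
  define \<phi> where "\<phi> z = f (J z) z" for z
  have \<phi>A': "\<phi> z \<in> A' (J z)" if "z \<in> U" for z
    unfolding \<phi>_def using f(2) Jspec[OF that] by blast
  have disA': "i = j" if "a \<in> A' i" "a \<in> A' j" "i \<in> Field k" "j \<in> Field k" for a i j
    using that Well_order_linear[OF wk, of i j] by (auto simp: A'_def in_underS_iff)
  have disY: "i = j" if "a \<in> Y i" "a \<in> Y j" "i \<in> Field k" "j \<in> Field k" for a i j
    using that Well_order_linear[OF wk, of i j] by (auto simp: Y_def in_underS_iff)
  have inj: "inj_on \<phi> U"
  proof (rule inj_onI)
    fix x y assume xy: "x \<in> U" "y \<in> U" "\<phi> x = \<phi> y"
    then have "J x = J y" using disA'[of "\<phi> x"] \<phi>A'[OF xy(1)] \<phi>A'[OF xy(2)] Jspec by auto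
    then show "x = y" using xy f(1)[of "J x"] Jspec[OF xy(1)] Jspec[OF xy(2)]
      by (auto simp: \<phi>_def inj_on_def)
  qed
  have UZ: "U \<subseteq> Z" by (auto simp: U_def Y_def)
  have \<phi>im: "|\<phi> ` W| =o |W|" if "W \<subseteq> U" for W
    using card_of_inj_image[OF inj_on_subset[OF inj that]] .
  define R where "R = Z - U"
  define pull where "pull a = {z \<in> U. \<phi> z \<in> a}" for a
  \<comment> \<open>Preimages can shrink, since \<open>\<phi>\<close> need not be onto; those of
    size below \<open>\<mu>\<close> are dropped, and so is a small \<open>R\<close>.\<close>
  define \<B> where "\<B> = {B. (B = R \<or> B \<in> pull ` (\<A> - A ` Field k)) \<and> |B| =o \<mu>}"
  have pullZ: "|pull a \<inter> W| \<le>o \<mu>" for a W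
    by (rule card_of_subset_ordLeq[OF _ Z]) (use UZ in \<open>auto simp: pull_def\<close>)
  have BX: "|B \<inter> X i| <o \<mu>" if B: "B \<in> \<B>" and i: "i \<in> Field k" for B i
  proof (cases "B = R")
    case True
    have "R \<inter> X i = {}" using idx[OF _ _ i] unfolding R_def U_def by blast
    moreover have "|{}| <o \<mu>" using m_less[OF i] m_Cinfinite[OF i] Card_order_empty ordLeq_ordLess_trans by blast
    ultimately show ?thesis using True by simp
  next
    case False
    then obtain a where a: "a \<in> \<A>" "a \<notin> A ` Field k" "B = pull a" using B by (auto simp: \<B>_def)
    \<comment> \<open>A point of \<open>X i\<close> has first index at most \<open>i\<close>, so
      \<open>\<phi>\<close> sends \<open>B \<inter> X i\<close> into the union of fewer than
      \<open>k\<close> small sets \<open>A j \<inter> a\<close>.\<close>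
    have "|\<Union>j\<in>under k i. A j \<inter> a| <o \<mu>"
    proof (rule small_Union[OF card_under_k[OF i]])
      fix j assume "j \<in> under k i"
      then have "j \<in> Field k" using under_Field[of k i] by blast
      then show "|A j \<inter> a| <o \<mu>" using AA[of j a] a by blast
    qed
    moreover have "\<phi> ` (B \<inter> X i) \<subseteq> (\<Union>j\<in>under k i. A j \<inter> a)"
    proof (rule image_subsetI)
      fix z assume z: "z \<in> B \<inter> X i"
      then have zU: "z \<in> U" "\<phi> z \<in> a" using a by (auto simp: pull_def)
      obtain j where j: "j \<in> Field k" "z \<in> Y j" "(j, i) \<in> k" using idx[OF _ _ i] z zU UZ by blast
      then have "J z = j" using disY[of z "J z" j] Jspec[OF zU(1)] by simp
      then have "\<phi> z \<in> A j" using \<phi>A'[OF zU(1)] by (auto simp: A'_def)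
      with zU(2) j(3) show "\<phi> z \<in> (\<Union>j\<in>under k i. A j \<inter> a)" by (auto simp: under_def)
    qed
    ultimately have "|\<phi> ` (B \<inter> X i)| <o \<mu>" using card_of_subset_ordLess by blast
    moreover have "B \<inter> X i \<subseteq> U" using a by (auto simp: pull_def)
    ultimately show ?thesis using \<phi>im ordIso_symmetric ordIso_ordLess_trans by metis
  qed
  have ad: "|B \<inter> B'| <o \<mu>" if B: "B \<in> \<B>" "B' \<in> \<B>" "B \<noteq> B'" for B B'
  proof (cases "B = R \<or> B' = R")
    case True
    then have "B \<inter> B' = {}" using B by (auto simp: \<B>_def pull_def R_def)
    moreover obtain i where "i \<in> Field k" using k_nonempty by blast
    then have "|{}| <o \<mu>" using m_less m_Cinfinite Card_order_empty ordLeq_ordLess_trans by blast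
    ultimately show ?thesis by simp
  next
    case False
    then obtain a a' where a: "a \<in> \<A>" "B = pull a" "a' \<in> \<A>" "B' = pull a'" using B by (auto simp: \<B>_def)
    then have "a \<noteq> a'" using B(3) by blast
    then have "|a \<inter> a'| <o \<mu>" using mad_ad[OF mad] a by blast
    moreover have "\<phi> ` (B \<inter> B') \<subseteq> a \<inter> a'" using a by (auto simp: pull_def)
    ultimately have "|\<phi> ` (B \<inter> B')| <o \<mu>" using card_of_subset_ordLess by blast
    moreover have "B \<inter> B' \<subseteq> U" using a by (auto simp: pull_def)
    ultimately show ?thesis using \<phi>im ordIso_symmetric ordIso_ordLess_trans by metis
  qed
  have meets: "\<exists>B\<in>\<B>. \<not> |B \<inter> C| <o \<mu>"
    if C: "C \<subseteq> Z" "|C| =o \<mu>" and CX: "\<And>i. i \<in> Field k \<Longrightarrow> |C \<inter> X i| <o \<mu>" for C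
  proof (cases "|R \<inter> C| <o \<mu>")
    case False
    have "|R| \<le>o \<mu>" by (rule card_of_subset_ordLeq[OF _ Z]) (auto simp: R_def)
    moreover have "\<not> |R| <o \<mu>" using False card_of_subset_ordLess[OF Int_lower1] by blast
    ultimately have "R \<in> \<B>" using card_of_ordLess_or_ordIso by (auto simp: \<B>_def)
    with False show ?thesis by blast
  next
    case True
    have "\<not> |C \<inter> U| <o \<mu>"
    proof
      assume "|C \<inter> U| <o \<mu>"
      then have "|R \<inter> C \<union> C \<inter> U| <o \<mu>" using True mu card_of_Un_ordLess by blast
      then have "|C| <o \<mu>" by (rule card_of_subset_ordLess[rotated]) (use C in \<open>auto simp: R_def\<close>)
      with C(2) show False using card_of_ordIso_not_ordLess by blast
    qed
    moreover have "|C \<inter> U| \<le>o \<mu>" by (rule card_of_subset_ordLeq[OF _ Z]) (use C in auto)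
    ultimately have "|C \<inter> U| =o \<mu>" using card_of_ordLess_or_ordIso by blast
    then have im: "|\<phi> ` (C \<inter> U)| =o \<mu>" using \<phi>im[of "C \<inter> U"] ordIso_transitive by blast
    have "\<phi> ` (C \<inter> U) \<subseteq> \<Union>\<A>"
    proof (rule image_subsetI)
      fix z assume "z \<in> C \<inter> U"
      then have "\<phi> z \<in> A (J z)" "J z \<in> Field k" using \<phi>A' Jspec by (auto simp: A'_def)
      then show "\<phi> z \<in> \<Union>\<A>" using A(2) by blast
    qed
    then obtain a where a: "a \<in> \<A>" "|a \<inter> \<phi> ` (C \<inter> U)| =o \<mu>" using mad_meets[OF mad _ im ne] by blast
    \<comment> \<open>The member that is met cannot be some \<open>A i\<close>: a point sent into
      \<open>A i\<close> has first index at most \<open>i\<close>, because \<open>A' j\<close>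
      avoids \<open>A i\<close> for \<open>i\<close> below \<open>j\<close>, and \<open>C\<close>
      has fewer than \<open>\<mu>\<close> points in the regions up to \<open>i\<close>.\<close>
    have "a \<notin> A ` Field k"
    proof
      assume "a \<in> A ` Field k"
      then obtain i where i: "i \<in> Field k" "a = A i" by blast
      have "|\<Union>j\<in>under k i. C \<inter> X j| <o \<mu>"
        using under_Field[of k i] by (intro small_Union[OF card_under_k[OF i(1)]] CX) blast
      then have "|\<phi> ` (\<Union>j\<in>under k i. C \<inter> X j)| <o \<mu>" by (rule card_of_image_ordLess)
      moreover have "a \<inter> \<phi> ` (C \<inter> U) \<subseteq> \<phi> ` (\<Union>j\<in>under k i. C \<inter> X j)"
      proof
        fix y assume "y \<in> a \<inter> \<phi> ` (C \<inter> U)"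
        then obtain z where z: "z \<in> C" "z \<in> U" "y = \<phi> z" "\<phi> z \<in> A i" using i(2) by blast
        have "i \<notin> underS k (J z)" using \<phi>A'[OF z(2)] z(4) by (auto simp: A'_def)
        then have "(J z, i) \<in> k" using Well_order_linear[OF wk _ i(1), of "J z"] Jspec[OF z(2)] by blast
        moreover have "z \<in> X (J z)" using Jspec[OF z(2)] by (auto simp: Y_def)
        ultimately show "y \<in> \<phi> ` (\<Union>j\<in>under k i. C \<inter> X j)" using z by (auto simp: under_def)
      qed
      ultimately show False using a(2) card_of_subset_ordLess card_of_ordIso_not_ordLess by blast
    qed
    moreover have nB: "\<not> |pull a \<inter> C| <o \<mu>"
    proof
      assume "|pull a \<inter> C| <o \<mu>"
      then have "|\<phi> ` (pull a \<inter> C)| <o \<mu>" by (rule card_of_image_ordLess)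
      moreover have "a \<inter> \<phi> ` (C \<inter> U) \<subseteq> \<phi> ` (pull a \<inter> C)" by (auto simp: pull_def)
      ultimately show False using a(2) card_of_subset_ordLess card_of_ordIso_not_ordLess by blast
    qed
    moreover have "|pull a| =o \<mu>"
    proof -
      have "\<not> |pull a| <o \<mu>" using nB card_of_subset_ordLess[OF Int_lower1] by blast
      moreover have "|pull a| \<le>o \<mu>" using pullZ[of a UNIV] by simp
      ultimately show ?thesis using card_of_ordLess_or_ordIso by blast
    qed
    ultimately show ?thesis using a(1) by (auto simp: \<B>_def)
  qed
  have "Cinfinite |\<A>|"
    using cinfinite_mono[OF kA] k card_of_Card_order by blast
  moreover have "|pull ` (\<A> - A ` Field k)| \<le>o |\<A>|"
    by (rule card_of_image_ordLeq[OF card_of_mono1]) blast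
  ultimately have "|insert R (pull ` (\<A> - A ` Field k))| \<le>o |\<A>|" by (rule card_of_insert_ordLeq)
  then have "|\<B>| \<le>o |\<A>|" by (rule card_of_subset_ordLeq[rotated]) (auto simp: \<B>_def)
  moreover have "\<B> \<subseteq> Pow Z" using UZ by (auto simp: \<B>_def pull_def R_def)
  then have "block \<mu> Z (X ` Field k) \<B>"
    unfolding block_def using BX ad meets by (auto simp: \<B>_def)
  ultimately show ?thesis by blast
qed

end

lemma blockD:
  assumes "block r Z \<X> \<B>"
  shows "B \<in> \<B> \<Longrightarrow> B \<subseteq> Z" "B \<in> \<B> \<Longrightarrow> |B| =o r"
    "B \<in> \<B> \<Longrightarrow> B' \<in> \<B> \<Longrightarrow> B \<noteq> B' \<Longrightarrow> |B \<inter> B'| <o r"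
    "B \<in> \<B> \<Longrightarrow> X \<in> \<X> \<Longrightarrow> |B \<inter> X| <o r"
    "C \<subseteq> Z \<Longrightarrow> |C| =o r \<Longrightarrow> (\<And>X. X \<in> \<X> \<Longrightarrow> |C \<inter> X| <o r) \<Longrightarrow> \<exists>B\<in>\<B>. \<not> |B \<inter> C| <o r"
  using assms by (auto simp: block_def)

section \<open>Blocks along the chain and their union\<close>

context chain_setup
begin

lemma ev_ex:
  assumes "\<forall>\<^sub>F i in tail k. P i" shows "\<exists>i\<in>Field k. P i"
proof -
  obtain j where "j \<in> Field k" "\<And>i. j \<in> underS k i \<Longrightarrow> P i" using assms by (auto simp: ev_tail)
  then show ?thesis using k_greater in_underS_Field by metis
qed

lemma Int_graph_small:
  assumes X: "initial k m X" and XY: "below k X Y" and B: "|B \<inter> graph Y| <o \<mu>"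
  shows "|B \<inter> graph X| <o \<mu>"
proof -
  have "|(B \<inter> graph Y) \<union> (graph X - graph Y)| <o \<mu>"
    using mu B below_diff_small[OF X XY] card_of_Un_ordLess by blast
  then show ?thesis by (rule card_of_subset_ordLess[rotated]) blast
qed

text \<open>The sequence \<open>g\<close> reduces the earlier regions to \<open>k\<close> of them:
  every \<open>X a\<close> is below some \<open>X (g i)\<close>, so a set almost disjoint from
  \<open>graph (X (g i))\<close> is almost disjoint from \<open>graph (X a)\<close>.\<close>

lemma block_at_reached:
  assumes mad: "mad \<mu> \<A>" "k \<le>o |\<A>|" and S: "ofilter l S" "reached k l S"
    and X: "\<And>d. d \<in> S \<Longrightarrow> step X d (X d)" and V: "initial k m V"
  shows "\<exists>\<B>. |\<B>| \<le>o |\<A>| \<and> block \<mu> (graph V) ((\<lambda>a. graph (X a)) ` S) \<B>"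
proof -
  obtain g where g: "\<And>i. i \<in> Field k \<Longrightarrow> g i \<in> S"
    "\<And>a. a \<in> S \<Longrightarrow> \<exists>i\<in>Field k. \<forall>j. (i, j) \<in> k \<longrightarrow> (a, g j) \<in> l"
    using S(2) by (auto simp: reached_def)
  obtain \<B> where B: "|\<B>| \<le>o |\<A>|" "block \<mu> (graph V) ((\<lambda>i. graph (X (g i))) ` Field k) \<B>"
    using block_exists[OF mad card_graph_le[OF V]] by blast
  have "|b \<inter> graph (X a)| <o \<mu>" if that: "b \<in> \<B>" "a \<in> S" for a b
  proof -
    have "\<exists>i\<in>Field k. (a, g i) \<in> l" using g(2)[OF that(2)] Well_order_refl[OF wk] by blast
    then obtain i where i: "i \<in> Field k" "(a, g i) \<in> l" by blast
    have "|b \<inter> graph (X (g i))| <o \<mu>" using blockD(4)[OF B(2) that(1)] i(1) by blast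
    then show ?thesis
      using Int_graph_small[OF small_initial[OF step_small[OF X[OF that(2)]]]]
        chain_below[of S X "g i" a] X g(1)[OF i(1)] i(2) by blast
  qed
  then have "block \<mu> (graph V) ((\<lambda>a. graph (X a)) ` S) \<B>"
    using B(2) g(1) unfolding block_def by simp
  with B(1) show ?thesis by blast
qed

lemma lub_meets:
  assumes S: "ofilter l S" "\<not> reached k l S" and X: "\<And>d. d \<in> S \<Longrightarrow> step X d (X d)"
    and V: "lub_on k m X S V" and C: "C \<subseteq> graph V" "|C| =o \<mu>"
  shows "\<exists>a\<in>S. \<not> |C \<inter> graph (X a)| <o \<mu>"
proof (rule lub_no_large[OF wl S V _ _ C])
  show "initial k m (X b)" if "b \<in> S" for b
    using small_initial[OF step_small[OF X[OF that]]] .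
  show "below k (X b) (X c)" if "b \<in> S" "c \<in> S" "(b, c) \<in> l" for b c
    using X that(2,3) by (rule chain_below)
qed

text \<open>At a least upper bound nothing new of size \<open>\<mu>\<close> appears in the region,
  so the empty block is maximal; at reached stages the mad family is imported.\<close>

lemma block_at:
  assumes mad: "mad \<mu> \<A>" "k \<le>o |\<A>|" and d: "d \<in> Field l"
    and X: "\<And>d. d \<in> Field l \<Longrightarrow> step X d (X d)"
  shows "\<exists>\<B>. |\<B>| \<le>o |\<A>| \<and> block \<mu> (graph (X d)) ((\<lambda>a. graph (X a)) ` underS l d) \<B>"
proof (cases "reached k l (underS l d)")
  case True
  show ?thesis
  proof (rule block_at_reached[OF mad ofilter_underS[OF wl] True])
    show "step X b (X b)" if "b \<in> underS l d" for b using X in_underS_Field[OF that] by blast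
    show "initial k m (X d)" using small_initial[OF step_small[OF X[OF d]]] .
  qed
next
  case False
  have lub: "lub_on k m X (underS l d) (X d)" using X[OF d] False by (simp add: step_def)
  have "\<exists>a\<in>underS l d. \<not> |C \<inter> graph (X a)| <o \<mu>" if "C \<subseteq> graph (X d)" "|C| =o \<mu>" for C
  proof (rule lub_meets[OF ofilter_underS[OF wl] False _ _ that])
    show "step X b (X b)" if "b \<in> underS l d" for b using X in_underS_Field[OF that] by blast
  qed (rule lub)
  then have "block \<mu> (graph (X d)) ((\<lambda>a. graph (X a)) ` underS l d) {}"
    unfolding block_def by simp
  moreover have "|{}| \<le>o |\<A>|" by (rule card_of_empty)
  ultimately show ?thesis by blast
qed

text \<open>The whole grid is treated as a last region. If \<open>Field l\<close> is not reached, a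
  set almost disjoint from every \<open>graph (X a)\<close> is almost disjoint from the graph of
  their least upper bound \<open>Z\<close>. So the complement \<open>R\<close> of that graph alone
  forms the block, provided that it has size \<open>\<mu>\<close>.\<close>

lemma block_top:
  assumes mad: "mad \<mu> \<A>" "k \<le>o |\<A>|" and X: "\<And>d. d \<in> Field l \<Longrightarrow> step X d (X d)"
  shows "\<exists>\<B>. |\<B>| \<le>o |\<A>| \<and> block \<mu> (graph (\<lambda>i. Field (m i))) ((\<lambda>a. graph (X a)) ` Field l) \<B>"
proof (cases "reached k l (Field l)")
  case True
  show ?thesis
    by (rule block_at_reached[OF mad ofilter_Field True X initial_Field])
next
  case False
  let ?D = "graph (\<lambda>i. Field (m i))"
  obtain Z where Z: "lub_on k m X (Field l) Z" using lub_exists[OF ofilter_Field X False] by blast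
  define R where "R = ?D - graph Z"
  define \<B> where "\<B> = {B. B = R \<and> |B| =o \<mu>}"
  have D: "|?D| \<le>o \<mu>" by (rule card_graph_le[OF initial_Field])
  have "|R \<inter> graph (X a)| <o \<mu>" if "a \<in> Field l" for a
  proof (rule card_of_subset_ordLess)
    show "|graph (X a) - graph Z| <o \<mu>"
      using Z that small_initial[OF step_small[OF X]] by (intro below_diff_small) (auto simp: lub_on_def)
  qed (auto simp: R_def)
  moreover have "\<exists>B\<in>\<B>. \<not> |B \<inter> C| <o \<mu>"
    if C: "C \<subseteq> ?D" "|C| =o \<mu>" and CX: "\<And>a. a \<in> Field l \<Longrightarrow> |C \<inter> graph (X a)| <o \<mu>" for C
  proof -
    have CZ: "|C \<inter> graph Z| <o \<mu>"
    proof (rule ccontr)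
      assume "\<not> ?thesis"
      moreover have "|C \<inter> graph Z| \<le>o \<mu>" by (rule card_of_subset_ordLeq[OF _ D]) (use C in blast)
      ultimately have "|C \<inter> graph Z| =o \<mu>" using card_of_ordLess_or_ordIso by blast
      then obtain a where "a \<in> Field l" "\<not> |C \<inter> graph Z \<inter> graph (X a)| <o \<mu>"
        using lub_meets[OF ofilter_Field False X Z] by blast
      moreover have "|C \<inter> graph Z \<inter> graph (X a)| <o \<mu>"
        by (rule card_of_subset_ordLess[OF _ CX[OF \<open>a \<in> Field l\<close>]]) blast
      ultimately show False by blast
    qed
    have RC: "\<not> |R \<inter> C| <o \<mu>"
    proof
      assume "|R \<inter> C| <o \<mu>"
      then have "|R \<inter> C \<union> C \<inter> graph Z| <o \<mu>" using CZ mu card_of_Un_ordLess by blast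
      then have "|C| <o \<mu>" by (rule card_of_subset_ordLess[rotated]) (use C in \<open>auto simp: R_def\<close>)
      with C(2) show False using card_of_ordIso_not_ordLess by blast
    qed
    moreover have "|R| \<le>o \<mu>" by (rule card_of_subset_ordLeq[OF _ D]) (auto simp: R_def)
    ultimately have "|R| =o \<mu>"
      using card_of_ordLess_or_ordIso card_of_subset_ordLess[OF Int_lower1] by blast
    with RC show ?thesis by (auto simp: \<B>_def)
  qed
  ultimately have "block \<mu> ?D ((\<lambda>a. graph (X a)) ` Field l) \<B>"
    unfolding block_def by (auto simp: \<B>_def R_def)
  moreover have "|\<B>| \<le>o |\<A>|"
  proof -
    have "Cinfinite |\<A>|" using cinfinite_mono[OF mad(2)] k card_of_Card_order by blast
    then have "|insert R {}| \<le>o |\<A>|" by (intro card_of_insert_ordLeq card_of_empty)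
    then show ?thesis by (rule card_of_subset_ordLeq[rotated]) (auto simp: \<B>_def)
  qed
  ultimately show ?thesis by blast
qed

text \<open>At the successor, growth by \<open>m j\<close> happens at some coordinate for every
  \<open>j\<close>, and the \<open>m j\<close> are cofinal in \<open>\<mu>\<close>.\<close>

lemma succ_diff_large:
  assumes X: "\<And>d. d \<in> Field l \<Longrightarrow> step X d (X d)" and d: "d \<in> Field l"
    and e: "e \<in> Field l" "underS l e = under l d"
  shows "|graph (X e) - graph (X d)| =o \<mu>"
proof -
  have "|graph (X e) - graph (X d)| \<le>o \<mu>"
    by (rule card_of_subset_ordLeq[OF _ card_graph_le[OF small_initial[OF step_small[OF X[OF e(1)]]]]]) blast
  moreover have "\<not> |graph (X e) - graph (X d)| <o \<mu>"
  proof
    assume "|graph (X e) - graph (X d)| <o \<mu>"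
    then obtain j where j: "j \<in> Field k" "|graph (X e) - graph (X d)| <o m j" using m_cofinal' by blast
    have "d \<in> underS l e" using e(2) Well_order_refl[OF wl d] by (simp add: under_def)
    then have "\<forall>\<^sub>F i in tail k. X d i \<subseteq> X e i \<and> m j \<le>o |X e i - X d i|"
      using X[OF e(1)] reached_succ[OF e(2) d] j(1) by (simp add: step_def)
    then obtain i where i: "i \<in> Field k" "m j \<le>o |X e i - X d i|" using ev_ex by blast
    have "|X e i - X d i| \<le>o |graph (X e) - graph (X d)|"
      by (rule card_of_ordLeqI[of "Pair i"]) (use i in \<open>auto simp: inj_on_def\<close>)
    with i(2) j(2) show False using ordLeq_transitive not_ordLess_ordLeq by blast
  qed
  ultimately show ?thesis using card_of_ordLess_or_ordIso by blast
qed

text \<open>Of two blocks one sits inside a region from which the members of the other are almost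
  disjoint; a large \<open>C\<close> is caught by the block of the first region that it meets in
  \<open>\<mu>\<close> points. There are at most \<open>l\<close> blocks of size at most
  \<open>l\<close>, and each successor stage contributes at least one member.\<close>

theorem mad_of_length:
  assumes mad: "mad \<mu> \<A>" "k \<le>o |\<A>|" "|\<A>| \<le>o l"
  shows "\<exists>\<F> :: ('i \<times> 'a) set set. mad \<mu> \<F> \<and> |\<F>| =o l"
proof -
  obtain X where X: "\<And>d. d \<in> Field l \<Longrightarrow> step X d (X d)" using chain_exists by blast
  let ?D = "\<lambda>i. Field (m i)"
  \<comment> \<open>\<open>None\<close> stands for the whole grid, which comes after all stages
    \<open>Some d\<close>.\<close>
  define I where "I = insert None (Some ` Field l)"
  define V where "V t = (case t of None \<Rightarrow> ?D | Some d \<Rightarrow> X d)" for t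
  define S where "S t = (case t of None \<Rightarrow> Field l | Some d \<Rightarrow> underS l d)" for t
  have "\<exists>\<B>. |\<B>| \<le>o |\<A>| \<and> block \<mu> (graph (V t)) ((\<lambda>a. graph (X a)) ` S t) \<B>" if "t \<in> I" for t
  proof (cases t)
    case None
    then show ?thesis using block_top[OF mad(1,2) X] by (simp add: V_def S_def)
  next
    case (Some d)
    then show ?thesis using block_at[OF mad(1,2) _ X] that by (auto simp: V_def S_def I_def)
  qed
  then obtain \<B> where \<B>: "\<And>t. t \<in> I \<Longrightarrow> |\<B> t| \<le>o |\<A>|"
    "\<And>t. t \<in> I \<Longrightarrow> block \<mu> (graph (V t)) ((\<lambda>a. graph (X a)) ` S t) (\<B> t)" by metis
  define \<F> where "\<F> = (\<Union>t\<in>I. \<B> t)"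
  have iniV: "initial k m (V t)" if "t \<in> I" for t
    using that initial_Field small_initial[OF step_small[OF X]] by (auto simp: V_def I_def)
  have VD: "graph (V t) \<subseteq> graph ?D" if "t \<in> I" for t
    using iniV[OF that] by (auto simp: initial_def ofilter_def)
  have card\<F>: "|B| =o \<mu>" if "B \<in> \<F>" for B using that blockD(2)[OF \<B>(2)] by (auto simp: \<F>_def)
  have \<F>D: "B \<subseteq> graph ?D" if "B \<in> \<F>" for B
    using that blockD(1)[OF \<B>(2)] VD unfolding \<F>_def by fast
  have sep1: "|B \<inter> B'| <o \<mu>" if B: "t \<in> I" "B \<in> \<B> t" "d \<in> S t" "Some d \<in> I" "B' \<in> \<B> (Some d)" for t d B B'
  proof -
    have "B' \<subseteq> graph (X d)" using blockD(1)[OF \<B>(2)[OF B(4)] B(5)] by (simp add: V_def)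
    moreover have "|B \<inter> graph (X d)| <o \<mu>" using blockD(4)[OF \<B>(2)[OF B(1)] B(2)] B(3) by blast
    ultimately show ?thesis using card_of_subset_ordLess[of "B \<inter> B'" "B \<inter> graph (X d)"] by blast
  qed
  have sep: "|B \<inter> B'| <o \<mu>" if B: "t \<in> I" "t' \<in> I" "t \<noteq> t'" "B \<in> \<B> t" "B' \<in> \<B> t'" for t t' B B'
  proof -
    have "(\<exists>d\<in>S t. t' = Some d) \<or> (\<exists>d\<in>S t'. t = Some d)"
    proof (cases t)
      case None
      then show ?thesis using B by (auto simp: S_def I_def)
    next
      case (Some d)
      show ?thesis
      proof (cases t')
        case None
        then show ?thesis using B by (auto simp: S_def I_def)
      next
        case (Some d')
        then show ?thesis using B \<open>t = Some d\<close> Well_order_linear[OF wl, of d d']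
          by (auto simp: S_def I_def in_underS_iff)
      qed
    qed
    then show ?thesis
    proof
      assume "\<exists>d\<in>S t. t' = Some d"
      then show ?thesis using sep1 B by blast
    next
      assume "\<exists>d\<in>S t'. t = Some d"
      then have "|B' \<inter> B| <o \<mu>" using sep1 B by blast
      then show ?thesis by (simp add: Int_commute)
    qed
  qed
  define sc where "sc d = (SOME e. e \<in> Field l \<and> underS l e = under l d)" for d
  have sc: "sc d \<in> Field l \<and> underS l (sc d) = under l d" if "d \<in> Field l" for d
  proof -
    have "\<exists>e. e \<in> Field l \<and> underS l e = under l d" using Cinfinite_succ[OF l that] by blast
    then show ?thesis unfolding sc_def by (rule someI_ex)
  qed
  \<comment> \<open>The difference of consecutive regions is large and almost disjoint from all
    earlier regions, so the block at the successor must contain something to catch it.\<close>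
  have ne: "\<exists>B. B \<in> \<B> (Some (sc d))" if d: "d \<in> Field l" for d
  proof -
    let ?C = "graph (X (sc d)) - graph (X d)"
    have t: "Some (sc d) \<in> I" using sc[OF d] by (simp add: I_def)
    have "|?C \<inter> graph (X a)| <o \<mu>" if "a \<in> underS l (sc d)" for a
    proof (rule card_of_subset_ordLess)
      have "(a, d) \<in> l" using that sc[OF d] by (auto simp: under_def)
      then show "|graph (X a) - graph (X d)| <o \<mu>"
        using chain_below[of "Field l" X, OF X d] in_underS_Field[OF that]
          small_initial[OF step_small[OF X]] by (intro below_diff_small) simp_all
    qed blast
    then have "\<exists>B\<in>\<B> (Some (sc d)). \<not> |B \<inter> ?C| <o \<mu>"
      using succ_diff_large[OF X d] sc[OF d]
      by (intro blockD(5)[OF \<B>(2)[OF t]]) (auto simp: V_def S_def)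
    then show ?thesis by blast
  qed
  define b where "b d = (SOME B. B \<in> \<B> (Some (sc d)))" for d
  have b: "b d \<in> \<B> (Some (sc d))" if "d \<in> Field l" for d
    unfolding b_def by (rule someI_ex[OF ne[OF that]])
  have "inj_on b (Field l)"
  proof (rule inj_onI, rule ccontr)
    fix d d' assume d: "d \<in> Field l" "d' \<in> Field l" "b d = b d'" "d \<noteq> d'"
    have "sc d \<noteq> sc d'"
    proof
      assume "sc d = sc d'"
      then have "under l d = under l d'" using sc d by metis
      then show False using Well_order_refl[OF wl] d Well_order_antisym[OF wl, of d d'] by (auto simp: under_def)
    qed
    then have "|b d \<inter> b d'| <o \<mu>"
      using sc[OF d(1)] sc[OF d(2)] b[OF d(1)] b[OF d(2)]
      by (intro sep[of "Some (sc d)" "Some (sc d')"]) (simp_all add: I_def)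
    moreover have "|b d| =o \<mu>" using b[OF d(1)] sc[OF d(1)] by (intro card\<F>) (auto simp: \<F>_def I_def)
    ultimately show False using d(3) card_of_ordIso_not_ordLess by auto
  qed
  moreover have "b ` Field l \<subseteq> \<F>" using b sc by (auto simp: \<F>_def I_def)
  ultimately have "|Field l| \<le>o |\<F>|" using card_of_ordLeq by blast
  then have lower: "l \<le>o |\<F>|" using ordLeq_card_of_Field l ordLeq_transitive by blast
  have "|I| \<le>o l" unfolding I_def
    using l card_of_Field_ordLeq by (intro card_of_insert_ordLeq card_of_image_ordLeq) auto
  moreover have "\<forall>t\<in>I. |\<B> t| \<le>o l" using \<B>(1) mad(3) ordLeq_transitive by blast
  ultimately have "|\<F>| \<le>o l" unfolding \<F>_def using l by (intro UNION_Cinfinite_bound)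
  with lower have cardl: "|\<F>| =o l" by (simp add: ordIso_iff_ordLeq)
  have "Field l \<noteq> {}" using l by (auto simp: cinfinite_def)
  then obtain d0 where d0: "d0 \<in> Field l" by blast
  have "mad \<mu> \<F>"
  proof (rule madI)
    have "|\<Union>\<F>| \<le>o \<mu>"
      by (rule card_of_subset_ordLeq[OF _ card_graph_le[OF initial_Field]]) (use \<F>D in blast)
    moreover have "\<not> |\<Union>\<F>| <o \<mu>"
    proof
      have b0: "b d0 \<in> \<F>" using b[OF d0] sc[OF d0] by (auto simp: \<F>_def I_def)
      assume "|\<Union>\<F>| <o \<mu>"
      then have "|b d0| <o \<mu>" using card_of_subset_ordLess[of "b d0" "\<Union>\<F>"] b0 by blast
      then show False using card\<F>[OF b0] card_of_ordIso_not_ordLess by blast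
    qed
    ultimately show "|\<Union>\<F>| =o \<mu>" using card_of_ordLess_or_ordIso by blast
    show "|A \<inter> B| <o \<mu>" if AB: "A \<in> \<F>" "B \<in> \<F>" "A \<noteq> B" for A B
    proof -
      obtain t t' where t: "t \<in> I" "A \<in> \<B> t" "t' \<in> I" "B \<in> \<B> t'" using AB by (auto simp: \<F>_def)
      show ?thesis
      proof (cases "t = t'")
        case True
        then show ?thesis using blockD(3)[OF \<B>(2)] t AB by blast
      next
        case False
        then show ?thesis using sep t by blast
      qed
    qed
    show "\<exists>A\<in>\<F>. \<not> |A \<inter> C| <o \<mu>" if C: "C \<subseteq> \<Union>\<F>" "|C| =o \<mu>" for C
    proof -
      have CD: "C \<subseteq> graph ?D" using C(1) \<F>D by blast
      obtain t where t: "t \<in> I" "\<not> |C \<inter> graph (V t)| <o \<mu>" "\<And>a. a \<in> S t \<Longrightarrow> |C \<inter> graph (X a)| <o \<mu>"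
      proof (cases "\<exists>d\<in>Field l. \<not> |C \<inter> graph (X d)| <o \<mu>")
        case True
        let ?M = "{d \<in> Field l. \<not> |C \<inter> graph (X d)| <o \<mu>}"
        have "?M \<subseteq> Field l" "?M \<noteq> {}" using True by auto
        then obtain d where d: "d \<in> ?M" "\<And>e. e \<in> ?M \<Longrightarrow> (d, e) \<in> l" by (rule Well_order_min[OF wl]) blast
        have "|C \<inter> graph (X a)| <o \<mu>" if a: "a \<in> underS l d" for a
          using d(2)[of a] a in_underS_Field[OF a] Well_order_antisym[OF wl, of a d]
          by (auto simp: in_underS_iff)
        then show ?thesis using that[of "Some d"] d(1) by (simp add: I_def V_def S_def)
      next
        case False
        have "\<not> |C \<inter> graph ?D| <o \<mu>" using CD C(2) card_of_ordIso_not_ordLess by (simp add: Int_absorb2)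
        then show ?thesis using that[of None] False by (simp add: I_def V_def S_def)
      qed
      have "|C \<inter> graph (V t)| \<le>o \<mu>"
        by (rule card_of_subset_ordLeq[OF _ ordIso_imp_ordLeq[OF C(2)]]) blast
      then have "|C \<inter> graph (V t)| =o \<mu>" using t(2) card_of_ordLess_or_ordIso by blast
      moreover have "|C \<inter> graph (V t) \<inter> Y| <o \<mu>" if Y: "Y \<in> (\<lambda>a. graph (X a)) ` S t" for Y
      proof -
        obtain a where a: "a \<in> S t" "Y = graph (X a)" using Y by blast
        show ?thesis unfolding a(2) by (rule card_of_subset_ordLess[OF _ t(3)[OF a(1)]]) blast
      qed
      ultimately have "\<exists>B\<in>\<B> t. \<not> |B \<inter> (C \<inter> graph (V t))| <o \<mu>"
        by (intro blockD(5)[OF \<B>(2)[OF t(1)]]) auto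
      then obtain B where B: "B \<in> \<B> t" "\<not> |B \<inter> (C \<inter> graph (V t))| <o \<mu>" by blast
      have "B \<inter> (C \<inter> graph (V t)) \<subseteq> B \<inter> C" by blast
      then have "\<not> |B \<inter> C| <o \<mu>" using B(2) card_of_subset_ordLess by blast
      with B(1) t(1) show ?thesis by (auto simp: \<F>_def)
    qed
  qed (rule card\<F>)
  with cardl show ?thesis by blast
qed

end

subsection \<open>Minima, suprema and the existence of mad families\<close>

lemma cmin_spec:
  assumes "R \<noteq> {}" "\<And>r. r \<in> R \<Longrightarrow> Card_order r"
  shows "cmin R \<in> R" "r \<in> R \<Longrightarrow> cmin R \<le>o r"
proof -
  have "\<exists>r. r \<in> R \<and> (\<forall>s\<in>R. r \<le>o s)"
    using exists_minim_Card_order[of R] assms by blast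
  then have "cmin R \<in> R \<and> (\<forall>s\<in>R. cmin R \<le>o s)" unfolding cmin_def by (rule someI_ex)
  then show "cmin R \<in> R" "r \<in> R \<Longrightarrow> cmin R \<le>o r" by auto
qed

lemma
  fixes R :: "'a rel set" and s :: "'a rel"
  assumes "\<And>r. r \<in> R \<Longrightarrow> Card_order r"
  shows csup_upper: "r \<in> R \<Longrightarrow> r \<le>o csup R"
    and csup_least: "Card_order s \<Longrightarrow> (\<And>r. r \<in> R \<Longrightarrow> r \<le>o s) \<Longrightarrow> csup R \<le>o s"
proof -
  define U where "U = {s :: 'a rel. Card_order s \<and> (\<forall>r\<in>R. r \<le>o s)}"
  have "r \<le>o |UNIV :: 'a set|" if "r \<in> R" for r
    by (rule ordLeq_transitive[OF ordLeq_card_of_Field[OF assms[OF that]] card_of_mono1]) simp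
  then have "|UNIV :: 'a set| \<in> U" by (simp add: U_def card_of_Card_order)
  then have ne: "U \<noteq> {}" by blast
  have CU: "\<And>s. s \<in> U \<Longrightarrow> Card_order s" by (simp add: U_def)
  have c1: "cmin U \<in> U" by (rule cmin_spec(1)[OF ne CU])
  have c2: "cmin U \<le>o s" if "s \<in> U" for s by (rule cmin_spec(2)[OF ne CU that])
  have sup: "csup R = cmin U" by (simp add: csup_def U_def)
  show "r \<in> R \<Longrightarrow> r \<le>o csup R" using c1 by (simp add: sup U_def)
  show "Card_order s \<Longrightarrow> (\<And>r. r \<in> R \<Longrightarrow> r \<le>o s) \<Longrightarrow> csup R \<le>o s"
    using c2[of s] by (simp add: sup U_def)
qed

text \<open>A partition of \<open>Field \<mu>\<close> into \<open>\<mu>\<close> pieces of size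
  \<open>\<mu>\<close> is extended to a maximal family by Zorn's lemma. Starting from it fixes the
  union and guarantees enough members for nontriviality, so \<open>MAD \<mu>\<close> is nonempty and
  its minimum meaningful.\<close>

lemma mad_exists:
  fixes \<mu> :: "'a rel"
  assumes mu: "Cinfinite \<mu>"
  shows "\<exists>\<A> :: 'a set set. mad \<mu> \<A> \<and> \<mu> \<le>o |\<A>|"
proof -
  let ?F = "Field \<mu>"
  have inf: "infinite ?F" using mu by (simp add: cinfinite_def)
  have F: "|?F| =o \<mu>" using mu card_of_Field_ordIso by blast
  have "|?F \<times> ?F| =o |?F|" using card_of_Times_same_infinite[OF inf] .
  then obtain h where h: "bij_betw h (?F \<times> ?F) ?F" using card_of_ordIso by blast
  define P where "P a = h ` ({a} \<times> ?F)" for a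
  have cP: "|P a| =o \<mu>" if a: "a \<in> ?F" for a
  proof -
    have "inj_on (\<lambda>b. h (a, b)) ?F" using h a by (auto simp: bij_betw_def inj_on_def)
    then have "bij_betw (\<lambda>b. h (a, b)) ?F (P a)" by (auto simp: bij_betw_def P_def)
    then show ?thesis using card_of_ordIsoI F ordIso_symmetric ordIso_transitive by blast
  qed
  have PF: "P a \<subseteq> ?F" if "a \<in> ?F" for a using h that by (auto simp: P_def bij_betw_def)
  have dis: "P a \<inter> P b = {}" if "a \<in> ?F" "b \<in> ?F" "a \<noteq> b" for a b
    using h that by (auto simp: P_def bij_betw_def inj_on_def)
  have empty: "|{} :: 'a set| <o \<mu>"
    by (rule finite_ordLess_infinite[OF card_of_Well_order Cinfinite_Well_order[OF mu]])
      (use inf in \<open>simp_all add: Field_card_of\<close>)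
  define \<X> where "\<X> = {\<A>. P ` ?F \<subseteq> \<A> \<and> \<A> \<subseteq> Pow ?F \<and> (\<forall>A\<in>\<A>. |A| =o \<mu>) \<and>
     (\<forall>A\<in>\<A>. \<forall>B\<in>\<A>. A \<noteq> B \<longrightarrow> |A \<inter> B| <o \<mu>)}"
  have "\<exists>M\<in>\<X>. \<forall>X\<in>\<X>. M \<subseteq> X \<longrightarrow> X = M"
  proof (rule subset_Zorn_nonempty)
    have "|P a \<inter> P b| <o \<mu>" if "a \<in> ?F" "b \<in> ?F" "P a \<noteq> P b" for a b
      using dis[of a b] that empty by (cases "a = b") auto
    moreover have "P ` ?F \<subseteq> Pow ?F" using PF by (intro image_subsetI PowI)
    ultimately have "P ` ?F \<in> \<X>" using cP by (simp add: \<X>_def)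
    then show "\<X> \<noteq> {}" by blast
    fix \<C> assume C: "\<C> \<noteq> {}" "subset.chain \<X> \<C>"
    then have CX: "\<And>\<A>. \<A> \<in> \<C> \<Longrightarrow> \<A> \<in> \<X>" by (auto simp: subset.chain_def)
    have "|A \<inter> B| <o \<mu>" if AB: "A \<in> \<Union>\<C>" "B \<in> \<Union>\<C>" "A \<noteq> B" for A B
    proof -
      obtain \<A> \<B> where 1: "\<A> \<in> \<C>" "A \<in> \<A>" "\<B> \<in> \<C>" "B \<in> \<B>" using AB by blast
      then have "\<A> \<subseteq> \<B> \<or> \<B> \<subseteq> \<A>" using C(2) by (auto simp: subset_chain_def)
      then show ?thesis
      proof
        assume "\<A> \<subseteq> \<B>"
        then have "A \<in> \<B>" using 1 by blast
        then show ?thesis using CX[OF 1(3)] 1(4) AB(3) by (simp add: \<X>_def)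
      next
        assume "\<B> \<subseteq> \<A>"
        then have "B \<in> \<A>" using 1 by blast
        then show ?thesis using CX[OF 1(1)] 1(2) AB(3) by (simp add: \<X>_def)
      qed
    qed
    moreover have "P ` ?F \<subseteq> \<Union>\<C>" "\<Union>\<C> \<subseteq> Pow ?F" "\<forall>A\<in>\<Union>\<C>. |A| =o \<mu>"
      using C(1) CX unfolding \<X>_def by blast+
    ultimately show "\<Union>\<C> \<in> \<X>" by (simp add: \<X>_def)
  qed
  then obtain \<A> where \<A>: "\<A> \<in> \<X>" "\<And>X. X \<in> \<X> \<Longrightarrow> \<A> \<subseteq> X \<Longrightarrow> X = \<A>" by blast
  have U: "\<Union>\<A> = ?F"
  proof
    show "\<Union>\<A> \<subseteq> ?F" using \<A>(1) by (auto simp: \<X>_def)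
    have "?F = h ` (?F \<times> ?F)" using h by (simp add: bij_betw_def)
    also have "\<dots> \<subseteq> (\<Union>a\<in>?F. P a)" by (auto simp: P_def)
    also have "\<dots> \<subseteq> \<Union>\<A>" using \<A>(1) by (auto simp: \<X>_def)
    finally show "?F \<subseteq> \<Union>\<A>" .
  qed
  have "mad \<mu> \<A>"
  proof (rule madI)
    show "|\<Union>\<A>| =o \<mu>" using U F by simp
    show "|A| =o \<mu>" if "A \<in> \<A>" for A using that \<A>(1) by (simp add: \<X>_def)
    show "|A \<inter> B| <o \<mu>" if "A \<in> \<A>" "B \<in> \<A>" "A \<noteq> B" for A B using that \<A>(1) by (simp add: \<X>_def)
    show "\<exists>A\<in>\<A>. \<not> |A \<inter> C| <o \<mu>" if C: "C \<subseteq> \<Union>\<A>" "|C| =o \<mu>" for C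
    proof (rule ccontr)
      assume neg: "\<not> ?thesis"
      then have "insert C \<A> \<in> \<X>" using \<A>(1) C U by (auto simp: \<X>_def Int_commute)
      then have "insert C \<A> = \<A>" using \<A>(2) by blast
      then have "C \<in> \<A>" by blast
      with neg have "|C| <o \<mu>" by auto
      with C(2) show False using card_of_ordIso_not_ordLess by blast
    qed
  qed
  moreover have "\<mu> \<le>o |\<A>|"
  proof -
    have "inj_on P ?F"
    proof (rule inj_onI, rule ccontr)
      fix a b assume ab: "a \<in> ?F" "b \<in> ?F" "P a = P b" "a \<noteq> b"
      then have "P a = {}" using dis by auto
      with cP[OF ab(1)] empty show False using card_of_ordIso_not_ordLess by auto
    qed
    moreover have "P ` ?F \<subseteq> \<A>" using \<A>(1) by (simp add: \<X>_def)
    ultimately have "|?F| \<le>o |\<A>|" using card_of_ordLeq by blast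
    then show ?thesis using F ordIso_symmetric ordIso_ordLeq_trans by blast
  qed
  ultimately show ?thesis by blast
qed

text \<open>The family built along the chain lives on pairs, whereas \<open>MAD\<close> collects
  families over the type of \<open>\<mu>\<close>.\<close>

lemma mad_transfer:
  fixes \<mu> :: "'a rel" and \<F> :: "'c set set"
  assumes mad: "mad \<mu> \<F>" and ne: "\<F> \<noteq> {}" and mu: "Card_order \<mu>"
  shows "\<exists>\<G> :: 'a set set. mad \<mu> \<G> \<and> |\<G>| =o |\<F>|"
proof -
  have U: "|\<Union>\<F>| =o \<mu>" by (rule mad_card_Union[OF mad ne])
  then have "|\<Union>\<F>| =o |Field \<mu>|"
    using card_of_Field_ordIso[OF mu] ordIso_symmetric ordIso_transitive by blast
  then obtain h where h: "bij_betw h (\<Union>\<F>) (Field \<mu>)" using card_of_ordIso by blast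
  then have inj: "inj_on h (\<Union>\<F>)" by (simp add: bij_betw_def)
  have him: "|h ` W| =o |W|" if "W \<subseteq> \<Union>\<F>" for W
    using card_of_inj_image[OF inj_on_subset[OF inj that]] .
  let ?G = "(`) h ` \<F>"
  have UG: "\<Union>?G = h ` \<Union>\<F>" by blast
  have "mad \<mu> ?G"
  proof (rule madI)
    show "|\<Union>?G| =o \<mu>" unfolding UG using him[of "\<Union>\<F>"] U ordIso_transitive by blast
    show "|A| =o \<mu>" if A: "A \<in> ?G" for A
    proof -
      obtain A0 where "A0 \<in> \<F>" "A = h ` A0" using A by blast
      then show ?thesis using him[of A0] mad_card[OF mad] ordIso_transitive by blast
    qed
    show "|A \<inter> B| <o \<mu>" if AB: "A \<in> ?G" "B \<in> ?G" "A \<noteq> B" for A B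
    proof -
      obtain A0 B0 where 0: "A0 \<in> \<F>" "A = h ` A0" "B0 \<in> \<F>" "B = h ` B0" using AB by blast
      have "A \<inter> B = h ` (A0 \<inter> B0)" unfolding 0 using inj_on_image_Int[OF inj, of A0 B0] 0 by blast
      moreover have "|A0 \<inter> B0| <o \<mu>" using mad_ad[OF mad] 0 AB(3) by blast
      ultimately show ?thesis using card_of_image_ordLess by metis
    qed
    show "\<exists>A\<in>?G. \<not> |A \<inter> C| <o \<mu>" if C: "C \<subseteq> \<Union>?G" "|C| =o \<mu>" for C
    proof -
      define C0 where "C0 = {x \<in> \<Union>\<F>. h x \<in> C}"
      have C0: "h ` C0 = C" using C(1) unfolding UG C0_def by blast
      have "C0 \<subseteq> \<Union>\<F>" by (auto simp: C0_def)
      from him[OF this] have "|C0| =o |C|" unfolding C0 by (rule ordIso_symmetric)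
      from ordIso_transitive[OF this C(2)] have "|C0| =o \<mu>" .
      then obtain A where A: "A \<in> \<F>" "|A \<inter> C0| =o \<mu>" using mad_meets[OF mad _ _ ne, of C0] by (auto simp: C0_def)
      have "|h ` (A \<inter> C0)| =o |A \<inter> C0|" using A(1) by (intro him) blast
      from ordIso_transitive[OF this A(2)] have "|h ` (A \<inter> C0)| =o \<mu>" .
      moreover have "h ` (A \<inter> C0) \<subseteq> h ` A \<inter> C" using C0 by blast
      ultimately have "\<not> |h ` A \<inter> C| <o \<mu>" using card_of_subset_ordLess card_of_ordIso_not_ordLess by blast
      with A(1) show ?thesis by blast
    qed
  qed
  moreover have "|?G| =o |\<F>|"
  proof -
    have "inj_on ((`) h) \<F>" using inj inj_on_image by blast
    then show ?thesis by (rule card_of_inj_image)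
  qed
  ultimately show ?thesis by blast
qed

subsection \<open>Thin unbounded sets and closed points\<close>

text \<open>
  Along an enumeration of \<open>x\<close> of length \<open>k\<^sup>+\<close>, keep the elements that exceed all earlier ones.
\<close>

lemma unbounded_in_thin:
  assumes r: "Well_order r" "ofilter r S" and k: "Cinfinite k"
    and x: "unbounded_in r S x" "|x| \<le>o cardSuc k"
  shows "\<exists>y. unbounded_in r S y \<and> (\<forall>b\<in>S. |y \<inter> underS r b| \<le>o k)"
proof -
  let ?k = "cardSuc k"
  have ck: "Cinfinite ?k" and wk: "Well_order ?k"
    using Cinfinite_cardSuc[OF k] Cinfinite_Well_order by auto
  have "|x| \<le>o |Field ?k|" using x(2) ordLeq_card_of_Field ck ordLeq_transitive by blast
  then obtain g where g: "inj_on g x" "g ` x \<subseteq> Field ?k" using card_of_ordLeq by metis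
  define y where "y = {a \<in> x. \<forall>c\<in>x. g c \<in> underS ?k (g a) \<longrightarrow> c \<in> underS r a}"
  have xS: "x \<subseteq> S" using x(1) by (simp add: unbounded_in_def)
  have SF: "S \<subseteq> Field r" using r(2) by (rule ofilter_subset_Field)
  have unb: "unbounded_in r S y" unfolding unbounded_in_def
  proof (intro conjI ballI)
    show "y \<subseteq> S" using xS by (auto simp: y_def)
    fix a assume a: "a \<in> S"
    let ?M = "g ` {c \<in> x. (a, c) \<in> r}"
    have "?M \<subseteq> Field ?k" "?M \<noteq> {}" using g(2) x(1) a by (auto simp: unbounded_in_def)
    then obtain u where u: "u \<in> ?M" "\<And>v. v \<in> ?M \<Longrightarrow> (u, v) \<in> ?k"
      by (rule Well_order_min[OF wk]) blast
    then obtain c where c: "c \<in> x" "(a, c) \<in> r" "u = g c" by blast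
    have "d \<in> underS r c" if d: "d \<in> x" "g d \<in> underS ?k (g c)" for d
    proof -
      have "(a, d) \<notin> r"
      proof
        assume "(a, d) \<in> r"
        then have "(g c, g d) \<in> ?k" using u(2) d(1) c(3) by blast
        then show False using d(2) Well_order_antisym[OF wk] by (auto simp: in_underS_iff)
      qed
      then have "d \<in> underS r a" using Well_order_linear[OF r(1)] a d(1) xS SF by blast
      then show ?thesis using underS_trans2[OF r(1) _ c(2)] by blast
    qed
    then have "c \<in> y" using c(1) by (simp add: y_def)
    with c(2) show "\<exists>b\<in>y. (a, b) \<in> r" by blast
  qed
  have "|y \<inter> underS r b| \<le>o k" if b: "b \<in> S" for b
  proof -
    obtain c where c: "c \<in> y" "(b, c) \<in> r" using unb b by (auto simp: unbounded_in_def)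
    have gF: "g a \<in> Field ?k" if "a \<in> y" for a using g(2) that by (auto simp: y_def)
    \<comment> \<open>Members of \<open>y\<close> below \<open>c\<close> are listed before
      \<open>c\<close>, since a later one would have to exceed \<open>c\<close>. So they inject into
      a proper segment of \<open>cardSuc k\<close>.\<close>
    have "g ` (y \<inter> underS r b) \<subseteq> underS ?k (g c)"
    proof (rule image_subsetI)
      fix a assume a: "a \<in> y \<inter> underS r b"
      then have ac: "a \<in> underS r c" using underS_trans2[OF r(1) _ c(2)] by blast
      have "\<not> g c \<in> underS ?k (g a)"
        using a c(1) ac Well_order_antisym[OF r(1), of a c] by (auto simp: y_def in_underS_iff)
      then have "(g a, g c) \<in> ?k" using Well_order_linear[OF wk] gF a c(1) by blast
      moreover have "g a \<noteq> g c" using g(1) a c(1) ac by (auto simp: inj_on_def y_def in_underS_iff)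
      ultimately show "g a \<in> underS ?k (g c)" by (simp add: in_underS_iff)
    qed
    moreover have "inj_on g (y \<inter> underS r b)" by (rule inj_on_subset[OF g(1)]) (auto simp: y_def)
    ultimately have "|y \<inter> underS r b| \<le>o |underS ?k (g c)|" using card_of_ordLeq by blast
    moreover have "|underS ?k (g c)| <o ?k" using card_of_underS[of ?k "g c"] ck gF[OF c(1)] by blast
    then have "|underS ?k (g c)| \<le>o k" using cardSuc_ordLeq_ordLess[of k] k card_of_Card_order by blast
    ultimately show ?thesis using ordLeq_transitive by blast
  qed
  with unb show ?thesis by blast
qed

text \<open>Iterate a map \<open>H\<close> jumping beyond both its argument and the values of
  \<open>G\<close> up to it. As \<open>\<nu>\<close> is regular and uncountable, the iterates
  \<open>f i\<close> have a least strict bound \<open>z\<close>; any \<open>v\<close> below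
  \<open>z\<close> is at most some \<open>f i\<close>, so \<open>G v\<close> is below the next
  iterate.\<close>

lemma regular_closed_point:
  assumes \<nu>: "regular_card \<nu>" and unc: "natLeq <o \<nu>" and z0: "z0 \<in> Field \<nu>"
    and G: "\<And>w. w \<in> Field \<nu> \<Longrightarrow> G w \<in> Field \<nu>"
  shows "\<exists>z\<in>Field \<nu>. z0 \<in> underS \<nu> z \<and> (\<forall>w\<in>underS \<nu> z. G w \<in> underS \<nu> z)"
proof -
  have c: "Cinfinite \<nu>" using \<nu> by (simp add: regular_card_def)
  have w: "Well_order \<nu>" using c by (rule Cinfinite_Well_order)
  have "\<exists>b\<in>Field \<nu>. a \<in> underS \<nu> b \<and> G ` under \<nu> a \<subseteq> underS \<nu> b" if a: "a \<in> Field \<nu>" for a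
  proof -
    obtain a' where a': "a' \<in> Field \<nu>" "underS \<nu> a' = under \<nu> a" using Cinfinite_succ[OF c a] by blast
    have "|under \<nu> a| <o \<nu>" using card_of_underS[of \<nu> a'] c a' by simp
    then have "|G ` under \<nu> a| <o \<nu>" by (rule card_of_image_ordLess)
    moreover have "G ` under \<nu> a \<subseteq> Field \<nu>" using G under_Field[of \<nu> a] by blast
    ultimately obtain b where b: "b \<in> Field \<nu>" "G ` under \<nu> a \<subseteq> underS \<nu> b"
      using regular_bounded[OF \<nu>] by blast
    have aa': "a \<in> underS \<nu> a'" using a'(2) Well_order_refl[OF w a] by (simp add: under_def)
    show ?thesis
    proof (cases "(a', b) \<in> \<nu>")
      case True
      then show ?thesis using b underS_trans2[OF w aa'] by blast
    next
      case False
      then have "(b, a') \<in> \<nu>" using Well_order_linear[OF w a'(1) b(1)] by (auto simp: in_underS_iff)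
      then show ?thesis using a'(1) aa' b(2) underS_trans2[OF w] by blast
    qed
  qed
  then obtain H where H: "\<And>a. a \<in> Field \<nu> \<Longrightarrow> H a \<in> Field \<nu> \<and> a \<in> underS \<nu> (H a) \<and>
      G ` under \<nu> a \<subseteq> underS \<nu> (H a)" by metis
  define f where "f i = (H ^^ i) z0" for i :: nat
  have f: "f i \<in> Field \<nu>" for i by (induction i) (use z0 H in \<open>auto simp: f_def\<close>)
  have fS: "f (Suc i) = H (f i)" for i by (simp add: f_def)
  have "|range f| <o \<nu>"
    using card_of_image_ordLess[OF ordIso_ordLess_trans[OF card_of_nat unc]] .
  then obtain b where b: "b \<in> Field \<nu>" "range f \<subseteq> underS \<nu> b"
    using regular_bounded[OF \<nu>, of "range f"] f by blast
  let ?B = "{b \<in> Field \<nu>. range f \<subseteq> underS \<nu> b}"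
  have "?B \<subseteq> Field \<nu>" "?B \<noteq> {}" using b by auto
  then obtain z where z: "z \<in> ?B" "\<And>b. b \<in> ?B \<Longrightarrow> (z, b) \<in> \<nu>"
    by (rule Well_order_min[OF w]) blast
  have "f 0 \<in> underS \<nu> z" using z(1) by blast
  then have "z0 \<in> underS \<nu> z" by (simp add: f_def)
  moreover have "G v \<in> underS \<nu> z" if v: "v \<in> underS \<nu> z" for v
  proof -
    have vF: "v \<in> Field \<nu>" using in_underS_Field[OF v] by blast
    have "v \<notin> ?B" using z(2) v Well_order_antisym[OF w] by (auto simp: in_underS_iff)
    then obtain i where "f i \<notin> underS \<nu> v" using vF by blast
    then have "(v, f i) \<in> \<nu>" using Well_order_linear[OF w vF f] by blast
    then have "G v \<in> underS \<nu> (f (Suc i))" unfolding fS using H[OF f[of i]] by (auto simp: under_def)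
    moreover have "f (Suc i) \<in> underS \<nu> z" using z(1) by blast
    then have "(f (Suc i), z) \<in> \<nu>" by (simp add: in_underS_iff)
    ultimately show ?thesis by (rule underS_trans2[OF w])
  qed
  ultimately show ?thesis using z(1) by blast
qed

text \<open>A proper initial segment has smaller order type, so a point can be recovered from the
  type below it.\<close>

lemma Restr_underS_inj:
  assumes r: "Well_order r" and z: "z \<in> Field r" "z' \<in> Field r"
    and iso: "Restr r (underS r z) =o Restr r (underS r z')"
  shows "z = z'"
proof -
  have *: "\<not> Restr r (underS r a) =o Restr r (underS r b)" if "a \<in> underS r b" for a b
  proof -
    have "underS r a \<subset> underS r b"
      using that underS_trans2[OF r, of _ a b] underS_notIn[of a r] by (auto simp: in_underS_iff)
    then have "Restr r (underS r a) <o Restr r (underS r b)"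
      using ofilter_subset_ordLess[OF r] ofilter_underS[OF r] by blast
    then show ?thesis using not_ordLess_ordIso by blast
  qed
  show ?thesis using *[of z z'] *[of z' z] iso ordIso_symmetric[OF iso] Well_order_linear[OF r z]
    by (auto simp: in_underS_iff)
qed

subsection \<open>Cofinality and bounding numbers\<close>

lemma finite_has_max:
  assumes r: "Well_order r" and "finite A" "A \<noteq> {}" "A \<subseteq> Field r"
  shows "\<exists>a\<in>A. \<forall>b\<in>A. (b, a) \<in> r"
  using assms(2-)
proof (induction A rule: finite_ne_induct)
  case (singleton x)
  then show ?case using Well_order_refl[OF r] by auto
next
  case (insert x A)
  then obtain a where a: "a \<in> A" "\<And>b. b \<in> A \<Longrightarrow> (b, a) \<in> r" by auto
  have xa: "x \<in> Field r" "a \<in> Field r" using insert a by auto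
  show ?case
  proof (cases "(x, a) \<in> r")
    case True
    then show ?thesis using a by auto
  next
    case False
    then have "(a, x) \<in> r" using Well_order_linear[OF r xa] by (auto simp: in_underS_iff)
    then have "\<forall>b\<in>insert x A. (b, x) \<in> r"
      using a(2) Well_order_trans[OF r] Well_order_refl[OF r xa(1)] by blast
    then show ?thesis by blast
  qed
qed

context
  fixes \<mu> :: "'a rel"
  assumes sing: "singular_card \<mu>"
begin

lemma Cinfinite_mu: "Cinfinite \<mu>"
  using sing by (simp add: singular_card_def)

lemmas w_mu = Cinfinite_Well_order[OF Cinfinite_mu]

lemma card_mu: "|Field \<mu>| =o \<mu>"
  using Cinfinite_mu card_of_Field_ordIso by blast

lemma cf_attained: "\<exists>K. K \<subseteq> Field \<mu> \<and> cofinal K \<mu> \<and> cf \<mu> = |K|"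
  and cf_least: "K \<subseteq> Field \<mu> \<Longrightarrow> cofinal K \<mu> \<Longrightarrow> cf \<mu> \<le>o |K|"
proof -
  let ?R = "{|K| | K. K \<subseteq> Field \<mu> \<and> cofinal K \<mu>}"
  have "cofinal (Field \<mu>) \<mu>"
    using infinite_Card_order_limit[of \<mu>] Cinfinite_mu by (auto simp: cofinal_def cinfinite_def)
  then have ne: "?R \<noteq> {}" by auto
  have CR: "\<And>r. r \<in> ?R \<Longrightarrow> Card_order r" using card_of_Card_order by auto
  show "\<exists>K. K \<subseteq> Field \<mu> \<and> cofinal K \<mu> \<and> cf \<mu> = |K|"
    using cmin_spec(1)[OF ne CR] by (auto simp: cf_def)
  show "K \<subseteq> Field \<mu> \<Longrightarrow> cofinal K \<mu> \<Longrightarrow> cf \<mu> \<le>o |K|"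
    unfolding cf_def by (rule cmin_spec(2)[OF ne CR]) auto
qed

lemma Cinfinite_cf: "Cinfinite (cf \<mu>)"
proof -
  obtain K where K: "K \<subseteq> Field \<mu>" "cofinal K \<mu>" "cf \<mu> = |K|" using cf_attained by blast
  have "infinite K"
  proof
    assume fin: "finite K"
    have "Field \<mu> \<noteq> {}" using Cinfinite_mu by (auto simp: cinfinite_def)
    then have "K \<noteq> {}" using K(2) by (auto simp: cofinal_def)
    then obtain a where a: "a \<in> K" "\<forall>b\<in>K. (b, a) \<in> \<mu>" using finite_has_max[OF w_mu fin _ K(1)] by blast
    then have "a \<in> Field \<mu>" using K(1) by blast
    then obtain b where "b \<in> K" "a \<noteq> b" "(a, b) \<in> \<mu>" using K(2) unfolding cofinal_def by blast
    with a show False using Well_order_antisym[OF w_mu] by blast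
  qed
  then show ?thesis using K(3) card_of_Card_order by (simp add: cinfinite_def Field_card_of)
qed

lemma cf_less: "cf \<mu> <o \<mu>"
proof -
  obtain K where K: "K \<subseteq> Field \<mu>" "cofinal K \<mu>" "\<not> |K| =o \<mu>"
    using sing by (auto simp: singular_card_def regularCard_def)
  have "|K| \<le>o \<mu>" using card_of_subset_ordLeq[OF K(1) ordIso_imp_ordLeq[OF card_mu]] .
  then have "|K| <o \<mu>" using K(3) card_of_ordLess_or_ordIso by blast
  with cf_least[OF K(1,2)] show ?thesis using ordLeq_ordLess_trans by blast
qed

text \<open>Strictness of \<open>m i <o \<mu>\<close> comes from the next term. Regularity of
  \<open>cf \<mu>\<close> is proved through \<open>\<mu>\<close>: unbounded indices \<open>H\<close>
  give points \<open>a h\<close> of \<open>Field \<mu>\<close> with order type \<open>m h\<close>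
  below them, cofinal in \<open>\<mu>\<close>, so \<open>H\<close> has at least
  \<open>cf \<mu>\<close> elements.\<close>

lemma singular_sequenceI:
  assumes m: "regular_seq (cf \<mu>) \<mu> m"
  shows "singular_sequence \<mu> (cf \<mu>) m"
proof -
  let ?k = "cf \<mu>"
  have wk: "Well_order ?k" by (rule Cinfinite_Well_order[OF Cinfinite_cf])
  have reg: "regular_card (m i)" if "i \<in> Field ?k" for i using m that by (simp add: regular_seq_def)
  have mono: "m i <o m j" if "i \<in> underS ?k j" for i j
    using m that by (auto simp: regular_seq_def in_underS_iff)
  have sup: "csup (m ` Field ?k) =o \<mu>" using m by (simp add: regular_seq_def)
  have CR: "\<And>r. r \<in> m ` Field ?k \<Longrightarrow> Card_order r" using reg by (auto simp: regular_card_def)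
  have less: "m i <o \<mu>" if i: "i \<in> Field ?k" for i
  proof -
    obtain j where j: "j \<in> Field ?k" "underS ?k j = under ?k i" using Cinfinite_succ[OF Cinfinite_cf i] by blast
    have "i \<in> underS ?k j" using j(2) Well_order_refl[OF wk i] by (simp add: under_def)
    then have "m i <o m j" by (rule mono)
    also have "m j \<le>o csup (m ` Field ?k)" by (rule csup_upper[OF CR]) (use j in auto)
    also note sup
    finally show ?thesis .
  qed
  have cofin: "\<exists>i\<in>Field ?k. |A| <o m i" if A: "|A| <o \<mu>" for A :: "'a set"
  proof (rule ccontr)
    assume neg: "\<not> ?thesis"
    have "m i \<le>o |A|" if i: "i \<in> Field ?k" for i
    proof -
      have "Well_order (m i)" using reg[OF i] by (auto simp: regular_card_def intro: Cinfinite_Well_order)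
      then show ?thesis using neg i card_of_ordLess_or_ordLeq by blast
    qed
    then have "csup (m ` Field ?k) \<le>o |A|" by (intro csup_least[OF CR card_of_Card_order]) auto
    then have "\<mu> \<le>o |A|" using sup ordIso_symmetric ordIso_ordLeq_trans by blast
    with A show False using not_ordLess_ordLeq by blast
  qed
  have bounded: "\<exists>j\<in>Field ?k. H \<subseteq> under ?k j" if H: "H \<subseteq> Field ?k" "|H| <o ?k" for H
  proof (rule ccontr)
    assume neg: "\<not> ?thesis"
    have "\<forall>h\<in>H. \<exists>a\<in>Field \<mu>. m h =o Restr \<mu> (underS \<mu> a)"
      using less H(1) ordLess_iff_ordIso_Restr[OF w_mu] ordIso_imp_ordLeq ordLeq_Well_order_simp
        ordLess_imp_ordLeq by (metis subsetD)
    then obtain a where a: "\<And>h. h \<in> H \<Longrightarrow> a h \<in> Field \<mu> \<and> m h =o Restr \<mu> (underS \<mu> (a h))" by metis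
    have "cofinal (a ` H) \<mu>" unfolding cofinal_def
    proof
      fix b assume b: "b \<in> Field \<mu>"
      have "|underS \<mu> b| <o \<mu>" using card_of_underS[OF _ b] Cinfinite_mu by blast
      then obtain i where i: "i \<in> Field ?k" "|underS \<mu> b| <o m i" using cofin by blast
      obtain h where h: "h \<in> H" "(h, i) \<notin> ?k" using neg i(1) by (auto simp: under_def)
      then have "i \<in> underS ?k h" using Well_order_linear[OF wk, of h i] H(1) i(1) by blast
      then have bh: "|underS \<mu> b| <o m h" using i(2) mono ordLess_transitive by blast
      have "(a h, b) \<notin> \<mu>"
      proof
        assume "(a h, b) \<in> \<mu>"
        then have sub: "underS \<mu> (a h) \<subseteq> underS \<mu> b" using underS_trans2[OF w_mu] by blast
        have hF: "h \<in> Field ?k" using h(1) H(1) by blast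
        have "m h =o |Field (m h)|"
          using CR[of "m h"] hF card_of_Field_ordIso ordIso_symmetric by blast
        also have "|Field (m h)| =o |Field (Restr \<mu> (underS \<mu> (a h)))|"
          by (rule card_of_cong[OF conjunct2[OF a[OF h(1)]]])
        also have "|Field (Restr \<mu> (underS \<mu> (a h)))| \<le>o |underS \<mu> b|"
          by (rule card_of_mono1[OF subset_trans[OF Field_Restr_subset sub]])
        finally show False using bh not_ordLess_ordLeq by blast
      qed
      then have "b \<in> underS \<mu> (a h)" using Well_order_linear[OF w_mu, of "a h" b] a[OF h(1)] b by blast
      then show "\<exists>c\<in>a ` H. b \<noteq> c \<and> (b, c) \<in> \<mu>" using h(1) by (auto simp: in_underS_iff)
    qed
    then have "?k \<le>o |a ` H|" using a by (intro cf_least) auto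
    then have "?k \<le>o |H|" using card_of_image ordLeq_transitive by blast
    with H(2) show False using not_ordLess_ordLeq by blast
  qed
  show ?thesis
    by (rule singular_sequence.intro[OF Cinfinite_mu Cinfinite_cf cf_less bounded reg less mono cofin])
qed

abbreviation seq_b :: "('a \<Rightarrow> 'a rel) \<Rightarrow> ('a \<Rightarrow> 'a) rel" where
  "seq_b m \<equiv> bounding_number (\<Pi>\<^sub>E i\<in>Field (cf \<mu>). Field (m i)) (le_star (cf \<mu>) m)"

context
  fixes m :: "'a \<Rightarrow> 'a rel"
  assumes m: "regular_seq (cf \<mu>) \<mu> m"
begin

interpretation S: singular_sequence \<mu> "cf \<mu>" m
  by (rule singular_sequenceI[OF m])

abbreviation prd :: "('a \<Rightarrow> 'a) set" where
  "prd \<equiv> \<Pi>\<^sub>E i\<in>Field (cf \<mu>). Field (m i)"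

lemma m_limit:
  assumes "i \<in> Field (cf \<mu>)" "a \<in> Field (m i)" shows "\<exists>b\<in>Field (m i). a \<in> underS (m i) b"
  using infinite_Card_order_limit[of "m i" a] S.m_Cinfinite[OF assms(1)] assms(2)
  by (auto simp: cinfinite_def in_underS_iff)

lemma le_star_iff:
  assumes "f \<in> prd" "g \<in> prd"
  shows "le_star (cf \<mu>) m f g \<longleftrightarrow> (\<forall>\<^sub>F i in tail (cf \<mu>). i \<in> Field (cf \<mu>) \<longrightarrow> (f i, g i) \<in> m i)"
proof -
  have "(g i, f i) \<in> m i \<and> g i \<noteq> f i \<longleftrightarrow> (f i, g i) \<notin> m i" if i: "i \<in> Field (cf \<mu>)" for i
  proof -
    have F: "f i \<in> Field (m i)" "g i \<in> Field (m i)" using assms i by (auto simp: PiE_iff)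
    show ?thesis
      using Well_order_linear[OF S.m_Well_order[OF i] F] Well_order_antisym[OF S.m_Well_order[OF i]]
        Well_order_refl[OF S.m_Well_order[OF i] F(1)]
      by (auto simp: in_underS_iff)
  qed
  then have "le_star (cf \<mu>) m f g \<longleftrightarrow>
      (\<exists>j\<in>Field (cf \<mu>). \<forall>i\<in>Field (cf \<mu>). (f i, g i) \<notin> m i \<longrightarrow> (i, j) \<in> cf \<mu>)"
    by (auto simp: le_star_def bounded_in_def)
  also have "\<dots> \<longleftrightarrow> (\<exists>j\<in>Field (cf \<mu>). \<forall>i. j \<in> underS (cf \<mu>) i \<longrightarrow> i \<in> Field (cf \<mu>) \<longrightarrow> (f i, g i) \<in> m i)"
  proof (intro bex_cong refl)
    fix j assume j: "j \<in> Field (cf \<mu>)"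
    have "(i, j) \<notin> cf \<mu> \<longleftrightarrow> j \<in> underS (cf \<mu>) i" if "i \<in> Field (cf \<mu>)" for i
      using Well_order_linear[OF S.wk that j] Well_order_antisym[OF S.wk] by (auto simp: in_underS_iff)
    then show "(\<forall>i\<in>Field (cf \<mu>). (f i, g i) \<notin> m i \<longrightarrow> (i, j) \<in> cf \<mu>) \<longleftrightarrow>
        (\<forall>i. j \<in> underS (cf \<mu>) i \<longrightarrow> i \<in> Field (cf \<mu>) \<longrightarrow> (f i, g i) \<in> m i)" by blast
  qed
  finally show ?thesis by (simp add: S.ev_tail)
qed

text \<open>Raising a bound strictly at every coordinate shows that the whole product is unbounded,
  so the minimum defining the bounding number is over a nonempty set.\<close>

lemma
  shows Card_order_seq_b: "Card_order (seq_b m)"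
    and seq_b_attained: "\<exists>B. B \<subseteq> prd \<and> \<not> (\<exists>p\<in>prd. \<forall>x\<in>B. le_star (cf \<mu>) m x p) \<and> |B| =o seq_b m"
    and seq_b_bound: "B \<subseteq> prd \<Longrightarrow> |B| <o seq_b m \<Longrightarrow> \<exists>p\<in>prd. \<forall>x\<in>B. le_star (cf \<mu>) m x p"
proof -
  define U where "U B \<longleftrightarrow> B \<subseteq> prd \<and> \<not> (\<exists>p\<in>prd. \<forall>x\<in>B. le_star (cf \<mu>) m x p)" for B
  define R where "R = {|B| | B. U B}"
  have b: "seq_b m = cmin R" by (simp add: bounding_number_def U_def R_def)
  have "U prd" unfolding U_def
  proof (intro conjI notI subset_refl)
    assume "\<exists>p\<in>prd. \<forall>x\<in>prd. le_star (cf \<mu>) m x p"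
    then obtain p where p: "p \<in> prd" "\<forall>x\<in>prd. le_star (cf \<mu>) m x p" by blast
    then have "\<forall>i\<in>Field (cf \<mu>). \<exists>b\<in>Field (m i). p i \<in> underS (m i) b" using m_limit by (auto simp: PiE_iff)
    then obtain q where q: "\<And>i. i \<in> Field (cf \<mu>) \<Longrightarrow> q i \<in> Field (m i) \<and> p i \<in> underS (m i) (q i)" by metis
    let ?q = "restrict q (Field (cf \<mu>))"
    have q': "?q \<in> prd" using q by auto
    then have "\<forall>\<^sub>F i in tail (cf \<mu>). i \<in> Field (cf \<mu>) \<longrightarrow> (?q i, p i) \<in> m i"
      using p(2) le_star_iff[OF q' p(1)] by blast
    then obtain j where j: "j \<in> Field (cf \<mu>)"
      "\<And>i. j \<in> underS (cf \<mu>) i \<Longrightarrow> i \<in> Field (cf \<mu>) \<Longrightarrow> (?q i, p i) \<in> m i" by (auto simp: S.ev_tail)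
    obtain i where i: "j \<in> underS (cf \<mu>) i" using S.k_greater[OF j(1)] by blast
    have iF: "i \<in> Field (cf \<mu>)" using in_underS_Field[OF i] by blast
    have "(q i, p i) \<in> m i" using j(2)[OF i iF] iF by simp
    with q[OF iF] show False using Well_order_antisym[OF S.m_Well_order[OF iF]] by (auto simp: in_underS_iff)
  qed
  then have "|prd| \<in> R" by (auto simp: R_def)
  then have ne: "R \<noteq> {}" by blast
  have CR: "\<And>r. r \<in> R \<Longrightarrow> Card_order r" using card_of_Card_order by (auto simp: R_def)
  have c: "cmin R \<in> R" by (rule cmin_spec(1)[OF ne CR])
  then show "Card_order (seq_b m)" unfolding b by (rule CR)
  obtain B where "U B" "cmin R = |B|" using c by (auto simp: R_def)
  then show "\<exists>B. B \<subseteq> prd \<and> \<not> (\<exists>p\<in>prd. \<forall>x\<in>B. le_star (cf \<mu>) m x p) \<and> |B| =o seq_b m"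
    unfolding b U_def using card_of_refl[of B] by (intro exI[of _ B]) simp
  show "\<exists>p\<in>prd. \<forall>x\<in>B. le_star (cf \<mu>) m x p" if B: "B \<subseteq> prd" "|B| <o seq_b m" for B
  proof (rule ccontr)
    assume "\<not> ?thesis"
    then have "|B| \<in> R" using B(1) by (auto simp: U_def R_def)
    from cmin_spec(2)[OF ne CR this] have "seq_b m \<le>o |B|" unfolding b .
    with B(2) show False using not_ordLess_ordLeq by blast
  qed
qed

lemma small_bounded:
  assumes Y: "|\<Y>| <o seq_b m" "\<And>Y. Y \<in> \<Y> \<Longrightarrow> small (cf \<mu>) m Y"
  shows "\<exists>Z. small (cf \<mu>) m Z \<and> (\<forall>Y\<in>\<Y>. below (cf \<mu>) Y Z)"
proof -
  let ?K = "Field (cf \<mu>)"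
  have mne: "Field (m i) \<noteq> {}" if "i \<in> ?K" for i using S.m_Cinfinite[OF that] by (auto simp: cinfinite_def)
  \<comment> \<open>On coordinates where \<open>Y i\<close> is full the point is arbitrary; these
    coordinates are bounded in \<open>cf \<mu>\<close>.\<close>
  have "\<exists>a\<in>Field (m i). Y i \<noteq> Field (m i) \<longrightarrow> Y i = underS (m i) a" if "Y \<in> \<Y>" "i \<in> ?K" for Y i
    using S.initial_proper_bounded[OF that(2), of "Y i"] Y(2)[OF that(1)] that(2) mne[OF that(2)]
    by (auto simp: small_def initial_def)
  then obtain y where y: "\<And>Y i. Y \<in> \<Y> \<Longrightarrow> i \<in> ?K \<Longrightarrow>
      y Y i \<in> Field (m i) \<and> (Y i \<noteq> Field (m i) \<longrightarrow> Y i = underS (m i) (y Y i))" by metis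
  let ?y = "\<lambda>Y. restrict (y Y) ?K"
  have yP: "?y Y \<in> prd" if "Y \<in> \<Y>" for Y using y that by auto
  have "|?y ` \<Y>| <o seq_b m" using Y(1) by (rule card_of_image_ordLess)
  moreover have "?y ` \<Y> \<subseteq> prd" using yP by (rule image_subsetI)
  ultimately have "\<exists>p\<in>prd. \<forall>x\<in>?y ` \<Y>. le_star (cf \<mu>) m x p" by (intro seq_b_bound)
  then obtain p where p: "p \<in> prd" and le_p: "\<forall>x\<in>?y ` \<Y>. le_star (cf \<mu>) m x p" by (elim bexE)
  let ?Z = "\<lambda>i. under (m i) (p i)"
  have "ofilter (m i) (?Z i) \<and> ?Z i \<noteq> Field (m i)" if i: "i \<in> ?K" for i
  proof -
    have "p i \<in> Field (m i)" using p i by (auto simp: PiE_iff)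
    then obtain d where d: "d \<in> Field (m i)" "underS (m i) d = ?Z i"
      using Cinfinite_succ[OF S.m_Cinfinite[OF i]] by blast
    then show ?thesis using ofilter_underS[OF S.m_Well_order[OF i], of d] underS_notIn[of d "m i"] by metis
  qed
  then have "small (cf \<mu>) m ?Z"
    unfolding small_def initial_def by (auto intro: eventually_mono[OF S.ev_Field])
  moreover have "below (cf \<mu>) Y ?Z" if Y': "Y \<in> \<Y>" for Y
  proof -
    have "\<forall>\<^sub>F i in tail (cf \<mu>). i \<in> ?K \<longrightarrow> (?y Y i, p i) \<in> m i"
      using bspec[OF le_p imageI[OF Y']] le_star_iff[OF yP[OF Y'] p] by (rule iffD1[rotated])
    moreover have "\<forall>\<^sub>F i in tail (cf \<mu>). Y i \<noteq> Field (m i)" using Y(2)[OF Y'] by (simp add: small_def)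
    ultimately show ?thesis using S.ev_Field unfolding below_def
    proof eventually_elim
      case (elim i)
      then have "Y i = underS (m i) (y Y i)" "(y Y i, p i) \<in> m i" using y[OF Y'] by auto
      then show ?case using Well_order_trans[OF S.m_Well_order[OF elim(3)]]
        by (auto simp: in_underS_iff under_def)
    qed
  qed
  ultimately show ?thesis by blast
qed

text \<open>Fewer than \<open>\<mu>\<close> functions are bounded coordinatewise by regularity of
  \<open>m i\<close>, as soon as \<open>m i\<close> exceeds their number.\<close>

lemma seq_b_ge: "\<mu> \<le>o seq_b m"
proof (rule ccontr)
  let ?K = "Field (cf \<mu>)"
  assume "\<not> ?thesis"
  then have "seq_b m <o \<mu>" using not_ordLeq_iff_ordLess[OF Card_order_Well_order[OF Card_order_seq_b] w_mu] by blast
  obtain B where B: "B \<subseteq> prd" "\<not> (\<exists>p\<in>prd. \<forall>x\<in>B. le_star (cf \<mu>) m x p)" "|B| =o seq_b m"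
    using seq_b_attained by blast
  have "|B| <o \<mu>" using B(3) \<open>seq_b m <o \<mu>\<close> ordIso_ordLess_trans by blast
  then have ev: "\<forall>\<^sub>F i in tail (cf \<mu>). |B| <o m i" by (rule S.ev_m_greater)
  have "\<exists>b\<in>Field (m i). |B| <o m i \<longrightarrow> (\<forall>x\<in>B. (x i, b) \<in> m i)" if i: "i \<in> ?K" for i
  proof (cases "|B| <o m i")
    case True
    have "(\<lambda>x. x i) ` B \<subseteq> Field (m i)" using B(1) i by (auto simp: PiE_iff)
    then obtain b where "b \<in> Field (m i)" "(\<lambda>x. x i) ` B \<subseteq> underS (m i) b"
      using regular_bounded[OF S.m_regular[OF i]] card_of_image_ordLess[OF True] by blast
    then show ?thesis by (intro bexI[of _ b]) (auto simp: in_underS_iff)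
  next
    case False
    moreover have "Field (m i) \<noteq> {}" using S.m_Cinfinite[OF i] by (auto simp: cinfinite_def)
    ultimately show ?thesis by blast
  qed
  then obtain p where p: "\<And>i. i \<in> ?K \<Longrightarrow> p i \<in> Field (m i) \<and> ( |B| <o m i \<longrightarrow> (\<forall>x\<in>B. (x i, p i) \<in> m i))"
    by metis
  let ?p = "restrict p ?K"
  have pP: "?p \<in> prd" using p by auto
  moreover have "le_star (cf \<mu>) m x ?p" if x: "x \<in> B" for x
  proof -
    have "\<forall>\<^sub>F i in tail (cf \<mu>). i \<in> ?K \<longrightarrow> (x i, ?p i) \<in> m i"
      using ev by (rule eventually_mono) (use p x in auto)
    then show ?thesis using le_star_iff[of x ?p] B(1) x pP by blast
  qed
  ultimately show False using B(2) by blast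
qed

end

end

subsection \<open>Approachability\<close>

text \<open>The assumption \<open>approachable\<close> of \<open>chain_setup\<close> as a predicate,
  so that \<open>Q\<close> can be constructed beforehand. Its conclusion asks for unboundedly many
  \<open>b\<close> only, since the suprema of initial parts are compared with the chain
  cofinally.\<close>

definition approaches :: "'i rel \<Rightarrow> 'b rel \<Rightarrow> ('b \<Rightarrow> 'b set set) \<Rightarrow> bool" where
  "approaches k l Q \<longleftrightarrow> (\<forall>S x. ofilter l S \<longrightarrow>
      (\<forall>y. y \<subseteq> S \<longrightarrow> |y| \<le>o k \<longrightarrow> (\<exists>b\<in>S. y \<subseteq> underS l b)) \<longrightarrow>
      unbounded_in l S x \<longrightarrow> |x| \<le>o cardSuc k \<longrightarrow>
      (\<exists>x. unbounded_in l S x \<and> (\<forall>a\<in>S. \<exists>b\<in>S. (a, b) \<in> l \<and> |x \<inter> underS l b| \<le>o k \<and>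
        (\<forall>d\<in>Field l. b \<in> underS l d \<longrightarrow> x \<inter> underS l b \<in> Q d))))"

text \<open>
  With \<open>|Field l|\<close> sets allowed at every stage, one thin unbounded set can be fixed in advance for
  each initial segment.
\<close>

lemma approaches_const:
  assumes l: "Cinfinite l" and k: "Cinfinite k"
  shows "\<exists>Q. approaches k l Q \<and> (\<forall>d. |Q d| \<le>o l)"
proof -
  have wl: "Well_order l" using l by (rule Cinfinite_Well_order)
  define thin where "thin S y \<longleftrightarrow> unbounded_in l S y \<and> (\<forall>b\<in>S. |y \<inter> underS l b| \<le>o k)" for S y
  define c where "c S = (SOME y. thin S y)" for S
  define O' where "O' = insert (Field l) (underS l ` Field l)"
  let ?Q = "(\<lambda>(S, b). c S \<inter> underS l b) ` (O' \<times> Field l)"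
  have "|O'| \<le>o l" unfolding O'_def
    using l card_of_Field_ordLeq by (intro card_of_insert_ordLeq card_of_image_ordLeq) auto
  then have "|O' \<times> Field l| \<le>o l"
    using l card_of_Field_ordLeq by (intro card_of_Times_ordLeq_infinite_Field) (auto simp: cinfinite_def)
  then have "|?Q| \<le>o l" by (rule card_of_image_ordLeq)
  moreover have "approaches k l (\<lambda>_. ?Q)" unfolding approaches_def
  proof (intro allI impI)
    fix S x assume S: "ofilter l S" and x: "unbounded_in l S x" "|x| \<le>o cardSuc k"
    have "\<exists>y. thin S y" using unbounded_in_thin[OF wl S k x] by (simp add: thin_def)
    then have c: "thin S (c S)" unfolding c_def by (rule someI_ex)
    have "S \<in> O'" using wo_rel.ofilter_underS_Field[of l S] S wl by (auto simp: O'_def wo_rel_def)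
    then have Q: "c S \<inter> underS l b \<in> ?Q" if "b \<in> S" for b
      using that ofilter_subset_Field[OF S] by (intro image_eqI[of _ _ "(S, b)"]) auto
    show "\<exists>x. unbounded_in l S x \<and> (\<forall>a\<in>S. \<exists>b\<in>S. (a, b) \<in> l \<and> |x \<inter> underS l b| \<le>o k \<and>
        (\<forall>d\<in>Field l. b \<in> underS l d \<longrightarrow> x \<inter> underS l b \<in> ?Q))"
    proof (intro exI[of _ "c S"] conjI ballI)
      show "unbounded_in l S (c S)" using c by (simp add: thin_def)
      fix a assume a: "a \<in> S"
      have "(a, a) \<in> l" using a ofilter_subset_Field[OF S] Well_order_refl[OF wl] by blast
      moreover have "|c S \<inter> underS l a| \<le>o k" using c a by (simp add: thin_def)
      ultimately show "\<exists>b\<in>S. (a, b) \<in> l \<and> |c S \<inter> underS l b| \<le>o k \<and>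
        (\<forall>d\<in>Field l. b \<in> underS l d \<longrightarrow> c S \<inter> underS l b \<in> ?Q)" using a Q by blast
    qed
  qed
  ultimately show ?thesis by blast
qed

lemma underS_subset_Field: "underS r a \<subseteq> Field r"
  using in_underS_Field by fast

lemma underS_mono: "Well_order r \<Longrightarrow> b \<in> underS r c \<Longrightarrow> underS r b \<subseteq> underS r c"
  using underS_trans2[of r _ b c] by (auto simp: in_underS_iff[of b r c])

lemma iso_segment:
  assumes l: "Well_order l" and \<nu>: "Well_order \<nu>" and A: "A \<subseteq> Field l" and z: "z \<in> Field \<nu>"
    and \<phi>: "bij_betw \<phi> A (underS \<nu> z)"
    and ord: "\<And>a b. a \<in> A \<Longrightarrow> b \<in> A \<Longrightarrow> (a, b) \<in> l \<longleftrightarrow> (\<phi> a, \<phi> b) \<in> \<nu>" and a: "a \<in> A"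
  shows "Restr l (A \<inter> underS l a) =o Restr \<nu> (underS \<nu> (\<phi> a))"
proof -
  let ?A = "A \<inter> underS l a" and ?B = "underS \<nu> (\<phi> a)"
  have w1: "well_order_on ?A (Restr l ?A)" using A by (intro well_order_on_Restr[OF l]) blast
  have w2: "well_order_on ?B (Restr \<nu> ?B)" by (rule well_order_on_Restr[OF \<nu> underS_subset_Field])
  have F: "Field (Restr l ?A) = ?A" "Field (Restr \<nu> ?B) = ?B"
    using w1 w2 well_order_on_Well_order by blast+
  have inj: "inj_on \<phi> A" using \<phi> by (simp add: bij_betw_def)
  have "\<phi> ` ?A = ?B"
  proof
    show "\<phi> ` ?A \<subseteq> ?B" using ord a inj by (auto simp: in_underS_iff inj_on_def)
    show "?B \<subseteq> \<phi> ` ?A"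
    proof
      fix y assume y: "y \<in> ?B"
      have "\<phi> a \<in> underS \<nu> z" using \<phi> a by (auto simp: bij_betw_def)
      then have "y \<in> underS \<nu> z" using y underS_trans1[OF \<nu>] by (auto simp: in_underS_iff)
      then obtain b where b: "b \<in> A" "y = \<phi> b" using \<phi> by (auto simp: bij_betw_def)
      then have "b \<in> underS l a" using y ord[OF b(1) a] by (auto simp: in_underS_iff)
      with b show "y \<in> \<phi> ` ?A" by blast
    qed
  qed
  then have "bij_betw \<phi> ?A ?B" using inj by (auto simp: bij_betw_def intro: inj_on_subset)
  moreover have "(b, c) \<in> Restr l ?A \<longleftrightarrow> (\<phi> b, \<phi> c) \<in> Restr \<nu> ?B" if "b \<in> ?A" "c \<in> ?A" for b c
    using that ord[of b c] \<open>\<phi> ` ?A = ?B\<close> by blast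
  ultimately have "iso (Restr l ?A) (Restr \<nu> ?B) \<phi>" unfolding iso_iff2 F by blast
  moreover have "Well_order (Restr l ?A)" "Well_order (Restr \<nu> ?B)"
    using w1 w2 well_order_on_Well_order by blast+
  ultimately show ?thesis unfolding ordIso_def by blast
qed

text \<open>
  Below the successor of a regular \<open>\<nu>\<close>, each \<open>b\<close> is an increasing union of sets \<open>a b z\<close> of size
  less than \<open>\<nu>\<close> that cohere along a given small unbounded set. Transporting a fixed unbounded
  subset \<open>c e\<close> of the order type \<open>e\<close> of \<open>a b z\<close> leaves only \<open>\<nu>\<close> candidates at every stage.
\<close>

lemma approaches_successor:
  assumes l: "Cinfinite l" "l =o cardSuc \<nu>" and \<nu>: "regular_card \<nu>"
    and k: "Cinfinite k" and kn: "cardSuc k <o \<nu>"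
  shows "\<exists>Q. approaches k l Q \<and> (\<forall>d\<in>Field l. |Q d| \<le>o \<nu>)"
proof -
  have c\<nu>: "Cinfinite \<nu>" using \<nu> by (simp add: regular_card_def)
  have wl: "Well_order l" and w\<nu>: "Well_order \<nu>" using l(1) c\<nu> Cinfinite_Well_order by auto
  have reg_l: "regular_card l"
    using regularCard_ordIso[OF ordIso_symmetric[OF l(2)]] Cinfinite_cardSuc[OF c\<nu>]
      regularCard_cardSuc[OF c\<nu>] l(1) by (simp add: regular_card_def)
  have nat\<nu>: "natLeq <o \<nu>"
    using natLeq_ordLeq_cinfinite[OF Cinfinite_cardSuc[OF k]] kn ordLeq_ordLess_trans by blast
  have under_card: "|underS l b| \<le>o \<nu>" if b: "b \<in> Field l" for b
  proof -
    have "|underS l b| <o cardSuc \<nu>"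
      using card_of_underS[OF _ b] l ordLess_ordIso_trans by blast
    then show ?thesis using cardSuc_ordLeq_ordLess[of \<nu>] c\<nu> card_of_Card_order by blast
  qed
  have "\<exists>e. inj_on e (underS l b) \<and> e ` underS l b \<subseteq> Field \<nu>" if "b \<in> Field l" for b
  proof -
    have "|underS l b| \<le>o |Field \<nu>|"
      using under_card[OF that] ordLeq_card_of_Field c\<nu> ordLeq_transitive by blast
    then show ?thesis using card_of_ordLeq by blast
  qed
  then obtain e where e: "\<And>b. b \<in> Field l \<Longrightarrow> inj_on (e b) (underS l b)"
    "\<And>b. b \<in> Field l \<Longrightarrow> e b ` underS l b \<subseteq> Field \<nu>" by metis
  \<comment> \<open>The filtration of \<open>underS l b\<close> by a fixed injection into
    \<open>\<nu>\<close>: points with index below \<open>z\<close>, fewer than \<open>\<nu>\<close>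
    many for each \<open>z\<close> in \<open>Field \<nu>\<close>.\<close>
  define a where "a b z = {c \<in> underS l b. e b c \<in> underS \<nu> z}" for b z
  define thin where "thin z c \<longleftrightarrow> unbounded_in \<nu> (underS \<nu> z) c \<and>
      (\<forall>w\<in>underS \<nu> z. |c \<inter> underS \<nu> w| \<le>o k)" for z c
  define c where "c z = (SOME y. thin z y)" for z
  \<comment> \<open>Reconstructs a set from three points: the elements of \<open>a b z\<close> whose
    position in it, measured as an order type, belongs to \<open>c w\<close>. Hence at most
    \<open>\<nu>\<close> candidates per stage.\<close>
  define f where "f = (\<lambda>(b, z, w). {x \<in> a b z. \<exists>u\<in> c w \<inter> Field \<nu>.
      Restr l (a b z \<inter> underS l x) =o Restr \<nu> (underS \<nu> u)})"
  define Q where "Q d = f ` (underS l d \<times> Field \<nu> \<times> Field \<nu>)" for d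
  have "|Q d| \<le>o \<nu>" if d: "d \<in> Field l" for d
    unfolding Q_def using c\<nu> card_of_Field_ordLeq under_card[OF d]
    by (intro card_of_image_ordLeq card_of_Times_ordLeq_infinite_Field) (auto simp: cinfinite_def)
  moreover have "approaches k l Q" unfolding approaches_def
  proof (intro allI impI)
    fix S x
    assume S: "ofilter l S" and bd: "\<forall>y. y \<subseteq> S \<longrightarrow> |y| \<le>o k \<longrightarrow> (\<exists>b\<in>S. y \<subseteq> underS l b)"
      and x: "unbounded_in l S x" "|x| \<le>o cardSuc k"
    have SF: "S \<subseteq> Field l" using S by (rule ofilter_subset_Field)
    have xS: "x \<subseteq> S" using x(1) by (simp add: unbounded_in_def)
    have x\<nu>: "|x| <o \<nu>" using x(2) kn ordLeq_ordLess_trans by blast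
    \<comment> \<open>\<open>l\<close> is regular and \<open>x\<close> has size below
      \<open>\<nu>\<close>, so \<open>S\<close> is a proper segment, with an endpoint
      \<open>\<delta>\<close> whose injection \<open>e \<delta>\<close> indexes
      \<open>S\<close>.\<close>
    have "S \<noteq> Field l"
    proof
      assume SF: "S = Field l"
      have "|x| <o l"
        using x\<nu> cardSuc_greater c\<nu> ordIso_symmetric[OF l(2)] ordLess_transitive ordLess_ordIso_trans by blast
      then obtain b where b: "b \<in> Field l" "x \<subseteq> underS l b" using regular_bounded[OF reg_l] xS SF by blast
      then obtain b' where "b' \<in> x" "(b, b') \<in> l" using x(1) SF by (auto simp: unbounded_in_def)
      with b(2) show False using Well_order_antisym[OF wl, of b b'] by (fastforce simp: in_underS_iff)
    qed
    then obtain \<delta> where \<delta>: "\<delta> \<in> Field l" "S = underS l \<delta>"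
      using wo_rel.ofilter_underS_Field[of l S] S wl by (auto simp: wo_rel_def)
    define i where "i b w = inv_into (underS l b) (e b) w" for b w
    \<comment> \<open>For an index \<open>w\<close>, its translations between
      \<open>e \<delta>\<close> and \<open>e b\<close> for all \<open>b\<close> in \<open>x\<close>.
      Closing \<open>z\<close> under them makes \<open>a b z\<close> and \<open>a \<delta> z\<close>
      agree below \<open>b\<close>. Where \<open>w\<close> is no index, \<open>i\<close> is
      arbitrary; the intersection with \<open>Field \<nu>\<close> keeps stray values in
      range.\<close>
    define T where "T w = ((\<lambda>b. e b (i \<delta> w)) ` x \<union> (\<lambda>b. e \<delta> (i b w)) ` x) \<inter> Field \<nu>" for w
    have "\<exists>g\<in>Field \<nu>. T w \<subseteq> underS \<nu> g" for w
    proof (rule regular_bounded[OF \<nu>])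
      have "|(\<lambda>b. e b (i \<delta> w)) ` x \<union> (\<lambda>b. e \<delta> (i b w)) ` x| <o \<nu>"
        using c\<nu> x\<nu> card_of_image_ordLess by (intro card_of_Un_ordLess) blast+
      then show "|T w| <o \<nu>" unfolding T_def by (rule card_of_subset_ordLess[rotated]) blast
    qed (simp add: T_def)
    then obtain G where G: "\<And>w. G w \<in> Field \<nu>" "\<And>w. T w \<subseteq> underS \<nu> (G w)" by metis
    have "e \<delta> ` x \<subseteq> Field \<nu>" using e(2)[OF \<delta>(1)] xS \<delta>(2) by blast
    then obtain z0 where z0: "z0 \<in> Field \<nu>" "e \<delta> ` x \<subseteq> underS \<nu> z0"
      using regular_bounded[OF \<nu> _ card_of_image_ordLess[OF x\<nu>]] by blast
    obtain z where z: "z \<in> Field \<nu>" "z0 \<in> underS \<nu> z" "\<And>w. w \<in> underS \<nu> z \<Longrightarrow> G w \<in> underS \<nu> z"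
      using regular_closed_point[OF \<nu> nat\<nu> z0(1), of G] G(1) by blast
    have Tz: "v \<in> underS \<nu> z" if "w \<in> underS \<nu> z" "v \<in> T w" for v w
    proof -
      have "v \<in> underS \<nu> (G w)" using G(2) that(2) by blast
      moreover have "(G w, z) \<in> \<nu>" using z(3)[OF that(1)] by (simp add: in_underS_iff)
      ultimately show ?thesis by (rule underS_trans2[OF w\<nu>])
    qed
    let ?A = "a \<delta> z"
    have xA: "x \<subseteq> ?A"
    proof
      fix b assume b: "b \<in> x"
      then have "e \<delta> b \<in> underS \<nu> z0" using z0(2) by blast
      then have "e \<delta> b \<in> underS \<nu> z" using underS_trans1[OF w\<nu> _ z(2)] by (simp add: in_underS_iff)
      then show "b \<in> ?A" using b xS \<delta>(2) by (auto simp: a_def)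
    qed
    have coh: "a b z = ?A \<inter> underS l b" if b: "b \<in> x" for b
    proof -
      have bS: "b \<in> underS l \<delta>" and bF: "b \<in> Field l" using b xS \<delta>(2) SF by auto
      have "e b d \<in> underS \<nu> z \<longleftrightarrow> e \<delta> d \<in> underS \<nu> z" if d: "d \<in> underS l b" for d
      proof -
        have d\<delta>: "d \<in> underS l \<delta>" using d underS_mono[OF wl bS] by blast
        have F: "e b d \<in> Field \<nu>" "e \<delta> d \<in> Field \<nu>"
          using subsetD[OF e(2)[OF bF] imageI[OF d]] subsetD[OF e(2)[OF \<delta>(1)] imageI[OF d\<delta>]] by simp_all
        have inv: "i b (e b d) = d" "i \<delta> (e \<delta> d) = d"
          unfolding i_def using inv_into_f_f[OF e(1)[OF bF] d] inv_into_f_f[OF e(1)[OF \<delta>(1)] d\<delta>] by simp_all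
        have "e b d \<in> (\<lambda>b. e b (i \<delta> (e \<delta> d))) ` x" "e \<delta> d \<in> (\<lambda>b'. e \<delta> (i b' (e b d))) ` x"
          using b inv by (auto intro!: image_eqI[of _ _ b])
        then have "e b d \<in> T (e \<delta> d)" "e \<delta> d \<in> T (e b d)" unfolding T_def using F by simp_all
        then show ?thesis using Tz[of "e b d" "e \<delta> d"] Tz[of "e \<delta> d" "e b d"] by blast
      qed
      moreover have "underS l b \<subseteq> underS l \<delta>" using bS by (rule underS_mono[OF wl])
      ultimately show ?thesis by (auto simp: a_def)
    qed
    have AF: "?A \<subseteq> Field l" using \<delta>(2) SF by (auto simp: a_def)
    have "|?A| <o \<nu>"
    proof -
      have "inj_on (e \<delta>) ?A" by (rule inj_on_subset[OF e(1)[OF \<delta>(1)]]) (auto simp: a_def)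
      moreover have "e \<delta> ` ?A \<subseteq> underS \<nu> z" by (auto simp: a_def)
      ultimately have "|?A| \<le>o |underS \<nu> z|" using card_of_ordLeq by blast
      moreover have "|underS \<nu> z| <o \<nu>" using card_of_underS[OF _ z(1)] c\<nu> by blast
      ultimately show ?thesis by (rule ordLeq_ordLess_trans)
    qed
    have wA: "well_order_on ?A (Restr l ?A)" by (rule well_order_on_Restr[OF wl AF])
    then have WA: "Well_order (Restr l ?A)" and FA: "Field (Restr l ?A) = ?A"
      using well_order_on_Well_order by blast+
    \<comment> \<open>\<open>a \<delta> z\<close> has fewer than \<open>\<nu>\<close> points, so its
      order type is some \<open>\<eta>\<close> in \<open>\<nu>\<close>, and the set
      \<open>c \<eta>\<close> fixed in advance can be carried back along the isomorphism
      \<open>\<phi>\<close>.\<close>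
    have "\<not> \<nu> \<le>o Restr l ?A"
    proof
      assume "\<nu> \<le>o Restr l ?A"
      then have "|Field \<nu>| \<le>o |?A|" using card_of_mono2 FA by metis
      then have "\<nu> \<le>o |?A|" using ordLeq_card_of_Field c\<nu> ordLeq_transitive by blast
      with \<open>|?A| <o \<nu>\<close> show False using not_ordLess_ordLeq by blast
    qed
    then have "Restr l ?A <o \<nu>" using not_ordLeq_iff_ordLess[OF WA w\<nu>] by blast
    then obtain \<eta> where \<eta>: "\<eta> \<in> Field \<nu>" "Restr l ?A =o Restr \<nu> (underS \<nu> \<eta>)"
      using ordLess_iff_ordIso_Restr[OF w\<nu> WA] by blast
    then obtain \<phi> where iso: "iso (Restr l ?A) (Restr \<nu> (underS \<nu> \<eta>)) \<phi>" unfolding ordIso_def by blast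
    have F\<eta>: "Field (Restr \<nu> (underS \<nu> \<eta>)) = underS \<nu> \<eta>"
      using well_order_on_Well_order[OF well_order_on_Restr[OF w\<nu> underS_subset_Field]] by metis
    have \<phi>: "bij_betw \<phi> ?A (underS \<nu> \<eta>)" using iso unfolding iso_iff2 FA F\<eta> by blast
    have \<phi>in: "\<phi> b \<in> underS \<nu> \<eta>" if "b \<in> ?A" for b using \<phi> that by (auto simp: bij_betw_def)
    have ord: "(b, d) \<in> l \<longleftrightarrow> (\<phi> b, \<phi> d) \<in> \<nu>" if "b \<in> ?A" "d \<in> ?A" for b d
    proof -
      have "(b, d) \<in> Restr l ?A \<longleftrightarrow> (\<phi> b, \<phi> d) \<in> Restr \<nu> (underS \<nu> \<eta>)"
        using iso that unfolding iso_iff2 FA by blast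
      then show ?thesis using that \<phi>in by simp
    qed
    have "unbounded_in \<nu> (underS \<nu> \<eta>) (\<phi> ` x)" unfolding unbounded_in_def
    proof (intro conjI ballI)
      show "\<phi> ` x \<subseteq> underS \<nu> \<eta>" using xA \<phi>in by blast
      fix w assume "w \<in> underS \<nu> \<eta>"
      then obtain b where b: "b \<in> ?A" "w = \<phi> b" using \<phi> by (auto simp: bij_betw_def)
      then have "b \<in> S" using \<delta>(2) by (simp add: a_def)
      then obtain d where d: "d \<in> x" "(b, d) \<in> l" using x(1) by (auto simp: unbounded_in_def)
      then have "(w, \<phi> d) \<in> \<nu>" using ord[OF b(1)] xA b(2) by blast
      with d(1) show "\<exists>v\<in>\<phi> ` x. (w, v) \<in> \<nu>" by blast
    qed
    then have "\<exists>y. thin \<eta> y"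
      using unbounded_in_thin[OF w\<nu> ofilter_underS[OF w\<nu>] k _ card_of_image_ordLeq[OF x(2)]]
      by (simp add: thin_def)
    then have c\<eta>: "thin \<eta> (c \<eta>)" unfolding c_def by (rule someI_ex)
    define X where "X = {b \<in> ?A. \<phi> b \<in> c \<eta>}"
    have unb: "unbounded_in l S X" unfolding unbounded_in_def
    proof (intro conjI ballI)
      show "X \<subseteq> S" using \<delta>(2) by (auto simp: X_def a_def)
      fix b assume "b \<in> S"
      then obtain d where d: "d \<in> x" "(b, d) \<in> l" using x(1) by (auto simp: unbounded_in_def)
      have dA: "d \<in> ?A" using d(1) xA by blast
      have "\<forall>v\<in>underS \<nu> \<eta>. \<exists>w\<in> c \<eta>. (v, w) \<in> \<nu>"
        using c\<eta> by (simp add: thin_def unbounded_in_def)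
      from bspec[OF this \<phi>in[OF dA]] obtain w where w: "w \<in> c \<eta>" "(\<phi> d, w) \<in> \<nu>" by blast
      have "w \<in> underS \<nu> \<eta>" using w(1) c\<eta> by (auto simp: thin_def unbounded_in_def)
      then obtain d' where d': "d' \<in> ?A" "w = \<phi> d'" using \<phi> by (auto simp: bij_betw_def)
      have "(d, d') \<in> l" using ord[OF dA d'(1)] w(2) d'(2) by blast
      then have "(b, d') \<in> l" using d(2) Well_order_trans[OF wl] by blast
      moreover have "d' \<in> X" using d' w(1) by (simp add: X_def)
      ultimately show "\<exists>b'\<in>X. (b, b') \<in> l" by blast
    qed
    have X_card: "|X \<inter> underS l b| \<le>o k" if b: "b \<in> x" for b
    proof -
      have bA: "b \<in> ?A" using b xA by blast
      have "\<phi> ` (X \<inter> underS l b) \<subseteq> c \<eta> \<inter> underS \<nu> (\<phi> b)"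
        using ord bA \<phi> by (auto simp: X_def in_underS_iff bij_betw_def inj_on_def)
      moreover have "inj_on \<phi> (X \<inter> underS l b)"
        using \<phi> by (auto simp: X_def bij_betw_def intro: inj_on_subset)
      ultimately have "|X \<inter> underS l b| \<le>o |c \<eta> \<inter> underS \<nu> (\<phi> b)|" using card_of_ordLeq by blast
      moreover have "|c \<eta> \<inter> underS \<nu> (\<phi> b)| \<le>o k" using c\<eta> \<phi>in[OF bA] by (simp add: thin_def)
      ultimately show ?thesis by (rule ordLeq_transitive)
    qed
    \<comment> \<open>By coherence the position of \<open>y\<close> in \<open>a b z\<close> equals
      its position in \<open>a \<delta> z\<close>, which is \<open>\<phi> y\<close>. So the part of
      \<open>X\<close> below \<open>b\<close> is one of the reconstructed candidates.\<close>
    have Xf: "X \<inter> underS l b = f (b, z, \<eta>)" if b: "b \<in> x" for b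
    proof -
      have bA: "b \<in> ?A" using b xA by blast
      have "\<phi> y \<in> c \<eta> \<longleftrightarrow> (\<exists>u\<in> c \<eta> \<inter> Field \<nu>. Restr l (a b z \<inter> underS l y) =o Restr \<nu> (underS \<nu> u))"
        if y: "y \<in> ?A" "y \<in> underS l b" for y
      proof -
        have "a b z \<inter> underS l y = ?A \<inter> underS l y"
          unfolding coh[OF b] using underS_mono[OF wl y(2)] by blast
        then have iso_y: "Restr l (a b z \<inter> underS l y) =o Restr \<nu> (underS \<nu> (\<phi> y))"
          using iso_segment[OF wl w\<nu> AF \<eta>(1) \<phi> ord y(1)] by simp
        have \<phi>F: "\<phi> y \<in> Field \<nu>" using \<phi>in[OF y(1)] by (simp add: in_underS_Field)
        show ?thesis
        proof
          assume "\<phi> y \<in> c \<eta>"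
          with iso_y \<phi>F show "\<exists>u\<in> c \<eta> \<inter> Field \<nu>. Restr l (a b z \<inter> underS l y) =o Restr \<nu> (underS \<nu> u)" by blast
        next
          assume "\<exists>u\<in> c \<eta> \<inter> Field \<nu>. Restr l (a b z \<inter> underS l y) =o Restr \<nu> (underS \<nu> u)"
          then obtain u where u: "u \<in> c \<eta>" "u \<in> Field \<nu>" "Restr l (a b z \<inter> underS l y) =o Restr \<nu> (underS \<nu> u)"
            by blast
          have "Restr \<nu> (underS \<nu> u) =o Restr \<nu> (underS \<nu> (\<phi> y))"
            using ordIso_transitive[OF ordIso_symmetric[OF u(3)] iso_y] .
          then have "u = \<phi> y" using Restr_underS_inj[OF w\<nu> u(2) \<phi>F] by blast
          with u(1) show "\<phi> y \<in> c \<eta>" by simp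
        qed
      qed
      then show ?thesis unfolding f_def X_def using coh[OF b] by auto
    qed
    show "\<exists>x. unbounded_in l S x \<and> (\<forall>a\<in>S. \<exists>b\<in>S. (a, b) \<in> l \<and> |x \<inter> underS l b| \<le>o k \<and>
        (\<forall>d\<in>Field l. b \<in> underS l d \<longrightarrow> x \<inter> underS l b \<in> Q d))"
    proof (intro exI[of _ X] conjI unb ballI)
      fix b' assume "b' \<in> S"
      then obtain b where b: "b \<in> x" "(b', b) \<in> l" using x(1) by (auto simp: unbounded_in_def)
      have "X \<inter> underS l b \<in> Q d" if "b \<in> underS l d" for d
        unfolding Q_def Xf[OF b(1)] using that z(1) \<eta>(1) by (intro imageI) simp
      then show "\<exists>b\<in>S. (b', b) \<in> l \<and> |X \<inter> underS l b| \<le>o k \<and>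
        (\<forall>d\<in>Field l. b \<in> underS l d \<longrightarrow> X \<inter> underS l b \<in> Q d)"
        using b X_card[OF b(1)] xS by blast
    qed
  qed
  ultimately show ?thesis by blast
qed

subsection \<open>Cardinalities of mad families\<close>

text \<open>Nontriviality supplies the lower bound \<open>cf \<mu>\<close>, which lets
  \<open>block_exists\<close> choose that many members of the family.\<close>

lemma a_num_attained:
  fixes \<mu> :: "'a rel"
  assumes sing: "singular_card \<mu>" and l: "a_num \<mu> \<le>o l"
  shows "\<exists>\<A> :: 'a set set. mad \<mu> \<A> \<and> cf \<mu> \<le>o |\<A>| \<and> |\<A>| \<le>o l"
proof -
  obtain \<A>0 :: "'a set set" where A0: "mad \<mu> \<A>0" "\<mu> \<le>o |\<A>0|"
    using mad_exists[OF Cinfinite_mu[OF sing]] by blast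
  have "cf \<mu> \<le>o |\<A>0|" using cf_less[OF sing] A0(2) ordLess_ordLeq_trans ordLess_imp_ordLeq by blast
  then have "\<not> trivial_family \<mu> \<A>0" unfolding trivial_family_def using not_ordLess_ordLeq by blast
  then have "|\<A>0| \<in> MAD \<mu>" using A0(1) by (auto simp: MAD_def)
  then have ne: "MAD \<mu> \<noteq> {}" by blast
  have CR: "\<And>r. r \<in> MAD \<mu> \<Longrightarrow> Card_order r" using card_of_Card_order by (auto simp: MAD_def)
  have "a_num \<mu> \<in> MAD \<mu>" unfolding a_num_def by (rule cmin_spec(1)[OF ne CR])
  then obtain \<A> :: "'a set set" where A: "a_num \<mu> = |\<A>|" "mad \<mu> \<A>" "\<not> |\<A>| <o cf \<mu>"
    by (auto simp: MAD_def trivial_family_def)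
  have "cf \<mu> \<le>o |\<A>|"
    using A(3) card_of_ordLess_or_ordLeq[OF Cinfinite_Well_order[OF Cinfinite_cf[OF sing]]] by blast
  with A l show ?thesis by auto
qed

lemma mem_MAD_of_sequence:
  fixes \<mu> :: "'a rel" and l :: "'b rel" and n :: "'n rel"
  assumes sing: "singular_card \<mu>" and m: "regular_seq (cf \<mu>) \<mu> m"
    and l: "Cinfinite l" "a_num \<mu> \<le>o l"
    and n: "Cinfinite n" "cf \<mu> \<le>o n" "n <o seq_b \<mu> m"
    and under: "\<And>d. d \<in> Field l \<Longrightarrow> |underS l d| \<le>o n"
    and Q: "approaches (cf \<mu>) l Q" "\<And>d. d \<in> Field l \<Longrightarrow> |Q d| \<le>o n"
  shows "l \<in>c MAD \<mu>"
proof -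
  obtain \<A> :: "'a set set" where A: "mad \<mu> \<A>" "cf \<mu> \<le>o |\<A>|" "|\<A>| \<le>o l"
    using a_num_attained[OF sing l(2)] by blast
  interpret chain_setup \<mu> "cf \<mu>" m l n Q
  proof (intro chain_setup.intro chain_setup_axioms.intro)
    show "singular_sequence \<mu> (cf \<mu>) m" by (rule singular_sequenceI[OF sing m])
    show "\<exists>Z. small (cf \<mu>) m Z \<and> (\<forall>Y\<in>\<Y>. below (cf \<mu>) Y Z)"
      if "|\<Y>| \<le>o n" "\<And>Y. Y \<in> \<Y> \<Longrightarrow> small (cf \<mu>) m Y" for \<Y>
      using that(2) by (rule small_bounded[OF sing m ordLeq_ordLess_trans[OF that(1) n(3)]])
    show "\<exists>x. unbounded_in l S x \<and> (\<forall>a\<in>S. \<exists>b\<in>S. (a, b) \<in> l \<and> |x \<inter> underS l b| \<le>o cf \<mu> \<and>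
        (\<forall>d\<in>Field l. b \<in> underS l d \<longrightarrow> x \<inter> underS l b \<in> Q d))"
      if "ofilter l S" "\<And>y. y \<subseteq> S \<Longrightarrow> |y| \<le>o cf \<mu> \<Longrightarrow> \<exists>b\<in>S. y \<subseteq> underS l b"
        "unbounded_in l S x" "|x| \<le>o cardSuc (cf \<mu>)" for S x
      using Q(1)[unfolded approaches_def, rule_format, OF that] .
  qed (use l n under Q(2) in blast)+
  obtain \<F> :: "('a \<times> 'a) set set" where F: "mad \<mu> \<F>" "|\<F>| =o l" using mad_of_length[OF A] by blast
  have "\<F> \<noteq> {}"
  proof
    assume "\<F> = {}"
    then have "finite (Field l)"
      using card_of_ordIso_finite_Field[of l "\<F>"] F(2) ordIso_symmetric l(1) by blast
    then show False using l(1) by (simp add: cinfinite_def)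
  qed
  then obtain \<G> :: "'a set set" where G: "mad \<mu> \<G>" "|\<G>| =o |\<F>|"
    using mad_transfer[OF F(1)] Cinfinite_mu[OF sing] by blast
  have Gl: "|\<G>| =o l" using G(2) F(2) by (rule ordIso_transitive)
  have "cf \<mu> \<le>o |\<G>|"
    using ordLeq_transitive[OF A(2,3)] ordIso_symmetric[OF Gl] ordLeq_ordIso_trans by blast
  then have "\<not> trivial_family \<mu> \<G>" unfolding trivial_family_def using not_ordLess_ordLeq by blast
  then have "|\<G>| \<in> MAD \<mu>" using G(1) by (auto simp: MAD_def)
  then show ?thesis unfolding cmem_def using ordIso_symmetric[OF Gl] by blast
qed

lemma b_num_alt: "b_num \<mu> = csup {seq_b \<mu> m | m. regular_seq (cf \<mu>) \<mu> m}"
  by (simp add: b_num_def)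

lemma Card_order_seq_b':
  "singular_card \<mu> \<Longrightarrow> r \<in> {seq_b \<mu> m | m. regular_seq (cf \<mu>) \<mu> m} \<Longrightarrow> Card_order r"
  using Card_order_seq_b by blast

text \<open>\<open>csup_least\<close> compares only cardinals on one type, so \<open>l\<close> is
  first copied to a set \<open>B\<close> of functions.\<close>

lemma less_b_num:
  fixes \<mu> :: "'a rel"
  assumes sing: "singular_card \<mu>" and l: "Card_order l" and lb: "l <o b_num \<mu>"
  shows "\<exists>m. regular_seq (cf \<mu>) \<mu> m \<and> l <o seq_b \<mu> m"
proof (rule ccontr)
  assume neg: "\<not> ?thesis"
  have "|Field l| <o b_num \<mu>" using card_of_Field_ordIso[OF l] lb ordIso_ordLess_trans by blast
  then obtain B :: "('a \<Rightarrow> 'a) set" where B: "|Field l| =o |B|" "|B| <o b_num \<mu>"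
    using internalize_card_of_ordLess by metis
  have lB: "l =o |B|"
    using ordIso_symmetric[OF card_of_Field_ordIso[OF l]] B(1) by (rule ordIso_transitive)
  have "b_num \<mu> \<le>o |B|" unfolding b_num_alt
  proof (rule csup_least[OF Card_order_seq_b'[OF sing] card_of_Card_order])
    fix r assume r: "r \<in> {seq_b \<mu> m | m. regular_seq (cf \<mu>) \<mu> m}"
    then have "\<not> l <o r" using neg by blast
    moreover have "Well_order r" "Well_order l"
      using Card_order_seq_b'[OF sing r] l Card_order_Well_order by blast+
    ultimately have "r \<le>o l" using not_ordLess_iff_ordLeq by blast
    then show "r \<le>o |B|" using lB by (rule ordLeq_ordIso_trans)
  qed
  with B(2) show False using not_ordLess_ordLeq by blast
qed

theorem theorem2p3:
  fixes \<mu> :: "'a rel" and l :: "'b rel"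
  assumes "singular_card \<mu>" and "Card_order l"
  shows "(a_num \<mu> \<le>o l \<and> l <o b_num \<mu> \<longrightarrow> l \<in>c MAD \<mu>) \<and>
    ((\<exists>\<nu> :: ('a \<Rightarrow> 'a) rel. regular_card \<nu> \<and> b_num \<mu> =o cardSuc \<nu>) \<and> a_num \<mu> \<le>o b_num \<mu> \<longrightarrow>
      b_num \<mu> \<in>c MAD \<mu>)"
proof (intro conjI impI)
  note sing = assms(1)
  assume "a_num \<mu> \<le>o l \<and> l <o b_num \<mu>"
  then have al: "a_num \<mu> \<le>o l" and lb: "l <o b_num \<mu>" by auto
  obtain \<A> :: "'a set set" where A: "mad \<mu> \<A>" "cf \<mu> \<le>o |\<A>|" "|\<A>| \<le>o l"
    using a_num_attained[OF sing al] by blast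
  \<comment> \<open>This makes \<open>l\<close> infinite; the chain is then built with
    \<open>n = l\<close>.\<close>
  have cl: "cf \<mu> \<le>o l" using A(2,3) by (rule ordLeq_transitive)
  have l: "Cinfinite l" using cinfinite_mono[OF cl] Cinfinite_cf[OF sing] assms(2) by blast
  from less_b_num[OF sing assms(2) lb] obtain m where m: "regular_seq (cf \<mu>) \<mu> m" "l <o seq_b \<mu> m" by blast
  obtain Q where Q: "approaches (cf \<mu>) l Q" "\<And>d. |Q d| \<le>o l"
    using approaches_const[OF l Cinfinite_cf[OF sing]] by blast
  show "l \<in>c MAD \<mu>"
  proof (rule mem_MAD_of_sequence[OF sing m(1) l al l cl m(2) _ Q])
    fix d assume "d \<in> Field l"
    then show "|underS l d| \<le>o l" using card_of_underS[of l d] assms(2) ordLess_imp_ordLeq by blast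
  qed
next
  note sing = assms(1)
  assume "(\<exists>\<nu> :: ('a \<Rightarrow> 'a) rel. regular_card \<nu> \<and> b_num \<mu> =o cardSuc \<nu>) \<and> a_num \<mu> \<le>o b_num \<mu>"
  then obtain \<nu> :: "('a \<Rightarrow> 'a) rel" where \<nu>: "regular_card \<nu>" "b_num \<mu> =o cardSuc \<nu>"
    and ab: "a_num \<mu> \<le>o b_num \<mu>" by blast
  have c\<nu>: "Cinfinite \<nu>" using \<nu>(1) by (simp add: regular_card_def)
  have b: "Cinfinite (b_num \<mu>)"
    using Cinfinite_cong[OF ordIso_symmetric[OF \<nu>(2)] Cinfinite_cardSuc[OF c\<nu>]] .
  have \<nu>b: "\<nu> <o b_num \<mu>" using cardSuc_greater c\<nu> ordIso_symmetric[OF \<nu>(2)] ordLess_ordIso_trans by blast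
  \<comment> \<open>A sequence with bounding number above \<open>\<nu>\<close> exists because the
    supremum is above \<open>\<nu>\<close>; each stage may then obey \<open>n = \<nu>\<close>
    requests.\<close>
  from less_b_num[OF sing conjunct2[OF c\<nu>] \<nu>b] obtain m
    where m: "regular_seq (cf \<mu>) \<mu> m" "\<nu> <o seq_b \<mu> m" by blast
  interpret singular_sequence \<mu> "cf \<mu>" m by (rule singular_sequenceI[OF sing m(1)])
  have "seq_b \<mu> m \<le>o b_num \<mu>" unfolding b_num_alt
  proof (rule csup_upper[OF Card_order_seq_b'[OF sing]])
    show "seq_b \<mu> m \<in> {seq_b \<mu> m | m. regular_seq (cf \<mu>) \<mu> m}"
      by (rule CollectI, rule exI, rule conjI, rule refl, rule m(1))
  qed
  then have \<mu>b: "\<mu> \<le>o cardSuc \<nu>"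
    using seq_b_ge[OF sing m(1)] \<nu>(2) ordLeq_transitive ordLeq_ordIso_trans by blast
  \<comment> \<open>\<open>\<mu>\<close> is a limit of the \<open>m i\<close>: if
    \<open>\<nu>\<close> were smaller, \<open>cardSuc \<nu>\<close> would be at most some
    \<open>m i\<close> and hence below \<open>\<mu>\<close>, against
    \<open>\<mu> \<le>o cardSuc \<nu>\<close>.\<close>
  have "\<mu> \<le>o \<nu>"
  proof (rule ccontr)
    assume "\<not> \<mu> \<le>o \<nu>"
    then have "\<nu> <o \<mu>"
      using not_ordLeq_iff_ordLess[OF Cinfinite_Well_order[OF c\<nu>] Cinfinite_Well_order[OF mu]] by blast
    then have "|Field \<nu>| <o \<mu>"
      using ordIso_ordLess_trans[OF card_of_Field_ordIso[OF conjunct2[OF c\<nu>]]] by blast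
    then obtain i where i: "i \<in> Field (cf \<mu>)" "|Field \<nu>| <o m i" using m_cofinal' by blast
    have "\<nu> <o m i" by (rule ordLeq_ordLess_trans[OF ordLeq_card_of_Field[OF conjunct2[OF c\<nu>]] i(2)])
    then have "cardSuc \<nu> \<le>o m i"
      by (rule cardSuc_least[OF conjunct2[OF c\<nu>] conjunct2[OF m_Cinfinite[OF i(1)]]])
    then have "cardSuc \<nu> <o \<mu>" using m_less[OF i(1)] ordLeq_ordLess_trans by blast
    with \<mu>b show False using not_ordLess_ordLeq by blast
  qed
  moreover obtain i where i: "i \<in> Field (cf \<mu>)" "cf \<mu> <o m i" using k_less_m by blast
  have "cardSuc (cf \<mu>) \<le>o m i"
    by (rule cardSuc_least[OF conjunct2[OF k] conjunct2[OF m_Cinfinite[OF i(1)]] i(2)])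
  then have "cardSuc (cf \<mu>) <o \<mu>" using m_less[OF i(1)] ordLeq_ordLess_trans by blast
  ultimately have k\<nu>: "cardSuc (cf \<mu>) <o \<nu>" using ordLess_ordLeq_trans by blast
  obtain Q where Q: "approaches (cf \<mu>) (b_num \<mu>) Q" "\<And>d. d \<in> Field (b_num \<mu>) \<Longrightarrow> |Q d| \<le>o \<nu>"
    using approaches_successor[OF b \<nu>(2,1) k k\<nu>] by blast
  have "cf \<mu> \<le>o \<nu>"
    by (rule ordLess_imp_ordLeq[OF ordLeq_ordLess_trans[OF cardSuc_ordLeq[OF conjunct2[OF k]] k\<nu>]])
  then show "b_num \<mu> \<in>c MAD \<mu>"
  proof (rule mem_MAD_of_sequence[OF sing m(1) b ab c\<nu> _ m(2) _ Q])
    fix d assume "d \<in> Field (b_num \<mu>)"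
    then have "|underS (b_num \<mu>) d| <o b_num \<mu>" by (rule card_of_underS[OF conjunct2[OF b]])
    from ordLess_ordIso_trans[OF this \<nu>(2)] show "|underS (b_num \<mu>) d| \<le>o \<nu>"
      by (rule iffD1[OF cardSuc_ordLeq_ordLess[OF conjunct2[OF c\<nu>] card_of_Card_order]])
  qed
qed

end
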